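(* Let $G$ be a non-amenable finitely generated virtually free group and let $X$ be its Bass–Serre tree. Then the $\mathrm{K}$-theory class $[p_1]$ of the first higher Kazhdan projection of $G$ satisfies $$-[p_1]=\sum_{v\in\,\mathrm{vert}\,G\backslash X}[\rho_v]\;-\sum_{e\in\,\mathrm{edge}\,G\backslash X}[\rho_e]\in \mathrm{K}_0(\mathrm{C}^*_{\mathrm{red}}(G)).$$
   Context: A finitely generated virtually free group is the fundamental group of a finite graph of finite groups (equivalently, an iterated HNN extension of a tree product of finitely many finite groups); its Bass–Serre tree $X$ is the associated tree, on which $G$ acts properly, cocompactly and without inversions. $\mathrm{vert}\,G\backslash X$ and $\mathrm{edge}\,G\backslash X$ are the finite sets of vertices and edges of the quotient graph. For a finite subgroup $H\le G$, $\rho_H=\frac1{|H|}\sum_{h\in H}h\in\mathbb{C}G\subseteq \mathrm{C}^*_{\mathrm{red}}(G)$ is the averaging projection; $\rho_v$ (resp. $\rho_e$) is $\rho_H$ for $H$ the isotropy group of a lift of $v$ (resp. $e$) to $X$ (its class does not depend on the lift, since isotropy groups of different lifts are conjugate). Higher Kazhdan projection $p_1$. The resolution $0\to\mathbb{C}[\mathrm{edge}\,X]\xrightarrow{\partial_0}\mathbb{C}[\mathrm{vert}\,X]\to\mathbb{C}\to0$ of the trivial module by finitely generated projective $\mathbb{C}G$-modules gives, after applying $\mathrm{Hom}_{\mathbb{C}G}(\cdot,\ell^2(G))$ (left regular representation), a complex of Hilbert spaces $C^0\xrightarrow{d_0}C^1\to0$, where $C^0\cong\bigoplus_v\rho_v\ell^2(G)$,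 $C^1\cong\bigoplus_e\rho_e\ell^2(G)$ and $d_0$ is given by a matrix over $\mathbb{C}G$. The Laplacian in degree 1 is $\Delta_1=d_0d_0^*$, and $p_1$ is the orthogonal projection of $C^1$ onto $\ker\Delta_1$. For non-amenable finitely generated virtually free $G$, $\Delta_1$ has a spectral gap at $0$ (its spectrum is contained in $\{0\}\cup[\varepsilon,\infty)$ for some $\varepsilon>0$), so $p_1$ lies in a corner of a matrix algebra over $\mathrm{C}^*_{\mathrm{red}}(G)$ and defines $[p_1]\in \mathrm{K}_0(\mathrm{C}^*_{\mathrm{red}}(G))$. *)

theory Defs
  imports
    "HOL-Analysis.Bounded_Linear_Function"
    "HOL-Analysis.Infinite_Sum"
    "HOL-Analysis.L2_Norm"
    "HOL-Algebra.Group_Action"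
    "HOL-Algebra.Generated_Groups"
    "Graph_Theory.Digraph"
    "Jordan_Normal_Form.Matrix"
begin

section \<open>Square-summable families and bounded operators on them\<close>

typedef 'i ell2 = "{f :: 'i \<Rightarrow> complex. (\<lambda>i. (cmod (f i))\<^sup>2) summable_on UNIV}"
  morphisms coord Abs_ell2
  by (rule exI[of _ "\<lambda>_. 0"]) simp

setup_lifting type_definition_ell2

lemma ell2_summable: "(\<lambda>i. (cmod (coord x i))\<^sup>2) summable_on UNIV"
  using coord[of x] by simp

lemma ell2_eqI: "(\<And>i. coord x i = coord y i) \<Longrightarrow> x = y"
  by (simp add: coord_inject[symmetric] ext)

lemma square_summable_bound:
  fixes f :: "'i \<Rightarrow> complex"
  assumes "\<And>F. finite F \<Longrightarrow> (\<Sum>i\<in>F. (cmod (f i))\<^sup>2) \<le> C"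
  shows "(\<lambda>i. (cmod (f i))\<^sup>2) summable_on UNIV" "(\<Sum>\<^sub>\<infinity>i. (cmod (f i))\<^sup>2) \<le> C"
proof -
  show s: "(\<lambda>i. (cmod (f i))\<^sup>2) summable_on UNIV"
    by (rule nonneg_bdd_above_summable_on) (auto intro!: bdd_aboveI2[where M = C] assms)
  show "(\<Sum>\<^sub>\<infinity>i. (cmod (f i))\<^sup>2) \<le> C"
    by (rule infsum_le_finite_sums[OF s]) (use assms in auto)
qed

lemma L2_set_le_ell2:
  assumes "(\<lambda>i. (cmod (f i))\<^sup>2) summable_on UNIV" "finite F"
  shows "L2_set (\<lambda>i. cmod (f i)) F \<le> sqrt (\<Sum>\<^sub>\<infinity>i. (cmod (f i))\<^sup>2)"
  unfolding L2_set_def using assms by (intro real_sqrt_le_mono finite_sum_le_infsum) auto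

lemma ell2_add_bound:
  fixes f g :: "'i \<Rightarrow> complex"
  assumes f: "(\<lambda>i. (cmod (f i))\<^sup>2) summable_on UNIV" and g: "(\<lambda>i. (cmod (g i))\<^sup>2) summable_on UNIV"
    and F: "finite F"
  shows "(\<Sum>i\<in>F. (cmod (f i + g i))\<^sup>2)
    \<le> (sqrt (\<Sum>\<^sub>\<infinity>i. (cmod (f i))\<^sup>2) + sqrt (\<Sum>\<^sub>\<infinity>i. (cmod (g i))\<^sup>2))\<^sup>2" (is "_ \<le> ?C\<^sup>2")
proof -
  have "L2_set (\<lambda>i. cmod (f i + g i)) F \<le> L2_set (\<lambda>i. cmod (f i) + cmod (g i)) F"
    by (intro L2_set_mono norm_triangle_ineq) auto
  also have "\<dots> \<le> L2_set (\<lambda>i. cmod (f i)) F + L2_set (\<lambda>i. cmod (g i)) F"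
    by (rule L2_set_triangle_ineq)
  also have "\<dots> \<le> ?C"
    by (intro add_mono L2_set_le_ell2 f g F)
  finally have "(L2_set (\<lambda>i. cmod (f i + g i)) F)\<^sup>2 \<le> ?C\<^sup>2"
    by (intro power_mono) auto
  then show ?thesis by (simp add: L2_set_def sum_nonneg)
qed

lemma square_summable_scale:
  fixes f :: "'i \<Rightarrow> complex"
  shows "(\<lambda>i. (cmod (f i))\<^sup>2) summable_on UNIV \<Longrightarrow> (\<lambda>i. (cmod (c * f i))\<^sup>2) summable_on UNIV"
  by (simp add: norm_mult power_mult_distrib summable_on_cmult_right)

lift_definition scaleC_ell2 :: "complex \<Rightarrow> 'i ell2 \<Rightarrow> 'i ell2" is "\<lambda>c f i. c * f i"
  by (rule square_summable_scale)

instantiation ell2 :: (type) real_normed_vector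
begin

lift_definition zero_ell2 :: "'a ell2" is "\<lambda>_. 0" by simp
lift_definition plus_ell2 :: "'a ell2 \<Rightarrow> 'a ell2 \<Rightarrow> 'a ell2" is "\<lambda>f g i. f i + g i"
  by (rule square_summable_bound(1)[OF ell2_add_bound])
lift_definition uminus_ell2 :: "'a ell2 \<Rightarrow> 'a ell2" is "\<lambda>f i. - f i" by simp
lift_definition minus_ell2 :: "'a ell2 \<Rightarrow> 'a ell2 \<Rightarrow> 'a ell2" is "\<lambda>f g i. f i - g i"
proof -
  fix f g :: "'a \<Rightarrow> complex"
  assume f: "(\<lambda>i. (cmod (f i))\<^sup>2) summable_on UNIV" and g: "(\<lambda>i. (cmod (g i))\<^sup>2) summable_on UNIV"
  have "(\<lambda>i. (cmod (- g i))\<^sup>2) summable_on UNIV" using g by simp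
  from square_summable_bound(1)[OF ell2_add_bound[OF f this]]
  show "(\<lambda>i. (cmod (f i - g i))\<^sup>2) summable_on UNIV" by simp
qed
lift_definition scaleR_ell2 :: "real \<Rightarrow> 'a ell2 \<Rightarrow> 'a ell2" is "\<lambda>r f i. r *\<^sub>R f i"
  unfolding scaleR_conv_of_real by (rule square_summable_scale)
lift_definition norm_ell2 :: "'a ell2 \<Rightarrow> real" is "\<lambda>f. sqrt (\<Sum>\<^sub>\<infinity>i. (cmod (f i))\<^sup>2)" .

definition sgn_ell2 :: "'a ell2 \<Rightarrow> 'a ell2" where "sgn_ell2 x = scaleR (inverse (norm x)) x"
definition dist_ell2 :: "'a ell2 \<Rightarrow> 'a ell2 \<Rightarrow> real" where "dist_ell2 x y = norm (x - y)"
definition uniformity_ell2 :: "('a ell2 \<times> 'a ell2) filter" where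
  "uniformity_ell2 = (INF e\<in>{0 <..}. principal {(x, y). dist x y < e})"
definition open_ell2 :: "'a ell2 set \<Rightarrow> bool" where
  "open_ell2 U = (\<forall>x\<in>U. eventually (\<lambda>(x', y). x' = x \<longrightarrow> y \<in> U) uniformity)"

instance
proof
  note coord_simps = plus_ell2.rep_eq zero_ell2.rep_eq uminus_ell2.rep_eq minus_ell2.rep_eq
    scaleR_ell2.rep_eq
  fix x y z :: "'a ell2" and a b r :: real
  show "x + y + z = x + (y + z)" by (rule ell2_eqI) (simp add: coord_simps)
  show "x + y = y + x" by (rule ell2_eqI) (simp add: coord_simps)
  show "0 + x = x" by (rule ell2_eqI) (simp add: coord_simps)
  show "- x + x = 0" by (rule ell2_eqI) (simp add: coord_simps)
  show "x - y = x + - y" by (rule ell2_eqI) (simp add: coord_simps)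
  show "a *\<^sub>R (x + y) = a *\<^sub>R x + a *\<^sub>R y" by (rule ell2_eqI) (simp add: coord_simps scaleR_add_right)
  show "(a + b) *\<^sub>R x = a *\<^sub>R x + b *\<^sub>R x" by (rule ell2_eqI) (simp add: coord_simps scaleR_add_left)
  show "a *\<^sub>R b *\<^sub>R x = (a * b) *\<^sub>R x" by (rule ell2_eqI) (simp add: coord_simps)
  show "1 *\<^sub>R x = x" by (rule ell2_eqI) (simp add: coord_simps)
  show "dist x y = norm (x - y)" by (rule dist_ell2_def)
  show "sgn x = scaleR (inverse (norm x)) x" by (rule sgn_ell2_def)
  show "uniformity = (INF e\<in>{0 <..}. principal {(x :: 'a ell2, y). dist x y < e})"
    by (rule uniformity_ell2_def)
  show "open U = (\<forall>x\<in>U. eventually (\<lambda>(x', y). x' = x \<longrightarrow> y \<in> U) uniformity)" for U :: "'a ell2 set"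
    by (rule open_ell2_def)
  show "norm x = 0 \<longleftrightarrow> x = 0"
  proof
    assume "norm x = 0"
    then have z: "(\<Sum>\<^sub>\<infinity>i. (cmod (coord x i))\<^sup>2) \<le> 0" by (simp add: norm_ell2.rep_eq)
    have "(cmod (coord x i))\<^sup>2 = 0" for i
      using nonneg_infsum_le_0D[OF z ell2_summable, of i] by simp
    then have "coord x i = 0" for i by simp
    then show "x = 0" by (intro ell2_eqI) (simp add: zero_ell2.rep_eq)
  qed (simp add: norm_ell2.rep_eq zero_ell2.rep_eq)
  show "norm (x + y) \<le> norm x + norm y"
    unfolding norm_ell2.rep_eq plus_ell2.rep_eq
  proof (rule real_le_lsqrt)
    show "(\<Sum>\<^sub>\<infinity>i. (cmod (coord x i + coord y i))\<^sup>2)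
        \<le> (sqrt (\<Sum>\<^sub>\<infinity>i. (cmod (coord x i))\<^sup>2) + sqrt (\<Sum>\<^sub>\<infinity>i. (cmod (coord y i))\<^sup>2))\<^sup>2"
      by (rule square_summable_bound(2)[OF ell2_add_bound[OF ell2_summable ell2_summable]])
    show "0 \<le> sqrt (\<Sum>\<^sub>\<infinity>i. (cmod (coord x i))\<^sup>2) + sqrt (\<Sum>\<^sub>\<infinity>i. (cmod (coord y i))\<^sup>2)"
      by (intro add_nonneg_nonneg real_sqrt_ge_zero infsum_nonneg zero_le_power2)
  qed
  have "(\<Sum>\<^sub>\<infinity>i. (cmod (r *\<^sub>R coord x i))\<^sup>2) = r\<^sup>2 * (\<Sum>\<^sub>\<infinity>i. (cmod (coord x i))\<^sup>2)"
    by (subst infsum_cmult_right'[symmetric]) (simp add: power_mult_distrib)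
  then show "norm (r *\<^sub>R x) = \<bar>r\<bar> * norm x"
    by (simp add: norm_ell2.rep_eq scaleR_ell2.rep_eq real_sqrt_mult)
qed

end

lemma norm_scaleC_ell2: "norm (scaleC_ell2 c x) = cmod c * norm x"
proof -
  have "(\<Sum>\<^sub>\<infinity>i. (cmod (c * coord x i))\<^sup>2) = (cmod c)\<^sup>2 * (\<Sum>\<^sub>\<infinity>i. (cmod (coord x i))\<^sup>2)"
    by (subst infsum_cmult_right'[symmetric]) (simp add: norm_mult power_mult_distrib)
  then show ?thesis
    by (simp add: norm_ell2.rep_eq scaleC_ell2.rep_eq real_sqrt_mult)
qed

lemma bounded_linear_scaleC: "bounded_linear (scaleC_ell2 c)"
proof (rule bounded_linear_intro[where K = "cmod c"])
  show "scaleC_ell2 c (x + y) = scaleC_ell2 c x + scaleC_ell2 c y" for x y :: "'a ell2"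
    by (rule ell2_eqI) (simp add: scaleC_ell2.rep_eq plus_ell2.rep_eq distrib_left)
  show "scaleC_ell2 c (r *\<^sub>R x) = r *\<^sub>R scaleC_ell2 c x" for r and x :: "'a ell2"
    by (rule ell2_eqI) (simp add: scaleC_ell2.rep_eq scaleR_ell2.rep_eq)
  show "norm (scaleC_ell2 c x) \<le> norm x * cmod c" for x :: "'a ell2"
    by (simp add: norm_scaleC_ell2)
qed

lifting_forget ell2.lifting

definition cinner :: "'i ell2 \<Rightarrow> 'i ell2 \<Rightarrow> complex" where
  "cinner x y = (\<Sum>\<^sub>\<infinity>i. cnj (coord x i) * coord y i)"

lemma cinner_abs_summable: "(\<lambda>i. cnj (coord x i) * coord y i) abs_summable_on UNIV"
proof (rule summable_on_comparison_test)
  show "(\<lambda>i. (cmod (coord x i))\<^sup>2 + (cmod (coord y i))\<^sup>2) summable_on UNIV"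
    by (intro summable_on_add ell2_summable)
  show "cmod (cnj (coord x i) * coord y i) \<le> (cmod (coord x i))\<^sup>2 + (cmod (coord y i))\<^sup>2" for i
  proof -
    have "0 \<le> cmod (coord x i) * cmod (coord y i)" by simp
    moreover have "2 * (cmod (coord x i) * cmod (coord y i)) \<le> (cmod (coord x i))\<^sup>2 + (cmod (coord y i))\<^sup>2"
      using sum_squares_bound[of "cmod (coord x i)" "cmod (coord y i)"] by (simp add: mult.assoc)
    ultimately show ?thesis by (simp only: norm_mult complex_mod_cnj)
  qed
qed auto

lemmas cinner_summable = abs_summable_summable[OF cinner_abs_summable]

lemma cinner_add_left: "cinner (x + y) z = cinner x z + cinner y z"
  unfolding cinner_def
  by (subst infsum_add[OF cinner_summable cinner_summable, symmetric])
    (simp add: plus_ell2.rep_eq distrib_right)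

lemma cinner_cnj: "cnj (cinner x y) = cinner y x"
  unfolding cinner_def infsum_cnj[symmetric] by (simp add: mult.commute)

lemma cinner_add_right: "cinner x (y + z) = cinner x y + cinner x z"
  by (metis cinner_cnj cinner_add_left complex_cnj_add)

lemma cinner_scaleC_right: "cinner x (scaleC_ell2 c y) = c * cinner x y"
  unfolding cinner_def scaleC_ell2.rep_eq
  by (subst infsum_cmult_right'[symmetric]) (simp add: mult.left_commute)

lemma cinner_scaleC_left: "cinner (scaleC_ell2 c x) y = cnj c * cinner x y"
  by (metis cinner_cnj cinner_scaleC_right complex_cnj_mult)

lemma scaleR_scaleC: "r *\<^sub>R x = scaleC_ell2 (of_real r) (x :: 'i ell2)"
  by (intro ell2_eqI) (simp add: scaleR_ell2.rep_eq scaleC_ell2.rep_eq scaleR_conv_of_real)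

lemma cinner_zero [simp]: "cinner 0 x = 0" "cinner x 0 = 0"
  by (simp_all add: cinner_def zero_ell2.rep_eq)

lemma cinner_minus_left: "cinner (- x) y = - cinner x y"
  using cinner_add_left[of x "- x" y] by (simp add: add_eq_0_iff)

lemma cinner_minus_right: "cinner x (- y) = - cinner x y"
  using cinner_add_right[of x y "- y"] by (simp add: add_eq_0_iff)

lemma cinner_self: "cinner x x = of_real ((norm x)\<^sup>2)"
proof -
  have "cinner x x = (\<Sum>\<^sub>\<infinity>i. of_real ((cmod (coord x i))\<^sup>2))"
    unfolding cinner_def
    by (intro infsum_cong) (simp only: complex_norm_square mult.commute)
  also have "\<dots> = of_real (\<Sum>\<^sub>\<infinity>i. (cmod (coord x i))\<^sup>2)"
    by (intro infsumI has_sum_of_real has_sum_infsum ell2_summable)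
  finally show ?thesis by (simp add: norm_ell2.rep_eq infsum_nonneg)
qed

lemma cinner_extensionality: "(\<And>x. cinner x y = cinner x z) \<Longrightarrow> y = z"
proof -
  assume h: "\<And>x. cinner x y = cinner x z"
  have "cinner (y - z) (y - z) = 0"
    using h[of "y - z"] by (simp only: diff_conv_add_uminus cinner_add_right cinner_minus_right) simp
  then show "y = z" by (simp add: cinner_self)
qed

text \<open>
  The C*-algebra of bounded operators. Only complex-linear operators have an adjoint for
  \<^const>\<open>cinner\<close>, and on a Hilbert space every bounded complex-linear operator has one, so
  adjointability picks out exactly the complex-linear elements of the real-linear function space.
\<close>

typedef 'i bop = "{T :: 'i ell2 \<Rightarrow>\<^sub>L 'i ell2.
    \<exists>S :: 'i ell2 \<Rightarrow>\<^sub>L 'i ell2. \<forall>x y. cinner (T x) y = cinner x (S y)}"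
  by (rule exI[of _ 0]) (auto intro!: exI[of _ 0])

setup_lifting type_definition_bop

lift_definition bop_apply :: "'i bop \<Rightarrow> 'i ell2 \<Rightarrow> 'i ell2" is blinfun_apply .

lemma bop_eqI: "(\<And>x. bop_apply S x = bop_apply T x) \<Longrightarrow> S = T"
  by transfer (auto intro: blinfun_eqI)

class star_ring = ring +
  fixes star :: "'a \<Rightarrow> 'a"
  assumes star_star: "star (star a) = a"
    and star_add: "star (a + b) = star a + star b"
    and star_mult: "star (a * b) = star b * star a"

instantiation bop :: (type) real_normed_algebra
begin

lift_definition zero_bop :: "'a bop" is 0 by (auto intro!: exI[of _ 0])
lift_definition plus_bop :: "'a bop \<Rightarrow> 'a bop \<Rightarrow> 'a bop" is "(+)"
proof -
  fix T T' :: "'a ell2 \<Rightarrow>\<^sub>L 'a ell2"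
  assume "\<exists>S :: 'a ell2 \<Rightarrow>\<^sub>L 'a ell2. \<forall>x y. cinner (T x) y = cinner x (S y)"
    "\<exists>S :: 'a ell2 \<Rightarrow>\<^sub>L 'a ell2. \<forall>x y. cinner (T' x) y = cinner x (S y)"
  then obtain S S' :: "'a ell2 \<Rightarrow>\<^sub>L 'a ell2"
    where "\<forall>x y. cinner (T x) y = cinner x (S y)" "\<forall>x y. cinner (T' x) y = cinner x (S' y)"
    by blast
  then show "\<exists>S :: 'a ell2 \<Rightarrow>\<^sub>L 'a ell2. \<forall>x y. cinner ((T + T') x) y = cinner x (S y)"
    by (intro exI[of _ "S + S'"]) (simp add: blinfun.add_left cinner_add_left cinner_add_right)
qed
lift_definition uminus_bop :: "'a bop \<Rightarrow> 'a bop" is "uminus"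
proof -
  fix T :: "'a ell2 \<Rightarrow>\<^sub>L 'a ell2"
  assume "\<exists>S :: 'a ell2 \<Rightarrow>\<^sub>L 'a ell2. \<forall>x y. cinner (T x) y = cinner x (S y)"
  then obtain S :: "'a ell2 \<Rightarrow>\<^sub>L 'a ell2" where "\<forall>x y. cinner (T x) y = cinner x (S y)"
    by blast
  then show "\<exists>S :: 'a ell2 \<Rightarrow>\<^sub>L 'a ell2. \<forall>x y. cinner ((- T) x) y = cinner x (S y)"
    by (intro exI[of _ "- S"]) (simp add: blinfun.minus_left cinner_minus_left cinner_minus_right)
qed
definition minus_bop :: "'a bop \<Rightarrow> 'a bop \<Rightarrow> 'a bop" where "minus_bop S T = S + - T"
lift_definition scaleR_bop :: "real \<Rightarrow> 'a bop \<Rightarrow> 'a bop" is "scaleR"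
proof -
  fix r and T :: "'a ell2 \<Rightarrow>\<^sub>L 'a ell2"
  assume "\<exists>S :: 'a ell2 \<Rightarrow>\<^sub>L 'a ell2. \<forall>x y. cinner (T x) y = cinner x (S y)"
  then obtain S :: "'a ell2 \<Rightarrow>\<^sub>L 'a ell2" where "\<forall>x y. cinner (T x) y = cinner x (S y)"
    by blast
  then show "\<exists>S :: 'a ell2 \<Rightarrow>\<^sub>L 'a ell2. \<forall>x y. cinner ((r *\<^sub>R T) x) y = cinner x (S y)"
    by (intro exI[of _ "r *\<^sub>R S"])
      (simp add: blinfun.scaleR_left scaleR_scaleC cinner_scaleC_left cinner_scaleC_right)
qed
lift_definition times_bop :: "'a bop \<Rightarrow> 'a bop \<Rightarrow> 'a bop" is "(o\<^sub>L)"
proof -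
  fix T T' :: "'a ell2 \<Rightarrow>\<^sub>L 'a ell2"
  assume "\<exists>S :: 'a ell2 \<Rightarrow>\<^sub>L 'a ell2. \<forall>x y. cinner (T x) y = cinner x (S y)"
    "\<exists>S :: 'a ell2 \<Rightarrow>\<^sub>L 'a ell2. \<forall>x y. cinner (T' x) y = cinner x (S y)"
  then obtain S S' :: "'a ell2 \<Rightarrow>\<^sub>L 'a ell2"
    where "\<forall>x y. cinner (T x) y = cinner x (S y)" "\<forall>x y. cinner (T' x) y = cinner x (S' y)"
    by blast
  then show "\<exists>S :: 'a ell2 \<Rightarrow>\<^sub>L 'a ell2. \<forall>x y. cinner ((T o\<^sub>L T') x) y = cinner x (S y)"
    by (intro exI[of _ "S' o\<^sub>L S"]) simp
qed
lift_definition norm_bop :: "'a bop \<Rightarrow> real" is norm .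

definition sgn_bop :: "'a bop \<Rightarrow> 'a bop" where "sgn_bop x = scaleR (inverse (norm x)) x"
definition dist_bop :: "'a bop \<Rightarrow> 'a bop \<Rightarrow> real" where "dist_bop x y = norm (x - y)"
definition uniformity_bop :: "('a bop \<times> 'a bop) filter" where
  "uniformity_bop = (INF e\<in>{0 <..}. principal {(x, y). dist x y < e})"
definition open_bop :: "'a bop set \<Rightarrow> bool" where
  "open_bop U = (\<forall>x\<in>U. eventually (\<lambda>(x', y). x' = x \<longrightarrow> y \<in> U) uniformity)"

instance
proof
  fix x y z :: "'a bop" and a b r :: real
  show "x + y + z = x + (y + z)" by transfer (auto simp: add.assoc)
  show "x + y = y + x" by transfer (auto simp: add.commute)
  show "0 + x = x" by transfer auto
  show "- x + x = 0" by transfer auto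
  show "x - y = x + - y" by (rule minus_bop_def)
  show "a *\<^sub>R (x + y) = a *\<^sub>R x + a *\<^sub>R y" by transfer (auto simp: algebra_simps)
  show "(a + b) *\<^sub>R x = a *\<^sub>R x + b *\<^sub>R x" by transfer (auto simp: algebra_simps)
  show "a *\<^sub>R b *\<^sub>R x = (a * b) *\<^sub>R x" by transfer auto
  show "1 *\<^sub>R x = x" by transfer auto
  show "x * y * z = x * (y * z)" by transfer (auto intro!: blinfun_eqI)
  show "(x + y) * z = x * z + y * z" by transfer (auto intro!: blinfun_eqI simp: blinfun.add_left)
  show "x * (y + z) = x * y + x * z"
    by transfer (auto intro!: blinfun_eqI simp: blinfun.add_left blinfun.add_right)
  show "a *\<^sub>R x * y = a *\<^sub>R (x * y)" by transfer (auto intro!: blinfun_eqI simp: blinfun.scaleR_left)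
  show "x * a *\<^sub>R y = a *\<^sub>R (x * y)"
    by transfer (auto intro!: blinfun_eqI simp: blinfun.scaleR_left blinfun.scaleR_right)
  show "dist x y = norm (x - y)" by (rule dist_bop_def)
  show "sgn x = scaleR (inverse (norm x)) x" by (rule sgn_bop_def)
  show "uniformity = (INF e\<in>{0 <..}. principal {(x :: 'a bop, y). dist x y < e})"
    by (rule uniformity_bop_def)
  show "open U = (\<forall>x\<in>U. eventually (\<lambda>(x', y). x' = x \<longrightarrow> y \<in> U) uniformity)" for U :: "'a bop set"
    by (rule open_bop_def)
  show "norm x = 0 \<longleftrightarrow> x = 0" by transfer auto
  show "norm (x + y) \<le> norm x + norm y" by transfer (rule norm_triangle_ineq)
  show "norm (r *\<^sub>R x) = \<bar>r\<bar> * norm x" by transfer auto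
  show "norm (x * y) \<le> norm x * norm y" by transfer (rule norm_blinfun_compose)
qed

end

lemma bop_adjoint_ex1: "\<exists>!S. \<forall>x y. cinner (bop_apply T x) y = cinner x (bop_apply S y)"
proof -
  obtain S :: "'a ell2 \<Rightarrow>\<^sub>L 'a ell2"
    where S: "\<forall>x y. cinner (bop_apply T x) y = cinner x (S y)"
    using Rep_bop[of T] unfolding bop_apply.rep_eq by blast
  have "\<forall>x y. cinner (S x) y = cinner x (Rep_bop T y)"
    using S by (metis cinner_cnj bop_apply.rep_eq)
  then have "bop_apply (Abs_bop S) = S"
    by (subst bop_apply.rep_eq, subst Abs_bop_inverse) auto
  with S have ex: "\<forall>x y. cinner (bop_apply T x) y = cinner x (bop_apply (Abs_bop S) y)" by simp
  show ?thesis
  proof (rule ex1I[of _ "Abs_bop S"])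
    show "\<forall>x y. cinner (bop_apply T x) y = cinner x (bop_apply (Abs_bop S) y)" by (rule ex)
  next
    fix S' assume S': "\<forall>x y. cinner (bop_apply T x) y = cinner x (bop_apply S' y)"
    show "S' = Abs_bop S"
      by (intro bop_eqI cinner_extensionality) (metis ex S')
  qed
qed

lemma bop_apply_plus: "bop_apply (S + T) x = bop_apply S x + bop_apply T x"
  by transfer (simp add: blinfun.add_left)

lemma bop_apply_times: "bop_apply (S * T) x = bop_apply S (bop_apply T x)"
  by transfer simp

instantiation bop :: (type) star_ring
begin

definition star_bop :: "'a bop \<Rightarrow> 'a bop" where
  "star_bop T = (THE S. \<forall>x y. cinner (bop_apply T x) y = cinner x (bop_apply S y))"

lemma cinner_star: "cinner (bop_apply T x) y = cinner x (bop_apply (star T) y)"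
  using theI'[OF bop_adjoint_ex1[of T]] unfolding star_bop_def by blast

lemma star_bop_eqI: "(\<And>x y. cinner (bop_apply T x) y = cinner x (bop_apply S y)) \<Longrightarrow> star T = S"
  using bop_adjoint_ex1[of T] cinner_star by blast

instance
proof
  fix a b :: "'a bop"
  show "star (star a) = a"
    by (rule star_bop_eqI) (metis cinner_star cinner_cnj)
  show "star (a + b) = star a + star b"
    by (rule star_bop_eqI) (simp add: bop_apply_plus cinner_add_left cinner_add_right cinner_star)
  show "star (a * b) = star b * star a"
    by (rule star_bop_eqI) (simp add: bop_apply_times cinner_star)
qed

end

definition bop_of :: "('i ell2 \<Rightarrow> 'i ell2) \<Rightarrow> 'i bop" where
  "bop_of f = Abs_bop (Blinfun f)"

lemma bop_apply_bop_of:
  assumes "bounded_linear f" "bounded_linear g" "\<And>x y. cinner (f x) y = cinner x (g y)"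
  shows "bop_apply (bop_of f) = f"
proof -
  have "\<exists>S :: 'a ell2 \<Rightarrow>\<^sub>L 'a ell2. \<forall>x y. cinner (Blinfun f x) y = cinner x (S y)"
    by (intro exI[of _ "Blinfun g"]) (simp add: bounded_linear_Blinfun_apply assms)
  then show ?thesis
    unfolding bop_of_def bop_apply.rep_eq
    by (subst Abs_bop_inverse) (auto simp: bounded_linear_Blinfun_apply assms)
qed

definition scaleC_bop :: "complex \<Rightarrow> 'i bop \<Rightarrow> 'i bop" where
  "scaleC_bop c T = bop_of (\<lambda>x. scaleC_ell2 c (bop_apply T x))"

lemma bounded_linear_bop: "bounded_linear (bop_apply T)"
  by (simp add: bop_apply.rep_eq blinfun.bounded_linear_right)

lemma bop_apply_scaleC: "bop_apply (scaleC_bop c T) x = scaleC_ell2 c (bop_apply T x)"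
proof -
  have "bop_apply (scaleC_bop c T) = (\<lambda>x. scaleC_ell2 c (bop_apply T x))"
    unfolding scaleC_bop_def
  proof (rule bop_apply_bop_of)
    show "bounded_linear (\<lambda>x. scaleC_ell2 c (bop_apply T x))"
      using bounded_linear_compose[OF bounded_linear_scaleC bounded_linear_bop] .
    show "bounded_linear (\<lambda>x. bop_apply (star T) (scaleC_ell2 (cnj c) x))"
      using bounded_linear_compose[OF bounded_linear_bop bounded_linear_scaleC] .
    show "cinner (scaleC_ell2 c (bop_apply T x)) y
        = cinner x (bop_apply (star T) (scaleC_ell2 (cnj c) y))" for x y
      by (metis cinner_star cinner_scaleC_left cinner_scaleC_right)
  qed
  then show ?thesis by simp
qed


section \<open>The reduced group C*-algebra\<close>

text \<open>
  \<open>\<ell>\<^sup>2(G)\<close> is the subspace of families supported on \<^term>\<open>carrier G\<close>. Operators on it are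
  extended by \<open>0\<close> to families over the whole type, so that the unit of the reduced group
  C*-algebra is \<open>left_reg G \<one>\<^bsub>G\<^esub>\<close>, the projection onto \<open>\<ell>\<^sup>2(G)\<close>.
\<close>

definition left_reg :: "('g, 'b) monoid_scheme \<Rightarrow> 'g \<Rightarrow> 'g bop" where
  "left_reg G g = bop_of (\<lambda>f. Abs_ell2 (\<lambda>x.
     if x \<in> carrier G then coord f (inv\<^bsub>G\<^esub> g \<otimes>\<^bsub>G\<^esub> x) else 0))"

context group
begin

lemma left_reg_aux:
  assumes g: "g \<in> carrier G"
  defines "L \<equiv> \<lambda>g f. Abs_ell2 (\<lambda>x. if x \<in> carrier G then coord f (inv g \<otimes> x) else 0)"
  shows "coord (L g f) x = (if x \<in> carrier G then coord f (inv g \<otimes> x) else 0)" (is ?coord)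
    and "bounded_linear (L g)"
    and "cinner (L g f) h = cinner f (L (inv g) h)"
proof -
  have inj: "inj_on (\<lambda>x. inv g' \<otimes> x) (carrier G)" if "g' \<in> carrier G" for g'
    using that by (simp add: inj_on_def)
  have bd: "(\<Sum>x\<in>F. (cmod (if x \<in> carrier G then coord f (inv g' \<otimes> x) else 0))\<^sup>2) \<le> (norm f)\<^sup>2"
    if "finite F" "g' \<in> carrier G" for F f g'
  proof -
    have "(\<Sum>x\<in>F. (cmod (if x \<in> carrier G then coord f (inv g' \<otimes> x) else 0))\<^sup>2)
        = (\<Sum>x\<in>F \<inter> carrier G. (cmod (coord f (inv g' \<otimes> x)))\<^sup>2)"
      by (rule sum.mono_neutral_cong_right[OF that(1)]) auto
    also have "\<dots> = (\<Sum>x\<in>(\<lambda>x. inv g' \<otimes> x) ` (F \<inter> carrier G). (cmod (coord f x))\<^sup>2)"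
      using inj_on_subset[OF inj[OF that(2)], of "F \<inter> carrier G"] by (simp add: sum.reindex)
    also have "\<dots> \<le> (\<Sum>\<^sub>\<infinity>x. (cmod (coord f x))\<^sup>2)"
      by (rule finite_sum_le_infsum[OF ell2_summable]) (use that(1) in simp_all)
    also have "\<dots> = (norm f)\<^sup>2" by (simp add: norm_ell2.rep_eq infsum_nonneg)
    finally show ?thesis .
  qed
  have coord: "coord (L g' f) x = (if x \<in> carrier G then coord f (inv g' \<otimes> x) else 0)"
    if "g' \<in> carrier G" for g' f x
  proof -
    have "(\<lambda>x. (cmod (if x \<in> carrier G then coord f (inv g' \<otimes> x) else 0))\<^sup>2) summable_on UNIV"
      by (rule square_summable_bound(1)[OF bd[OF _ that]])
    then have "coord (L g' f) = (\<lambda>x. if x \<in> carrier G then coord f (inv g' \<otimes> x) else 0)"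
      unfolding L_def by (intro Abs_ell2_inverse) simp
    then show ?thesis by simp
  qed
  show ?coord by (rule coord[OF g])
  show "bounded_linear (L g)"
  proof (rule bounded_linear_intro[where K = 1])
    show "L g (x + y) = L g x + L g y" for x y
      by (rule ell2_eqI) (simp add: coord[OF g] plus_ell2.rep_eq)
    show "L g (r *\<^sub>R x) = r *\<^sub>R L g x" for r x
      by (rule ell2_eqI) (simp add: coord[OF g] scaleR_ell2.rep_eq)
    show "norm (L g x) \<le> norm x * 1" for x
    proof -
      have "(norm (L g x))\<^sup>2 = (\<Sum>\<^sub>\<infinity>i. (cmod (coord (L g x) i))\<^sup>2)"
        by (simp add: norm_ell2.rep_eq infsum_nonneg)
      also have "\<dots> \<le> (norm x)\<^sup>2"
        unfolding coord[OF g] by (rule square_summable_bound(2)[OF bd[OF _ g]])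
      finally show ?thesis using power2_le_imp_le norm_ge_zero by (metis mult.right_neutral)
    qed
  qed
  have img: "(\<lambda>x. inv g \<otimes> x) ` carrier G = carrier G"
  proof (intro equalityI subsetI)
    fix y assume y: "y \<in> carrier G"
    then have "y = inv g \<otimes> (g \<otimes> y)" 
      by (simp only: m_assoc[OF inv_closed[OF g] g y, symmetric] l_inv[OF g] l_one)
    moreover have "g \<otimes> y \<in> carrier G" using g y by (rule m_closed)
    ultimately show "y \<in> (\<lambda>x. inv g \<otimes> x) ` carrier G" by (rule image_eqI)
  next
    fix y assume "y \<in> (\<lambda>x. inv g \<otimes> x) ` carrier G"
    then show "y \<in> carrier G" using g by blast
  qed
  have "cinner (L g f) h = (\<Sum>\<^sub>\<infinity>x\<in>carrier G. cnj (coord f (inv g \<otimes> x)) * coord h x)"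
    unfolding cinner_def coord[OF g] by (rule infsum_cong_neutral) simp_all
  also have "\<dots> = (\<Sum>\<^sub>\<infinity>x\<in>carrier G. cnj (coord f (inv g \<otimes> x)) * coord h (g \<otimes> (inv g \<otimes> x)))"
  proof (rule infsum_cong)
    fix x assume x: "x \<in> carrier G"
    then have "g \<otimes> (inv g \<otimes> x) = x" 
      by (simp only: m_assoc[OF g inv_closed[OF g] x, symmetric] r_inv[OF g] l_one)
    then show "cnj (coord f (inv g \<otimes> x)) * coord h x
        = cnj (coord f (inv g \<otimes> x)) * coord h (g \<otimes> (inv g \<otimes> x))" by (simp only:)
  qed
  also have "\<dots> = (\<Sum>\<^sub>\<infinity>x\<in>(\<lambda>x. inv g \<otimes> x) ` carrier G. cnj (coord f x) * coord h (g \<otimes> x))"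
    by (simp only: infsum_reindex[OF inj[OF g]] o_def)
  also have "\<dots> = cinner f (L (inv g) h)"
    unfolding img cinner_def coord[OF inv_closed[OF g]] inv_inv[OF g]
    by (rule infsum_cong_neutral) simp_all
  finally show "cinner (L g f) h = cinner f (L (inv g) h)" .
qed

lemma coord_left_reg:
  assumes "g \<in> carrier G"
  shows "coord (bop_apply (left_reg G g) f) x
    = (if x \<in> carrier G then coord f (inv g \<otimes> x) else 0)"
  unfolding left_reg_def
  by (subst bop_apply_bop_of[OF left_reg_aux(2)[OF assms] left_reg_aux(2)[OF inv_closed[OF assms]]
        left_reg_aux(3)[OF assms]]) (rule left_reg_aux(1)[OF assms])

end

definition reduced_cstar :: "('g, 'b) monoid_scheme \<Rightarrow> 'g bop set" where
  "reduced_cstar G = closure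
     {\<Sum>g\<in>F. scaleC_bop (c g) (left_reg G g) | c F. finite F \<and> F \<subseteq> carrier G}"

definition averaging :: "('g, 'b) monoid_scheme \<Rightarrow> 'g set \<Rightarrow> 'g bop" where
  "averaging G H = (1 / real (card H)) *\<^sub>R (\<Sum>h\<in>H. left_reg G h)"


section \<open>\<open>K\<^sub>0\<close> of a unital C*-algebra\<close>

text \<open>
  For a C*-algebra \<open>A\<close> of operators having a unit, which need not be the identity operator, \<open>K\<^sub>0(A)\<close>
  is the Grothendieck group of the semigroup of Murray--von Neumann classes of projections in
  matrices over \<open>A\<close>. It is written multiplicatively, and the pair \<open>(p, q)\<close> represents \<open>[p] - [q]\<close>.
\<close>

definition mats_over :: "'a set \<Rightarrow> nat \<Rightarrow> nat \<Rightarrow> 'a mat set" where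
  "mats_over A m n = {M \<in> carrier_mat m n. elements_mat M \<subseteq> A}"

definition star_mat :: "'a::star_ring mat \<Rightarrow> 'a mat" where
  "star_mat M = mat (dim_col M) (dim_row M) (\<lambda>(i, j). star (M $$ (j, i)))"

definition projections :: "'a::star_ring set \<Rightarrow> 'a mat set" where
  "projections A = {p. (\<exists>n. p \<in> mats_over A n n) \<and> star_mat p = p \<and> p * p = p}"

definition mvn_equiv :: "'a::star_ring set \<Rightarrow> 'a mat \<Rightarrow> 'a mat \<Rightarrow> bool" where
  "mvn_equiv A p q \<longleftrightarrow>
     (\<exists>v \<in> mats_over A (dim_row q) (dim_row p). star_mat v * v = p \<and> v * star_mat v = q)"

definition block_sum :: "'a::star_ring mat \<Rightarrow> 'a mat \<Rightarrow> 'a mat" (infixr "\<oplus>\<^sub>m" 65) where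
  "p \<oplus>\<^sub>m q = four_block_mat p (0\<^sub>m (dim_row p) (dim_col q)) (0\<^sub>m (dim_row q) (dim_col p)) q"

definition K0_rel :: "'a::star_ring set \<Rightarrow> (('a mat \<times> 'a mat) \<times> ('a mat \<times> 'a mat)) set" where
  "K0_rel A = {((p, q), (p', q')).
     p \<in> projections A \<and> q \<in> projections A \<and> p' \<in> projections A \<and> q' \<in> projections A \<and>
     (\<exists>r \<in> projections A. mvn_equiv A (p \<oplus>\<^sub>m q' \<oplus>\<^sub>m r) (p' \<oplus>\<^sub>m q \<oplus>\<^sub>m r))}"

definition K0 :: "'a::star_ring set \<Rightarrow> ('a mat \<times> 'a mat) set monoid" where
  "K0 A = \<lparr>carrier = (projections A \<times> projections A) // K0_rel A,
     mult = (\<lambda>X Y. \<Union>(p, q)\<in>X. \<Union>(p', q')\<in>Y. K0_rel A `` {(p \<oplus>\<^sub>m p', q \<oplus>\<^sub>m q')}),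
     one = K0_rel A `` {(0\<^sub>m 0 0, 0\<^sub>m 0 0)}\<rparr>"

definition K0_class :: "'a::star_ring set \<Rightarrow> 'a mat \<Rightarrow> ('a mat \<times> 'a mat) set" where
  "K0_class A p = K0_rel A `` {(p, 0\<^sub>m 0 0)}"


section \<open>Non-amenable, finitely generated, virtually free groups\<close>

definition amenable :: "('g, 'b) monoid_scheme \<Rightarrow> bool" where
  "amenable G \<longleftrightarrow> (\<exists>\<mu> :: 'g set \<Rightarrow> real.
     (\<forall>A \<subseteq> carrier G. 0 \<le> \<mu> A) \<and> \<mu> (carrier G) = 1 \<and>
     (\<forall>A \<subseteq> carrier G. \<forall>B \<subseteq> carrier G. A \<inter> B = {} \<longrightarrow> \<mu> (A \<union> B) = \<mu> A + \<mu> B) \<and>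
     (\<forall>g \<in> carrier G. \<forall>A \<subseteq> carrier G. \<mu> (g <#\<^bsub>G\<^esub> A) = \<mu> A))"

definition finitely_generated :: "('g, 'b) monoid_scheme \<Rightarrow> bool" where
  "finitely_generated G \<longleftrightarrow> (\<exists>S. finite S \<and> S \<subseteq> carrier G \<and> generate G S = carrier G)"

text \<open>A pair \<open>(b, s)\<close> stands for \<open>b\<close> if \<open>s\<close> holds, and for the inverse of \<open>b\<close> otherwise.\<close>

definition reduced :: "('b \<times> bool) list \<Rightarrow> bool" where
  "reduced = successively (\<lambda>x y. \<not> (fst x = fst y \<and> snd x \<noteq> snd y))"

definition eval_word :: "('g, 'b) monoid_scheme \<Rightarrow> ('g \<times> bool) list \<Rightarrow> 'g" where
  "eval_word G w = foldr (\<lambda>(b, s) x. (if s then b else inv\<^bsub>G\<^esub> b) \<otimes>\<^bsub>G\<^esub> x) w \<one>\<^bsub>G\<^esub>"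

definition free_basis :: "('g, 'b) monoid_scheme \<Rightarrow> 'g set \<Rightarrow> 'g set \<Rightarrow> bool" where
  "free_basis G B H \<longleftrightarrow> B \<subseteq> carrier G \<and> generate G B = H \<and>
     (\<forall>w. w \<noteq> [] \<and> set w \<subseteq> B \<times> UNIV \<and> reduced w \<longrightarrow> eval_word G w \<noteq> \<one>\<^bsub>G\<^esub>)"

definition virtually_free :: "('g, 'b) monoid_scheme \<Rightarrow> bool" where
  "virtually_free G \<longleftrightarrow>
     (\<exists>H B. subgroup H G \<and> finite (rcosets\<^bsub>G\<^esub> H) \<and> free_basis G B H)"


section \<open>Graphs of groups and their Bass--Serre trees\<close>

text \<open>
  A digraph (loops and parallel arcs are allowed) represents an unoriented graph with a chosen
  orientation of each of its edges. Walks may traverse arcs in both directions: \<open>(e, True)\<close> goes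
  from tail to head.
\<close>

fun gwalk :: "('v, 'e) pre_digraph \<Rightarrow> 'v \<Rightarrow> ('e \<times> bool) list \<Rightarrow> 'v \<Rightarrow> bool" where
  "gwalk Y u [] v \<longleftrightarrow> u \<in> verts Y \<and> u = v"
| "gwalk Y u ((e, s) # w) v \<longleftrightarrow> e \<in> arcs Y \<and> u = (if s then tail Y e else head Y e) \<and>
     gwalk Y (if s then head Y e else tail Y e) w v"

definition connected_graph :: "('v, 'e) pre_digraph \<Rightarrow> bool" where
  "connected_graph Y \<longleftrightarrow> verts Y \<noteq> {} \<and> (\<forall>u \<in> verts Y. \<forall>v \<in> verts Y. \<exists>w. gwalk Y u w v)"

definition tree_graph :: "('v, 'e) pre_digraph \<Rightarrow> bool" where
  "tree_graph Y \<longleftrightarrow> connected_graph Y \<and> (\<forall>u w. gwalk Y u w u \<and> reduced w \<longrightarrow> w = [])"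

definition maximal_tree :: "('v, 'e) pre_digraph \<Rightarrow> 'e set \<Rightarrow> bool" where
  "maximal_tree Y T \<longleftrightarrow> T \<subseteq> arcs Y \<and> tree_graph (Y\<lparr>arcs := T\<rparr>)"

record ('v, 'e, 'h, 'k) graph_of_groups =
  base :: "('v, 'e) pre_digraph"
  vgroup :: "'v \<Rightarrow> 'h monoid"
  egroup :: "'e \<Rightarrow> 'k monoid"
  tail_emb :: "'e \<Rightarrow> 'k \<Rightarrow> 'h"
  head_emb :: "'e \<Rightarrow> 'k \<Rightarrow> 'h"

definition finite_graph_of_finite_groups :: "('v, 'e, 'h, 'k) graph_of_groups \<Rightarrow> bool" where
  "finite_graph_of_finite_groups Y \<longleftrightarrow>
     fin_digraph (base Y) \<and> connected_graph (base Y) \<and>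
     (\<forall>v \<in> verts (base Y). group (vgroup Y v) \<and> finite (carrier (vgroup Y v))) \<and>
     (\<forall>e \<in> arcs (base Y). group (egroup Y e) \<and> finite (carrier (egroup Y e)) \<and>
        tail_emb Y e \<in> mon (egroup Y e) (vgroup Y (tail (base Y) e)) \<and>
        head_emb Y e \<in> mon (egroup Y e) (vgroup Y (head (base Y) e)))"

datatype ('v, 'e, 'h) letter = Vert 'v 'h | Edge 'e | Edge_inv 'e

definition letters :: "('v, 'e, 'h, 'k) graph_of_groups \<Rightarrow> ('v, 'e, 'h) letter set" where
  "letters Y = {Vert v a | v a. v \<in> verts (base Y) \<and> a \<in> carrier (vgroup Y v)}
     \<union> Edge ` arcs (base Y) \<union> Edge_inv ` arcs (base Y)"

text \<open>
  The congruence on words defining the fundamental group \<open>\<pi>\<^sub>1(Y, T)\<close> with respect to a maximal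
  tree \<open>T\<close>: the last two rules are the relations \<open>t\<^sub>e \<beta>\<^sub>e(a) t\<^sub>e\<^sup>-\<^sup>1 = \<alpha>\<^sub>e(a)\<close> for the
  embeddings \<open>\<alpha>\<^sub>e\<close>, \<open>\<beta>\<^sub>e\<close> of the edge group at the tail and at the head, and \<open>t\<^sub>e = 1\<close> for \<open>e \<in> T\<close>.
\<close>

inductive gog_cong :: "('v, 'e, 'h, 'k) graph_of_groups \<Rightarrow> 'e set \<Rightarrow>
    ('v, 'e, 'h) letter list \<Rightarrow> ('v, 'e, 'h) letter list \<Rightarrow> bool" for Y T where
  refl: "w \<in> lists (letters Y) \<Longrightarrow> gog_cong Y T w w"
| sym: "gog_cong Y T w w' \<Longrightarrow> gog_cong Y T w' w"
| trans: "gog_cong Y T w w' \<Longrightarrow> gog_cong Y T w' w'' \<Longrightarrow> gog_cong Y T w w''"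
| context_closed: "gog_cong Y T w w' \<Longrightarrow> x \<in> lists (letters Y) \<Longrightarrow> y \<in> lists (letters Y) \<Longrightarrow>
    gog_cong Y T (x @ w @ y) (x @ w' @ y)"
| vert_one: "v \<in> verts (base Y) \<Longrightarrow> gog_cong Y T [Vert v \<one>\<^bsub>vgroup Y v\<^esub>] []"
| vert_mult: "v \<in> verts (base Y) \<Longrightarrow> a \<in> carrier (vgroup Y v) \<Longrightarrow> b \<in> carrier (vgroup Y v) \<Longrightarrow>
    gog_cong Y T [Vert v a, Vert v b] [Vert v (a \<otimes>\<^bsub>vgroup Y v\<^esub> b)]"
| edge_right_inv: "e \<in> arcs (base Y) \<Longrightarrow> gog_cong Y T [Edge e, Edge_inv e] []"
| edge_left_inv: "e \<in> arcs (base Y) \<Longrightarrow> gog_cong Y T [Edge_inv e, Edge e] []"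
| edge_conj: "e \<in> arcs (base Y) \<Longrightarrow> a \<in> carrier (egroup Y e) \<Longrightarrow>
    gog_cong Y T [Edge e, Vert (head (base Y) e) (head_emb Y e a), Edge_inv e]
      [Vert (tail (base Y) e) (tail_emb Y e a)]"
| tree_edge: "e \<in> T \<Longrightarrow> e \<in> arcs (base Y) \<Longrightarrow> gog_cong Y T [Edge e] []"

definition word_class :: "('v, 'e, 'h, 'k) graph_of_groups \<Rightarrow> 'e set \<Rightarrow>
    ('v, 'e, 'h) letter list \<Rightarrow> ('v, 'e, 'h) letter list set" where
  "word_class Y T w = {w'. gog_cong Y T w w'}"

definition fundamental_group :: "('v, 'e, 'h, 'k) graph_of_groups \<Rightarrow> 'e set \<Rightarrow>
    ('v, 'e, 'h) letter list set monoid" where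
  "fundamental_group Y T = \<lparr>carrier = word_class Y T ` lists (letters Y),
     mult = (\<lambda>A B. \<Union>a\<in>A. \<Union>b\<in>B. word_class Y T (a @ b)),
     one = word_class Y T []\<rparr>"

text \<open>
  From here on, \<open>\<psi>\<close> is an isomorphism from the fundamental group of \<open>Y\<close> onto \<open>G\<close>.
\<close>

definition vsubgroup :: "('v, 'e, 'h, 'k) graph_of_groups \<Rightarrow> 'e set \<Rightarrow>
    (('v, 'e, 'h) letter list set \<Rightarrow> 'g) \<Rightarrow> 'v \<Rightarrow> 'g set" where
  "vsubgroup Y T \<psi> v = (\<lambda>a. \<psi> (word_class Y T [Vert v a])) ` carrier (vgroup Y v)"

definition esubgroup :: "('v, 'e, 'h, 'k) graph_of_groups \<Rightarrow> 'e set \<Rightarrow>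
    (('v, 'e, 'h) letter list set \<Rightarrow> 'g) \<Rightarrow> 'e \<Rightarrow> 'g set" where
  "esubgroup Y T \<psi> e =
     (\<lambda>a. \<psi> (word_class Y T [Vert (tail (base Y) e) (tail_emb Y e a)])) ` carrier (egroup Y e)"

definition stable_letter :: "('v, 'e, 'h, 'k) graph_of_groups \<Rightarrow> 'e set \<Rightarrow>
    (('v, 'e, 'h) letter list set \<Rightarrow> 'g) \<Rightarrow> 'e \<Rightarrow> 'g" where
  "stable_letter Y T \<psi> e = \<psi> (word_class Y T [Edge e])"

text \<open>
  The arc \<open>(e, g G\<^sub>e)\<close> of the Bass--Serre tree leads from \<open>(v, g G\<^sub>v)\<close> to \<open>(w, g t\<^sub>e G\<^sub>w)\<close>, where
  \<open>e\<close> leads from \<open>v\<close> to \<open>w\<close>, and \<open>G\<^sub>e\<close> is embedded into \<open>G\<^sub>v\<close>.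
\<close>

definition bass_serre_tree :: "('g, 'b) monoid_scheme \<Rightarrow> ('v, 'e, 'h, 'k) graph_of_groups \<Rightarrow> 'e set \<Rightarrow>
    (('v, 'e, 'h) letter list set \<Rightarrow> 'g) \<Rightarrow> ('v \<times> 'g set, 'e \<times> 'g set) pre_digraph" where
  "bass_serre_tree G Y T \<psi> = \<lparr>
     verts = {(v, g <#\<^bsub>G\<^esub> vsubgroup Y T \<psi> v) | v g. v \<in> verts (base Y) \<and> g \<in> carrier G},
     arcs = {(e, g <#\<^bsub>G\<^esub> esubgroup Y T \<psi> e) | e g. e \<in> arcs (base Y) \<and> g \<in> carrier G},
     tail = (\<lambda>(e, C). (tail (base Y) e, C <#>\<^bsub>G\<^esub> vsubgroup Y T \<psi> (tail (base Y) e))),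
     head = (\<lambda>(e, C). (head (base Y) e,
       (C #>\<^bsub>G\<^esub> stable_letter Y T \<psi> e) <#>\<^bsub>G\<^esub> vsubgroup Y T \<psi> (head (base Y) e)))\<rparr>"

definition coset_action :: "('g, 'b) monoid_scheme \<Rightarrow> ('c \<times> 'g set) set \<Rightarrow>
    'g \<Rightarrow> ('c \<times> 'g set) \<Rightarrow> ('c \<times> 'g set)" where
  "coset_action G E g = (\<lambda>(c, C) \<in> E. (c, g <#\<^bsub>G\<^esub> C))"


section \<open>The first higher Kazhdan projection\<close>

text \<open>
  \<open>X\<close> is a graph on which \<open>G\<close> acts, through \<open>\<alpha>\<close> on its vertices and \<open>\<beta>\<close> on its arcs, preserving
  tails and heads. The Hilbert space \<open>Hom(\<complex>[S], \<ell>\<^sup>2(G))\<close> of \<open>\<complex>G\<close>-linear maps is represented by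
  the \<open>G\<close>-equivariant maps from \<open>S\<close> to \<open>\<ell>\<^sup>2(G)\<close>; equivariance under \<open>1\<close> forces the values to
  be supported on \<^term>\<open>carrier G\<close>.
\<close>

definition cochains :: "('g, 'b) monoid_scheme \<Rightarrow> 's set \<Rightarrow> ('g \<Rightarrow> 's \<Rightarrow> 's) \<Rightarrow> ('s \<Rightarrow> 'g ell2) set" where
  "cochains G S \<alpha> = {\<phi>.
     (\<forall>g \<in> carrier G. \<forall>x \<in> S. \<phi> (\<alpha> g x) = bop_apply (left_reg G g) (\<phi> x)) \<and> (\<forall>x. x \<notin> S \<longrightarrow> \<phi> x = 0)}"

definition orbit_lift :: "('g, 'b) monoid_scheme \<Rightarrow> 's set \<Rightarrow> ('g \<Rightarrow> 's \<Rightarrow> 's) \<Rightarrow> ('s set \<Rightarrow> 's) \<Rightarrow> bool" where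
  "orbit_lift G S \<alpha> l \<longleftrightarrow> (\<forall>R \<in> orbits G S \<alpha>. l R \<in> R)"

text \<open>
  The inner product of \<open>\<Oplus>\<^sub>R \<rho>\<^sub>R \<ell>\<^sup>2(G)\<close>, where \<open>R\<close> ranges over the orbits, transported along the
  evaluation of cochains at the lifts. As the left regular representation is unitary, it does not
  depend on the lifts.
\<close>

definition cochain_inner :: "('g, 'b) monoid_scheme \<Rightarrow> 's set \<Rightarrow> ('g \<Rightarrow> 's \<Rightarrow> 's) \<Rightarrow> ('s set \<Rightarrow> 's) \<Rightarrow>
    ('s \<Rightarrow> 'g ell2) \<Rightarrow> ('s \<Rightarrow> 'g ell2) \<Rightarrow> complex" where
  "cochain_inner G S \<alpha> l \<phi> \<phi>' = (\<Sum>R \<in> orbits G S \<alpha>. cinner (\<phi> (l R)) (\<phi>' (l R)))"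

definition coboundary :: "('x, 'y) pre_digraph \<Rightarrow> ('x \<Rightarrow> 'g ell2) \<Rightarrow> ('y \<Rightarrow> 'g ell2)" where
  "coboundary X \<phi> = (\<lambda>e. if e \<in> arcs X then \<phi> (head X e) - \<phi> (tail X e) else 0)"

definition coboundary_adj :: "('g, 'b) monoid_scheme \<Rightarrow> ('x, 'y) pre_digraph \<Rightarrow>
    ('g \<Rightarrow> 'x \<Rightarrow> 'x) \<Rightarrow> ('g \<Rightarrow> 'y \<Rightarrow> 'y) \<Rightarrow> ('x set \<Rightarrow> 'x) \<Rightarrow> ('y set \<Rightarrow> 'y) \<Rightarrow>
    ('y \<Rightarrow> 'g ell2) \<Rightarrow> ('x \<Rightarrow> 'g ell2)" where
  "coboundary_adj G X \<alpha> \<beta> l\<^sub>v l\<^sub>e \<omega> = (THE \<phi>. \<phi> \<in> cochains G (verts X) \<alpha> \<and>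
     (\<forall>\<theta> \<in> cochains G (verts X) \<alpha>.
        cochain_inner G (arcs X) \<beta> l\<^sub>e (coboundary X \<theta>) \<omega> = cochain_inner G (verts X) \<alpha> l\<^sub>v \<theta> \<phi>))"

definition laplacian1 :: "('g, 'b) monoid_scheme \<Rightarrow> ('x, 'y) pre_digraph \<Rightarrow>
    ('g \<Rightarrow> 'x \<Rightarrow> 'x) \<Rightarrow> ('g \<Rightarrow> 'y \<Rightarrow> 'y) \<Rightarrow> ('x set \<Rightarrow> 'x) \<Rightarrow> ('y set \<Rightarrow> 'y) \<Rightarrow>
    ('y \<Rightarrow> 'g ell2) \<Rightarrow> ('y \<Rightarrow> 'g ell2)" where
  "laplacian1 G X \<alpha> \<beta> l\<^sub>v l\<^sub>e \<omega> = coboundary X (coboundary_adj G X \<alpha> \<beta> l\<^sub>v l\<^sub>e \<omega>)"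

definition ker_laplacian1 :: "('g, 'b) monoid_scheme \<Rightarrow> ('x, 'y) pre_digraph \<Rightarrow>
    ('g \<Rightarrow> 'x \<Rightarrow> 'x) \<Rightarrow> ('g \<Rightarrow> 'y \<Rightarrow> 'y) \<Rightarrow> ('x set \<Rightarrow> 'x) \<Rightarrow> ('y set \<Rightarrow> 'y) \<Rightarrow> ('y \<Rightarrow> 'g ell2) set" where
  "ker_laplacian1 G X \<alpha> \<beta> l\<^sub>v l\<^sub>e =
     {\<omega> \<in> cochains G (arcs X) \<beta>. laplacian1 G X \<alpha> \<beta> l\<^sub>v l\<^sub>e \<omega> = (\<lambda>_. 0)}"

text \<open>
  The matrix of \<open>p\<^sub>1\<close>, with rows and columns indexed by the list \<open>es\<close> of all orbits of arcs. Evaluation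
  at the lifts embeds the 1-cochains isometrically onto the summand \<open>\<Oplus>\<^sub>e \<rho>\<^sub>e \<ell>\<^sup>2(G)\<close> of
  \<open>\<ell>\<^sup>2(G)\<^sup>n\<close>, and operators on that summand are extended by \<open>0\<close>, which makes them elements of the corner
  \<open>diag(\<rho>\<^sub>e) M\<^sub>n(B(\<ell>\<^sup>2(G))) diag(\<rho>\<^sub>e)\<close>. Thus the matrix is the one of the orthogonal projection of
  \<open>\<ell>\<^sup>2(G)\<^sup>n\<close> onto the image of the kernel of the Laplacian.
\<close>

definition kazhdan_projection1 :: "('g, 'b) monoid_scheme \<Rightarrow> ('x, 'y) pre_digraph \<Rightarrow>
    ('g \<Rightarrow> 'x \<Rightarrow> 'x) \<Rightarrow> ('g \<Rightarrow> 'y \<Rightarrow> 'y) \<Rightarrow> ('x set \<Rightarrow> 'x) \<Rightarrow> ('y set \<Rightarrow> 'y) \<Rightarrow> 'y set list \<Rightarrow>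
    'g bop mat" where
  "kazhdan_projection1 G X \<alpha> \<beta> l\<^sub>v l\<^sub>e es = (THE p. p \<in> carrier_mat (length es) (length es) \<and>
     (\<forall>\<xi> :: nat \<Rightarrow> 'g ell2. \<exists>\<omega> \<in> ker_laplacian1 G X \<alpha> \<beta> l\<^sub>v l\<^sub>e.
        (\<forall>i < length es. (\<Sum>j < length es. bop_apply (p $$ (i, j)) (\<xi> j)) = \<omega> (l\<^sub>e (es ! i))) \<and>
        (\<forall>\<eta> \<in> ker_laplacian1 G X \<alpha> \<beta> l\<^sub>v l\<^sub>e.
           (\<Sum>i < length es. cinner (\<eta> (l\<^sub>e (es ! i))) (\<xi> i - \<omega> (l\<^sub>e (es ! i)))) = 0)))"

end

(* On 1-cochains, im d is the orthogonal complement of ker (d d^* ) = ker d^*, once d is bounded below.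
   Then the polar part of d is a partial isometry over the reduced C*-algebra from the 0-cochains onto
   im d, so [rho_V] + [p_1] = [rho_E].  That d is bounded below only uses that X is connected: if d f is
   small, then f is almost constant along paths, so that f(x_0) is an almost invariant vector
   of l^2(G), which non-amenability excludes.  The polar part lies in the C*-algebra because the inverse
   square root of d^* d is a norm convergent binomial series. *)

theory Submission
  imports Defs
    "HOL-Analysis.Function_Topology"
    "HOL-Computational_Algebra.Formal_Power_Series"
begin

section \<open>\<open>K\<^sub>0\<close> of a ring with involution\<close>

text \<open>The Kazhdan projection is given by a definite description, so a projection has to be
  produced inside the C*-algebra first and recognised afterwards. It is produced by a formula:
  \<open>p = E - D R\<close>, where \<open>P\<close> and \<open>E\<close> are the diagonal matrices
  of vertex and arc stabiliser averages, \<open>D\<close> is a rescaled differential, and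
  \<open>R\<close> is the adjoint of \<open>D\<close> followed by the inverse of
  \<open>D\<^sup>* D\<close>. The identity operator need not lie in the algebra, and the cochain
  spaces are cut down by the averages. Hence inverses and power series are formed in the corner of
  \<open>P\<close>, with zeroth power \<open>P\<close>, and the gap is stated relative to it:
  \<epsilon> |P \<xi>|^2 \<le> |D \<xi>|^2 \<le> |P \<xi>|^2, the upper bound being the purpose of
  the rescaling. Then \<open>x = P - D\<^sup>* D\<close> lies between 0 and some q < 1, and as the
  binomial coefficients are at most 1, a geometric series dominates. Amenability would follow from
  almost invariant unit vectors by reading |\<xi>|^2 as a probability measure on the group: a
  cluster point of such measures in the product of unit intervals is an invariant mean.\<close>

lemma star_zero [simp]: "star 0 = (0::'a::star_ring)"
  using star_add[of 0 "0::'a"] by simp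

lemma star_minus: "star (- x) = - star (x::'a::star_ring)"
  using star_add[of x "- x"] by (simp add: eq_neg_iff_add_eq_0 add.commute)

lemma star_diff: "star (x - y) = star x - star (y::'a::star_ring)"
  using star_add[of x "- y"] by (simp add: star_minus)

lemma star_sum: "star (sum f I) = (\<Sum>i\<in>I. star (f i :: 'a::star_ring))"
  by (induction I rule: infinite_finite_induct) (auto simp: star_add)

section \<open>Matrices over a ring with involution and their block sums\<close>

lemma index_mult_mat_sum:
  "i < dim_row M \<Longrightarrow> j < dim_col N \<Longrightarrow> dim_col M = dim_row N \<Longrightarrow>
    (M * N) $$ (i, j) = (\<Sum>k<dim_row N. M $$ (i, k) * N $$ (k, j))"
  by (simp add: scalar_prod_def atLeast0LessThan)

lemma assoc_mult_mat4:
  assumes "A \<in> carrier_mat a b" "B \<in> carrier_mat b c" "C \<in> carrier_mat c d" "D \<in> carrier_mat d e"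
  shows "(A * B) * (C * D) = A * ((B * C) * D)"
proof -
  have "(A * B) * (C * D) = A * (B * (C * D))" using assms by (intro assoc_mult_mat) auto
  also have "B * (C * D) = (B * C) * D" using assms by (intro assoc_mult_mat[symmetric]) auto
  finally show ?thesis .
qed

lemma dim_star_mat [simp]: "dim_row (star_mat M) = dim_col M" "dim_col (star_mat M) = dim_row M"
  by (simp_all add: star_mat_def)

lemma index_star_mat [simp]:
  "i < dim_col M \<Longrightarrow> j < dim_row M \<Longrightarrow> star_mat M $$ (i, j) = star (M $$ (j, i))"
  by (simp add: star_mat_def)

lemma star_mat_carrier [simp]: "M \<in> carrier_mat m n \<Longrightarrow> star_mat M \<in> carrier_mat n m"
  by auto

lemma star_mat_star_mat [simp]: "star_mat (star_mat M) = M"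
  by (rule eq_matI) (auto simp: star_star)

lemma star_mat_mult: "dim_col M = dim_row N \<Longrightarrow> star_mat (M * N) = star_mat N * star_mat M"
  by (rule eq_matI) (auto simp: index_mult_mat_sum star_sum star_mult simp del: index_mult_mat(1))

lemma star_mat_zero [simp]: "star_mat (0\<^sub>m m n) = (0\<^sub>m n m :: 'a::star_ring mat)"
  by (rule eq_matI) auto

lemma star_mat_four_block:
  assumes "A \<in> carrier_mat r1 c1" "B \<in> carrier_mat r1 c2" "C \<in> carrier_mat r2 c1" "D \<in> carrier_mat r2 c2"
  shows "star_mat (four_block_mat A B C D)
    = four_block_mat (star_mat A) (star_mat C) (star_mat B) (star_mat D)"
  by (rule eq_matI) (use assms in auto)

lemma mats_over_iff:
  "M \<in> mats_over A m n \<longleftrightarrow> M \<in> carrier_mat m n \<and> (\<forall>i<m. \<forall>j<n. M $$ (i, j) \<in> A)"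
  by (fastforce simp: mats_over_def elements_mat_def)

lemma mats_overI:
  "M \<in> carrier_mat m n \<Longrightarrow> (\<And>i j. i < m \<Longrightarrow> j < n \<Longrightarrow> M $$ (i, j) \<in> A) \<Longrightarrow> M \<in> mats_over A m n"
  by (simp add: mats_over_iff)

lemma dim_block_sum [simp]:
  "dim_row (p \<oplus>\<^sub>m q) = dim_row p + dim_row q" "dim_col (p \<oplus>\<^sub>m q) = dim_col p + dim_col q"
  by (simp_all add: block_sum_def)

lemma block_sum_assoc: "(p \<oplus>\<^sub>m q) \<oplus>\<^sub>m r = p \<oplus>\<^sub>m q \<oplus>\<^sub>m r"
  unfolding block_sum_def by (rule assoc_four_block_mat[symmetric])

lemma block_sum_zero [simp]: "p \<oplus>\<^sub>m 0\<^sub>m 0 0 = p" "0\<^sub>m 0 0 \<oplus>\<^sub>m p = p"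
  by (auto simp: block_sum_def intro!: eq_matI)

lemma star_mat_block_sum: "star_mat (p \<oplus>\<^sub>m q) = star_mat p \<oplus>\<^sub>m star_mat q"
  unfolding block_sum_def
  by (subst star_mat_four_block[of p "dim_row p" "dim_col p" _ "dim_col q" _ "dim_row q"]) auto

lemma block_sum_mult:
  assumes "dim_col p = dim_row p'" "dim_col q = dim_row q'"
  shows "(p \<oplus>\<^sub>m q) * (p' \<oplus>\<^sub>m q') = (p * p') \<oplus>\<^sub>m (q * q')"
  unfolding block_sum_def
  by (subst mult_four_block_mat[of p "dim_row p" "dim_col p" _ "dim_col q" _ "dim_row q" _ _ "dim_col p'" _ "dim_col q'"])
     (use assms in \<open>auto intro!: cong_four_block_mat\<close>)

text \<open>Block sums are strictly associative with the empty matrix as strict unit, so a list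
  records a sum without bracketing. Up to equivalence only its multiset matters, which turns later
  rearrangements into multiset equations.\<close>

definition bsum :: "'a::star_ring mat list \<Rightarrow> 'a mat" where
  "bsum ps = foldr (\<oplus>\<^sub>m) ps (0\<^sub>m 0 0)"

lemma bsum_simps [simp]: "bsum [] = 0\<^sub>m 0 0" "bsum (p # ps) = p \<oplus>\<^sub>m bsum ps"
  by (simp_all add: bsum_def)

lemma bsum_append: "bsum (ps @ qs) = bsum ps \<oplus>\<^sub>m bsum qs"
  by (induction ps) (auto simp: block_sum_assoc)

text \<open>Exactly the operations that enter projections and partial isometries. There is no unit
  among them, since that of the reduced group C*-algebra may differ from the identity
  operator.\<close>

locale star_subring =
  fixes A :: "'a::star_ring set"
  assumes zero_mem: "0 \<in> A"
    and add_mem: "x \<in> A \<Longrightarrow> y \<in> A \<Longrightarrow> x + y \<in> A"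
    and mult_mem: "x \<in> A \<Longrightarrow> y \<in> A \<Longrightarrow> x * y \<in> A"
    and star_mem: "x \<in> A \<Longrightarrow> star x \<in> A"
begin

lemma sum_mem: "(\<And>i. i \<in> I \<Longrightarrow> f i \<in> A) \<Longrightarrow> sum f I \<in> A"
  by (induction I rule: infinite_finite_induct) (auto intro: zero_mem add_mem)

lemma mats_mult: "M \<in> mats_over A l m \<Longrightarrow> N \<in> mats_over A m n \<Longrightarrow> M * N \<in> mats_over A l n"
  unfolding mats_over_iff
  by (auto simp: index_mult_mat_sum simp del: index_mult_mat(1) intro!: sum_mem mult_mem)

lemma mats_star: "M \<in> mats_over A m n \<Longrightarrow> star_mat M \<in> mats_over A n m"
  unfolding mats_over_iff by (auto intro!: star_mem)

lemma mats_zero: "0\<^sub>m m n \<in> mats_over A m n"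
  by (auto intro!: mats_overI zero_mem)

lemma mats_four_block:
  "P \<in> mats_over A r1 c1 \<Longrightarrow> Q \<in> mats_over A r1 c2 \<Longrightarrow> R \<in> mats_over A r2 c1 \<Longrightarrow> S \<in> mats_over A r2 c2 \<Longrightarrow>
    four_block_mat P Q R S \<in> mats_over A (r1 + r2) (c1 + c2)"
  unfolding mats_over_iff by auto

lemma mats_block_sum:
  "p \<in> mats_over A m n \<Longrightarrow> q \<in> mats_over A m' n' \<Longrightarrow> p \<oplus>\<^sub>m q \<in> mats_over A (m + m') (n + n')"
  unfolding block_sum_def by (intro mats_four_block) (auto simp: mats_over_iff intro: zero_mem)

lemma projectionsI: "p \<in> mats_over A n n \<Longrightarrow> star_mat p = p \<Longrightarrow> p * p = p \<Longrightarrow> p \<in> projections A"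
  by (auto simp: projections_def)

lemma projectionsD:
  assumes "p \<in> projections A"
  shows "p \<in> mats_over A (dim_row p) (dim_row p)" "dim_col p = dim_row p" "star_mat p = p" "p * p = p"
  using assms by (auto simp: projections_def mats_over_iff)

lemma block_sum_projections: "p \<in> projections A \<Longrightarrow> q \<in> projections A \<Longrightarrow> p \<oplus>\<^sub>m q \<in> projections A"
  by (rule projectionsI[OF mats_block_sum[OF projectionsD(1) projectionsD(1)]])
     (simp_all add: star_mat_block_sum block_sum_mult projectionsD)

lemma zero_projections: "0\<^sub>m 0 0 \<in> projections A"
  by (rule projectionsI[OF mats_zero]) auto

lemma bsum_projections: "set ps \<subseteq> projections A \<Longrightarrow> bsum ps \<in> projections A"
  by (induction ps) (auto intro: zero_projections block_sum_projections)

section \<open>Murray-von Neumann equivalence of projections\<close>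

lemma mvn_refl: "p \<in> projections A \<Longrightarrow> mvn_equiv A p p"
  unfolding mvn_equiv_def by (rule bexI[of _ p]) (auto simp: projectionsD)

lemma mvn_sym: "mvn_equiv A p q \<Longrightarrow> mvn_equiv A q p"
  unfolding mvn_equiv_def by (metis mats_star star_mat_star_mat)

text \<open>The product \<open>w * v\<close> of the two partial isometries works: its inner factor
  is \<open>q\<close> in either guise, so the products collapse to \<open>p * p\<close> and
  \<open>r * r\<close>.\<close>

lemma mvn_trans:
  assumes p: "p \<in> projections A" and r: "r \<in> projections A"
    and pq: "mvn_equiv A p q" and qr: "mvn_equiv A q r"
  shows "mvn_equiv A p r"
proof -
  obtain v where v: "v \<in> mats_over A (dim_row q) (dim_row p)" "star_mat v * v = p" "v * star_mat v = q"
    using pq by (auto simp: mvn_equiv_def)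
  obtain w where w: "w \<in> mats_over A (dim_row r) (dim_row q)" "star_mat w * w = q" "w * star_mat w = r"
    using qr by (auto simp: mvn_equiv_def)
  let ?a = "dim_row p" and ?b = "dim_row q" and ?c = "dim_row r"
  have V: "v \<in> carrier_mat ?b ?a" "star_mat v \<in> carrier_mat ?a ?b"
    and W: "w \<in> carrier_mat ?c ?b" "star_mat w \<in> carrier_mat ?b ?c"
    using v w by (auto simp: mats_over_iff)
  have s: "star_mat (w * v) = star_mat v * star_mat w" using V W by (subst star_mat_mult) auto
  have "star_mat (w * v) * (w * v) = star_mat v * ((star_mat w * w) * v)"
    unfolding s using V W
    by (intro assoc_mult_mat4)
  also have "\<dots> = (star_mat v * v) * (star_mat v * v)"
    unfolding w(2) v(3)[symmetric] using V
    by (intro assoc_mult_mat4[symmetric])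
  also have "\<dots> = p" by (simp add: v(2) projectionsD[OF p])
  finally have 1: "star_mat (w * v) * (w * v) = p" .
  have "(w * v) * star_mat (w * v) = w * ((v * star_mat v) * star_mat w)"
    unfolding s using V W
    by (intro assoc_mult_mat4)
  also have "\<dots> = (w * star_mat w) * (w * star_mat w)"
    unfolding v(3) w(2)[symmetric] using W
    by (intro assoc_mult_mat4[symmetric])
  also have "\<dots> = r" by (simp add: w(3) projectionsD[OF r])
  finally have 2: "(w * v) * star_mat (w * v) = r" .
  show ?thesis
    unfolding mvn_equiv_def by (rule bexI[of _ "w * v"]) (use 1 2 mats_mult[OF w(1) v(1)] in auto)
qed

lemma mvn_block_sum:
  assumes "mvn_equiv A p p'" "mvn_equiv A q q'"
  shows "mvn_equiv A (p \<oplus>\<^sub>m q) (p' \<oplus>\<^sub>m q')"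
proof -
  obtain v where v: "v \<in> mats_over A (dim_row p') (dim_row p)" "star_mat v * v = p" "v * star_mat v = p'"
    using assms by (auto simp: mvn_equiv_def)
  obtain w where w: "w \<in> mats_over A (dim_row q') (dim_row q)" "star_mat w * w = q" "w * star_mat w = q'"
    using assms by (auto simp: mvn_equiv_def)
  show ?thesis
    unfolding mvn_equiv_def
    by (rule bexI[of _ "v \<oplus>\<^sub>m w"])
       (use mats_block_sum[OF v(1) w(1)] v w in \<open>auto simp: star_mat_block_sum block_sum_mult\<close>)
qed

text \<open>The flip of the two summands implements the equivalence, with \<open>p\<close> and
  \<open>q\<close> in place of identity blocks so that its entries stay in \<open>A\<close>.\<close>

lemma mvn_block_sum_commute:
  assumes p: "p \<in> projections A" and q: "q \<in> projections A"
  shows "mvn_equiv A (p \<oplus>\<^sub>m q) (q \<oplus>\<^sub>m p)"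
proof -
  define a b where "a = dim_row p" and "b = dim_row q"
  have P: "p \<in> mats_over A a a" "p \<in> carrier_mat a a" "star_mat p = p" "p * p = p"
    and Q: "q \<in> mats_over A b b" "q \<in> carrier_mat b b" "star_mat q = q" "q * q = q"
    using projectionsD[OF p] projectionsD[OF q] by (auto simp: mats_over_iff a_def b_def)
  let ?w = "four_block_mat (0\<^sub>m b a) q p (0\<^sub>m a b)"
  have w: "?w \<in> mats_over A (b + a) (a + b)"
    by (intro mats_four_block mats_zero P Q)
  have s: "star_mat ?w = four_block_mat (0\<^sub>m a b) p q (0\<^sub>m b a)"
    by (subst star_mat_four_block[OF zero_carrier_mat Q(2) P(2) zero_carrier_mat]) (simp add: P Q)
  have "star_mat ?w * ?w = p \<oplus>\<^sub>m q"
    unfolding s block_sum_def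
    by (subst mult_four_block_mat[OF zero_carrier_mat P(2) Q(2) zero_carrier_mat zero_carrier_mat Q(2) P(2) zero_carrier_mat])
       (use P Q in \<open>simp only: left_mult_zero_mat right_mult_zero_mat left_add_zero_mat right_add_zero_mat carrier_matD, simp\<close>)
  moreover have "?w * star_mat ?w = q \<oplus>\<^sub>m p"
    unfolding s block_sum_def
    by (subst mult_four_block_mat[OF zero_carrier_mat Q(2) P(2) zero_carrier_mat zero_carrier_mat P(2) Q(2) zero_carrier_mat])
       (use P Q in \<open>simp only: left_mult_zero_mat right_mult_zero_mat left_add_zero_mat right_add_zero_mat carrier_matD, simp\<close>)
  ultimately show ?thesis
    unfolding mvn_equiv_def using w P Q by (intro bexI[of _ ?w]) simp_all
qed

lemma mvn_orthogonal_sum: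
  assumes p: "p \<in> projections A" and q: "q \<in> projections A" and d: "dim_row q = dim_row p"
    and pq: "p * q = 0\<^sub>m (dim_row p) (dim_row p)"
  shows "mvn_equiv A (p + q) (p \<oplus>\<^sub>m q)"
proof -
  define n where "n = dim_row p"
  have P: "p \<in> mats_over A n n" "p \<in> carrier_mat n n" "star_mat p = p" "p * p = p"
    and Q: "q \<in> mats_over A n n" "q \<in> carrier_mat n n" "star_mat q = q" "q * q = q"
    using projectionsD[OF p] projectionsD[OF q] d by (auto simp: mats_over_iff n_def)
  have pq: "p * q = 0\<^sub>m n n" using pq by (simp add: n_def)
  have "star_mat (p * q) = q * p" 
    using P Q by (subst star_mat_mult) simp_all
  then have qp: "q * p = 0\<^sub>m n n" using pq by simp
  \<comment> \<open>The column with \<open>p\<close> above \<open>q\<close>, written as a four-block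
    matrix whose right half is empty. The off-diagonal blocks of \<open>?w * star_mat ?w\<close> are
    \<open>p * q\<close> and \<open>q * p\<close>, which vanish.\<close>
  let ?w = "four_block_mat p (0\<^sub>m n 0) q (0\<^sub>m n 0)"
  have w: "?w \<in> mats_over A (n + n) (n + 0)"
    by (intro mats_four_block mats_zero P Q)
  have s: "star_mat ?w = four_block_mat p q (0\<^sub>m 0 n) (0\<^sub>m 0 n)"
    by (subst star_mat_four_block[OF P(2) zero_carrier_mat Q(2) zero_carrier_mat]) (simp add: P Q)
  have *: "four_block_mat (p + q) (0\<^sub>m n 0) (0\<^sub>m 0 n) (0\<^sub>m 0 0) = p + q"
    by (rule eq_matI) (use P Q in simp_all)
  have "star_mat ?w * ?w = p + q"
    unfolding s
    by (subst mult_four_block_mat[OF P(2) Q(2) zero_carrier_mat zero_carrier_mat P(2) zero_carrier_mat Q(2) zero_carrier_mat])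
       (use P Q * in simp)
  moreover have "?w * star_mat ?w = p \<oplus>\<^sub>m q"
    unfolding s block_sum_def
    by (subst mult_four_block_mat[OF P(2) zero_carrier_mat Q(2) zero_carrier_mat P(2) Q(2) zero_carrier_mat zero_carrier_mat])
       (use P Q pq qp in simp)
  ultimately show ?thesis
    unfolding mvn_equiv_def using w P Q by (intro bexI[of _ ?w]) simp_all
qed

text \<open>The first summand of \<open>ps\<close> is located in \<open>qs\<close> and moved to the
  front by a single flip against everything before it.\<close>

lemma mvn_bsum_perm:
  "mset ps = mset qs \<Longrightarrow> set ps \<subseteq> projections A \<Longrightarrow> mvn_equiv A (bsum ps) (bsum qs)"
proof (induction ps arbitrary: qs)
  case Nil
  then show ?case by (simp add: mvn_refl zero_projections)
next
  case (Cons p ps)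
  then have "p \<in> set qs" by (metis list.set_intros(1) set_mset_mset)
  then obtain q1 q2 where qs: "qs = q1 @ p # q2" by (meson split_list)
  have sq: "set q1 \<subseteq> projections A" "set q2 \<subseteq> projections A" "p \<in> projections A" "set ps \<subseteq> projections A"
    using Cons.prems mset_eq_setD[OF Cons.prems(1)] by (auto simp: qs)
  have "mvn_equiv A (bsum ps) (bsum (q1 @ q2))"
    using Cons by (auto simp: qs)
  then have 1: "mvn_equiv A (bsum (p # ps)) (p \<oplus>\<^sub>m bsum (q1 @ q2))"
    using sq by (auto intro: mvn_block_sum mvn_refl)
  have "mvn_equiv A ((p \<oplus>\<^sub>m bsum q1) \<oplus>\<^sub>m bsum q2) ((bsum q1 \<oplus>\<^sub>m p) \<oplus>\<^sub>m bsum q2)"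
    using sq by (intro mvn_block_sum mvn_block_sum_commute mvn_refl bsum_projections)
  then have "mvn_equiv A (p \<oplus>\<^sub>m bsum (q1 @ q2)) (bsum qs)"
    by (simp add: qs bsum_append block_sum_assoc)
  with 1 show ?case
    by (rule mvn_trans[rotated 2])
       (use sq in \<open>auto simp: qs intro!: block_sum_projections bsum_projections\<close>)
qed

section \<open>The Grothendieck group of stable classes\<close>

lemma K0_rel_iff:
  "((p, q), (p', q')) \<in> K0_rel A \<longleftrightarrow>
     p \<in> projections A \<and> q \<in> projections A \<and> p' \<in> projections A \<and> q' \<in> projections A \<and>
     (\<exists>r \<in> projections A. mvn_equiv A (bsum [p, q', r]) (bsum [p', q, r]))"
  by (simp add: K0_rel_def)

text \<open>The commutative law and the inverse law of the group reduce to this comparison of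
  multisets; the empty projection serves as stabiliser.\<close>

lemma K0_rel_perm:
  assumes "set xs \<subseteq> projections A" "set ys \<subseteq> projections A" "set xs' \<subseteq> projections A" "set ys' \<subseteq> projections A"
    "mset (xs @ ys') = mset (xs' @ ys)"
  shows "((bsum xs, bsum ys), (bsum xs', bsum ys')) \<in> K0_rel A"
proof -
  have "mvn_equiv A (bsum (xs @ ys')) (bsum (xs' @ ys))"
    by (rule mvn_bsum_perm[OF assms(5)]) (use assms in auto)
  then show ?thesis
    unfolding K0_rel_iff using assms
    by (auto intro!: bsum_projections bexI[of _ "0\<^sub>m 0 0"] zero_projections simp: bsum_append)
qed

lemma mvn_perm_chain:
  assumes "mvn_equiv A (bsum xs) (bsum ys)" "mset xs' = mset xs" "mset ys' = mset ys"
    "set xs \<subseteq> projections A" "set ys \<subseteq> projections A"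
  shows "mvn_equiv A (bsum xs') (bsum ys')"
proof -
  have s: "set xs' \<subseteq> projections A" "set ys' \<subseteq> projections A"
    using assms mset_eq_setD by blast+
  have "mvn_equiv A (bsum xs') (bsum xs)" "mvn_equiv A (bsum ys) (bsum ys')"
    by (rule mvn_bsum_perm; use assms s in simp)+
  with assms(1) show ?thesis
    using s assms(4,5) by (meson bsum_projections mvn_trans)
qed

lemma K0_equiv: "equiv (projections A \<times> projections A) (K0_rel A)"
proof (rule equivI)
  show "K0_rel A \<subseteq> (projections A \<times> projections A) \<times> (projections A \<times> projections A)"
    by (auto simp: K0_rel_def)
  show "refl_on (projections A \<times> projections A) (K0_rel A)"
    by (rule refl_onI) (auto simp: K0_rel_iff intro!: bexI[of _ "0\<^sub>m 0 0"] mvn_refl zero_projections block_sum_projections)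
  show "sym (K0_rel A)"
    by (rule symI) (use mvn_sym in \<open>fastforce simp: K0_rel_iff\<close>)
  show "trans (K0_rel A)"
  proof (rule transI)
    fix x y z assume xy: "(x, y) \<in> K0_rel A" and yz: "(y, z) \<in> K0_rel A"
    obtain p q p' q' p'' q'' where x: "x = (p, q)" and y: "y = (p', q')" and z: "z = (p'', q'')"
      by (cases x; cases y; cases z) auto
    obtain r where r: "r \<in> projections A" "mvn_equiv A (bsum [p, q', r]) (bsum [p', q, r])"
      and pr: "p \<in> projections A" "q \<in> projections A" "p' \<in> projections A" "q' \<in> projections A"
      using xy unfolding x y K0_rel_iff by blast
    obtain s where s: "s \<in> projections A" "mvn_equiv A (bsum [p', q'', s]) (bsum [p'', q', s])"
      and ps: "p'' \<in> projections A" "q'' \<in> projections A"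
      using yz unfolding z y K0_rel_iff by blast
    \<comment> \<open>In the sum of both equivalences \<open>p'\<close>, \<open>q'\<close>,
      \<open>r\<close> and \<open>s\<close> occur on either side; together they form the stabilising
      projection for the composite.\<close>
    have "mvn_equiv A (bsum ([p, q', r] @ [p', q'', s])) (bsum ([p', q, r] @ [p'', q', s]))"
      unfolding bsum_append by (rule mvn_block_sum[OF r(2) s(2)])
    then have "mvn_equiv A (bsum [p, q'', p', q', r, s]) (bsum [p'', q, p', q', r, s])"
      by (rule mvn_perm_chain) (use pr ps r s in \<open>auto simp: add_mset_commute\<close>)
    then show "(x, z) \<in> K0_rel A"
      unfolding x z K0_rel_iff using pr ps r s
      by (auto intro!: bexI[of _ "bsum [p', q', r, s]"] zero_projections block_sum_projections)
  qed
qed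

abbreviation "K0_diff p q \<equiv> K0_rel A `` {(p, q)}"

lemma K0_diff_eqI: "((p, q), (p', q')) \<in> K0_rel A \<Longrightarrow> K0_diff p q = K0_diff p' q'"
  by (rule equiv_class_eq[OF K0_equiv])

text \<open>The product in \<open>K0\<close> is a union over all pairs of representatives;
  congruence in both arguments shows that every term of the union is the same class.\<close>

lemma K0_mult:
  assumes "p \<in> projections A" "q \<in> projections A" "p' \<in> projections A" "q' \<in> projections A"
  shows "K0_diff p q \<otimes>\<^bsub>K0 A\<^esub> K0_diff p' q' = K0_diff (p \<oplus>\<^sub>m p') (q \<oplus>\<^sub>m q')"
proof -
  define f where "f = (\<lambda>x y. K0_diff (fst x \<oplus>\<^sub>m fst y) (snd x \<oplus>\<^sub>m snd y))"
  have "congruent2 (K0_rel A) (K0_rel A) f"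
  proof (rule congruent2I', clarify)
    fix p1 q1 p1' q1' p2 q2 p2' q2'
    assume 1: "((p1, q1), (p1', q1')) \<in> K0_rel A" and 2: "((p2, q2), (p2', q2')) \<in> K0_rel A"
    obtain r where r: "r \<in> projections A" "mvn_equiv A (bsum [p1, q1', r]) (bsum [p1', q1, r])"
      and pr: "p1 \<in> projections A" "q1 \<in> projections A" "p1' \<in> projections A" "q1' \<in> projections A"
      using 1 unfolding K0_rel_iff by blast
    obtain s where s: "s \<in> projections A" "mvn_equiv A (bsum [p2, q2', s]) (bsum [p2', q2, s])"
      and ps: "p2 \<in> projections A" "q2 \<in> projections A" "p2' \<in> projections A" "q2' \<in> projections A"
      using 2 unfolding K0_rel_iff by blast
    have "mvn_equiv A (bsum ([p1, q1', r] @ [p2, q2', s])) (bsum ([p1', q1, r] @ [p2', q2, s]))"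
      unfolding bsum_append by (rule mvn_block_sum[OF r(2) s(2)])
    then have "mvn_equiv A (bsum [p1, p2, q1', q2', r, s]) (bsum [p1', p2', q1, q2, r, s])"
      by (rule mvn_perm_chain) (use pr ps r s in \<open>auto simp: add_mset_commute\<close>)
    then have "((p1 \<oplus>\<^sub>m p2, q1 \<oplus>\<^sub>m q2), (p1' \<oplus>\<^sub>m p2', q1' \<oplus>\<^sub>m q2')) \<in> K0_rel A"
      unfolding K0_rel_iff using pr ps r s
      by (auto intro!: bexI[of _ "bsum [r, s]"] zero_projections block_sum_projections simp: block_sum_assoc)
    then show "f (p1, q1) (p2, q2) = f (p1', q1') (p2', q2')"
      unfolding f_def by (intro K0_diff_eqI) simp
  qed
  from UN_equiv_class2[OF K0_equiv K0_equiv this, of "(p, q)" "(p', q')"] assms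
  show ?thesis by (simp add: K0_def f_def case_prod_beta)
qed

lemma K0_carrierE:
  assumes "X \<in> carrier (K0 A)"
  obtains p q where "p \<in> projections A" "q \<in> projections A" "X = K0_diff p q"
  using assms by (auto simp: K0_def elim!: quotientE)

lemma K0_diff_carrier: "p \<in> projections A \<Longrightarrow> q \<in> projections A \<Longrightarrow> K0_diff p q \<in> carrier (K0 A)"
  by (auto simp: K0_def intro!: quotientI)

lemma K0_one: "\<one>\<^bsub>K0 A\<^esub> = K0_diff (0\<^sub>m 0 0) (0\<^sub>m 0 0)"
  by (simp add: K0_def)

lemma K0_comm_group: "comm_group (K0 A)"
proof (rule comm_groupI)
  show "\<one>\<^bsub>K0 A\<^esub> \<in> carrier (K0 A)"
    unfolding K0_one by (intro K0_diff_carrier zero_projections)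
next
  fix X Y assume "X \<in> carrier (K0 A)" "Y \<in> carrier (K0 A)"
  then obtain p q p' q' where pr: "p \<in> projections A" "q \<in> projections A" "p' \<in> projections A" "q' \<in> projections A"
    and XY: "X = K0_diff p q" "Y = K0_diff p' q'" by (metis K0_carrierE)
  show "X \<otimes>\<^bsub>K0 A\<^esub> Y \<in> carrier (K0 A)"
    using pr by (simp add: XY K0_mult K0_diff_carrier block_sum_projections)
  show "X \<otimes>\<^bsub>K0 A\<^esub> Y = Y \<otimes>\<^bsub>K0 A\<^esub> X"
    using pr K0_diff_eqI[OF K0_rel_perm, of "[p, p']" "[q, q']" "[p', p]" "[q', q]"]
    by (simp add: XY K0_mult)
next
  fix X Y Z assume "X \<in> carrier (K0 A)" "Y \<in> carrier (K0 A)" "Z \<in> carrier (K0 A)"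
  then show "X \<otimes>\<^bsub>K0 A\<^esub> Y \<otimes>\<^bsub>K0 A\<^esub> Z = X \<otimes>\<^bsub>K0 A\<^esub> (Y \<otimes>\<^bsub>K0 A\<^esub> Z)"
    by (elim K0_carrierE) (simp add: K0_mult block_sum_projections block_sum_assoc)
next
  fix X assume "X \<in> carrier (K0 A)"
  then obtain p q where pr: "p \<in> projections A" "q \<in> projections A" and X: "X = K0_diff p q"
    by (metis K0_carrierE)
  show "\<one>\<^bsub>K0 A\<^esub> \<otimes>\<^bsub>K0 A\<^esub> X = X"
    using pr by (simp add: X K0_one K0_mult zero_projections)
  have "K0_diff q p \<otimes>\<^bsub>K0 A\<^esub> X = \<one>\<^bsub>K0 A\<^esub>"
    using pr K0_diff_eqI[OF K0_rel_perm, of "[q, p]" "[p, q]" "[]" "[]"]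
    by (simp add: X K0_mult K0_one)
  then show "\<exists>Y\<in>carrier (K0 A). Y \<otimes>\<^bsub>K0 A\<^esub> X = \<one>\<^bsub>K0 A\<^esub>"
    using pr K0_diff_carrier by blast
qed

lemma K0_class_carrier: "p \<in> projections A \<Longrightarrow> K0_class A p \<in> carrier (K0 A)"
  by (simp add: K0_class_def K0_diff_carrier zero_projections)

lemma K0_class_block_sum:
  "p \<in> projections A \<Longrightarrow> q \<in> projections A \<Longrightarrow>
    K0_class A (p \<oplus>\<^sub>m q) = K0_class A p \<otimes>\<^bsub>K0 A\<^esub> K0_class A q"
  by (simp add: K0_class_def K0_mult zero_projections)

lemma K0_class_mvn:
  assumes "p \<in> projections A" "q \<in> projections A" "mvn_equiv A p q"
  shows "K0_class A p = K0_class A q"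
  unfolding K0_class_def using assms
  by (intro K0_diff_eqI) (auto simp: K0_rel_iff zero_projections intro!: bexI[of _ "0\<^sub>m 0 0"])

lemma K0_class_bsum:
  assumes "distinct xs" "\<And>x. x \<in> set xs \<Longrightarrow> F x \<in> projections A"
  shows "(\<Otimes>\<^bsub>K0 A\<^esub>x \<in> set xs. K0_class A (F x)) = K0_class A (bsum (map F xs))"
proof -
  interpret comm_group "K0 A" by (rule K0_comm_group)
  from assms show ?thesis
  proof (induction xs)
    case Nil
    then show ?case by (simp add: K0_class_def K0_one)
  next
    case (Cons x xs)
    then show ?case
      by (subst list.set, subst finprod_insert)
         (auto simp: K0_class_carrier K0_class_block_sum bsum_projections image_subset_iff)
  qed
qed

end

section \<open>Completeness of the operator algebras\<close>

lemma norm_ell2_power2: "(norm x)\<^sup>2 = (\<Sum>\<^sub>\<infinity>i. (cmod (coord x i))\<^sup>2)"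
  by (simp add: norm_ell2.rep_eq infsum_nonneg)

lemma sum_coord_le_norm:
  assumes "finite F"
  shows "(\<Sum>i\<in>F. (cmod (coord x i))\<^sup>2) \<le> (norm x)\<^sup>2"
  unfolding norm_ell2_power2 by (rule finite_sum_le_infsum[OF ell2_summable]) (use assms in auto)

lemma cmod_coord_le_norm: "cmod (coord x i) \<le> norm x"
proof (rule power2_le_imp_le)
  show "(cmod (coord x i))\<^sup>2 \<le> (norm x)\<^sup>2" using sum_coord_le_norm[of "{i}" x] by simp
qed simp

lemma norm_ell2_le:
  assumes "\<And>F. finite F \<Longrightarrow> (\<Sum>i\<in>F. (cmod (coord x i))\<^sup>2) \<le> C\<^sup>2" "0 \<le> C"
  shows "norm x \<le> C"
proof -
  have "(norm x)\<^sup>2 \<le> C\<^sup>2"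
    unfolding norm_ell2_power2 by (rule square_summable_bound(2)[OF assms(1)])
  then show ?thesis using assms(2) by (rule power2_le_imp_le)
qed

instance ell2 :: (type) banach
proof
  fix X :: "nat \<Rightarrow> 'a ell2"
  assume X: "Cauchy X"
  have "Cauchy (\<lambda>n. coord (X n) i)" for i
  proof (rule CauchyI)
    fix e :: real assume "0 < e"
    then obtain M where "\<forall>m\<ge>M. \<forall>n\<ge>M. norm (X m - X n) < e" using CauchyD[OF X] by blast
    then show "\<exists>M. \<forall>m\<ge>M. \<forall>n\<ge>M. cmod (coord (X m) i - coord (X n) i) < e"
      by (metis cmod_coord_le_norm minus_ell2.rep_eq order_le_less_trans)
  qed
  then have "\<forall>i. \<exists>l. (\<lambda>n. coord (X n) i) \<longlonglongrightarrow> l" by (simp add: Cauchy_convergent_iff convergent_def)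
  then obtain f where f: "\<And>i. (\<lambda>n. coord (X n) i) \<longlonglongrightarrow> f i" by metis
  \<comment> \<open>The bound is uniform over finite index sets. For fixed \<open>F\<close> the
    limit in \<open>m\<close> passes through a finite sum, so no interchange of infinite limits
    occurs.\<close>
  have tail: "\<exists>M. \<forall>n\<ge>M. \<forall>F. finite F \<longrightarrow> (\<Sum>i\<in>F. (cmod (coord (X n) i - f i))\<^sup>2) \<le> e\<^sup>2"
    if e: "0 < e" for e :: real
  proof -
    obtain M where M: "\<And>m n. m \<ge> M \<Longrightarrow> n \<ge> M \<Longrightarrow> norm (X m - X n) < e"
      using CauchyD[OF X e] by blast
    have "(\<Sum>i\<in>F. (cmod (coord (X n) i - f i))\<^sup>2) \<le> e\<^sup>2" if n: "n \<ge> M" and F: "finite F" for n F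
    proof (rule LIMSEQ_le_const2)
      show "(\<lambda>m. \<Sum>i\<in>F. (cmod (coord (X n) i - coord (X m) i))\<^sup>2) \<longlonglongrightarrow> (\<Sum>i\<in>F. (cmod (coord (X n) i - f i))\<^sup>2)"
        by (intro tendsto_intros f)
      have "(\<Sum>i\<in>F. (cmod (coord (X n) i - coord (X m) i))\<^sup>2) \<le> e\<^sup>2" if m: "m \<ge> M" for m
      proof -
        have "(\<Sum>i\<in>F. (cmod (coord (X n) i - coord (X m) i))\<^sup>2) \<le> (norm (X n - X m))\<^sup>2"
          using sum_coord_le_norm[OF F, of "X n - X m"] by (simp add: minus_ell2.rep_eq)
        also have "\<dots> \<le> e\<^sup>2" using M[OF n m] by (intro power_mono) auto
        finally show ?thesis .
      qed
      then show "\<exists>N. \<forall>m\<ge>N. (\<Sum>i\<in>F. (cmod (coord (X n) i - coord (X m) i))\<^sup>2) \<le> e\<^sup>2" by blast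
    qed
    then show ?thesis by blast
  qed
  obtain N where N: "\<And>F. finite F \<Longrightarrow> (\<Sum>i\<in>F. (cmod (coord (X N) i - f i))\<^sup>2) \<le> 1\<^sup>2"
    using tail[of 1] by auto
  \<comment> \<open>Square-summability of the pointwise limit \<open>f\<close> is not known yet,
    only that of its difference from \<open>X N\<close>; hence the detour.\<close>
  define L where "L = X N - Abs_ell2 (\<lambda>i. coord (X N) i - f i)"
  have "coord (Abs_ell2 (\<lambda>i. coord (X N) i - f i)) = (\<lambda>i. coord (X N) i - f i)"
    using square_summable_bound(1)[OF N] by (intro Abs_ell2_inverse) simp
  then have L: "coord L = f" by (simp add: L_def minus_ell2.rep_eq fun_eq_iff)
  have "X \<longlonglongrightarrow> L"
  proof (rule LIMSEQ_I)
    fix r :: real assume r: "0 < r"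
    obtain M where M: "\<And>n F. n \<ge> M \<Longrightarrow> finite F \<Longrightarrow> (\<Sum>i\<in>F. (cmod (coord (X n) i - f i))\<^sup>2) \<le> (r / 2)\<^sup>2"
      using tail[of "r / 2"] r by auto
    have "norm (X n - L) \<le> r / 2" if "n \<ge> M" for n
      by (rule norm_ell2_le) (use M[OF that] r L in \<open>auto simp: minus_ell2.rep_eq\<close>)
    then have "\<forall>n\<ge>M. norm (X n - L) < r" using r by (smt (verit) field_sum_of_halves)
    then show "\<exists>no. \<forall>n\<ge>no. norm (X n - L) < r" by blast
  qed
  then show "convergent X" by (auto simp: convergent_def)
qed

lemma cinner_Cauchy_Schwarz: "cmod (cinner x y) \<le> norm x * norm y"
proof -
  have "cmod (cinner x y) \<le> (\<Sum>\<^sub>\<infinity>i. cmod (cnj (coord x i) * coord y i))"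
    unfolding cinner_def by (rule norm_infsum_bound[OF cinner_abs_summable])
  also have "\<dots> \<le> norm x * norm y"
  proof (rule infsum_le_finite_sums[OF cinner_abs_summable])
    fix F :: "'a set" assume F: "finite F"
    have "(\<Sum>i\<in>F. cmod (cnj (coord x i) * coord y i)) = (\<Sum>i\<in>F. \<bar>cmod (coord x i)\<bar> * \<bar>cmod (coord y i)\<bar>)"
      by (simp add: norm_mult)
    also have "\<dots> \<le> L2_set (\<lambda>i. cmod (coord x i)) F * L2_set (\<lambda>i. cmod (coord y i)) F"
      by (rule L2_set_mult_ineq)
    also have "\<dots> \<le> norm x * norm y"
      unfolding norm_ell2.rep_eq
      by (intro mult_mono L2_set_le_ell2 ell2_summable F L2_set_nonneg real_sqrt_ge_zero infsum_nonneg zero_le_power2)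
    finally show "(\<Sum>i\<in>F. cmod (cnj (coord x i) * coord y i)) \<le> norm x * norm y" .
  qed
  finally show ?thesis .
qed

lemma bounded_bilinear_cinner: "bounded_bilinear cinner"
proof
  show "cinner (a + a') b = cinner a b + cinner a' b" for a a' b :: "'a ell2" by (rule cinner_add_left)
  show "cinner a (b + b') = cinner a b + cinner a b'" for a b b' :: "'a ell2" by (rule cinner_add_right)
  show "cinner (r *\<^sub>R a) b = r *\<^sub>R cinner a b" for r and a b :: "'a ell2"
    by (simp add: scaleR_scaleC cinner_scaleC_left scaleR_conv_of_real)
  show "cinner a (r *\<^sub>R b) = r *\<^sub>R cinner a b" for r and a b :: "'a ell2"
    by (simp add: scaleR_scaleC cinner_scaleC_right scaleR_conv_of_real)
  show "\<exists>K. \<forall>a b. norm (cinner a b) \<le> norm a * norm (b :: 'a ell2) * K"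
    by (intro exI[of _ 1]) (simp add: cinner_Cauchy_Schwarz)
qed

interpretation cinner: bounded_bilinear cinner by (rule bounded_bilinear_cinner)

lemma norm_bop_apply_le: "norm (bop_apply T x) \<le> norm T * norm x"
  by transfer (rule norm_blinfun)

lemma norm_bop_le: "0 \<le> b \<Longrightarrow> (\<And>x. norm (bop_apply T x) \<le> b * norm x) \<Longrightarrow> norm T \<le> b"
  by transfer (rule norm_blinfun_bound)

lemmas bop_apply_linear = linear_simps[OF bounded_linear_bop]
lemmas bop_apply_sum_right = linear_sum[OF bounded_linear.linear[OF bounded_linear_bop]]

lemma bop_apply_zero [simp]: "bop_apply 0 x = 0"
  by transfer simp

lemma bop_apply_minus: "bop_apply (- T) x = - bop_apply T x"
  by transfer (simp add: blinfun.minus_left)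

lemma bop_apply_diff: "bop_apply (S - T) x = bop_apply S x - bop_apply T x"
  by (simp only: minus_bop_def bop_apply_plus bop_apply_minus diff_conv_add_uminus)

lemma bop_apply_scaleR: "bop_apply (r *\<^sub>R T) x = r *\<^sub>R bop_apply T x"
  by transfer (simp add: blinfun.scaleR_left)

lemma bop_apply_sum: "bop_apply (sum f I) x = (\<Sum>i\<in>I. bop_apply (f i) x)"
  by (induction I rule: infinite_finite_induct) (auto simp: bop_apply_plus)

lemma star_scaleR_bop: "star (r *\<^sub>R T) = r *\<^sub>R star (T :: 'i bop)"
  by (rule star_bop_eqI) (simp add: bop_apply_scaleR cinner.scaleR_left cinner.scaleR_right cinner_star)

text \<open>With \<open>y = bop_apply (star T) x\<close> one has |y|^2 = <T y, x>, and one factor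
  |y| cancels. This continuity of the adjoint is what makes the operator algebra complete.\<close>

lemma norm_star_bop_le: "norm (star T) \<le> norm (T :: 'i bop)"
proof (rule norm_bop_le)
  fix x :: "'i ell2"
  let ?y = "bop_apply (star T) x"
  have "(norm ?y)\<^sup>2 = cmod (cinner ?y ?y)" by (simp add: cinner_self norm_power)
  also have "\<dots> = cmod (cinner (bop_apply T ?y) x)" by (simp add: cinner_star)
  also have "\<dots> \<le> norm (bop_apply T ?y) * norm x" by (rule cinner_Cauchy_Schwarz)
  also have "\<dots> \<le> (norm T * norm ?y) * norm x" by (intro mult_right_mono norm_bop_apply_le) auto
  finally have "norm ?y * norm ?y \<le> norm ?y * (norm T * norm x)" by (simp add: power2_eq_square mult_ac)
  then show "norm ?y \<le> norm T * norm x"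
    by (cases "norm ?y = 0") (auto simp: mult_le_cancel_left)
qed simp

lemma bounded_linear_star: "bounded_linear (star :: 'i bop \<Rightarrow> _)"
  by (rule bounded_linear_intro[where K = 1]) (auto simp: star_add star_scaleR_bop norm_star_bop_le)

lemma Rep_bop_diff: "Rep_bop (S - T) = Rep_bop S - Rep_bop T"
  by (simp only: minus_bop_def plus_bop.rep_eq uminus_bop.rep_eq diff_conv_add_uminus)

text \<open>The adjoints of a Cauchy sequence are Cauchy as well, and their limit is an adjoint of
  the limit; so adjointability survives norm limits of real-linear maps.\<close>

instance bop :: (type) banach
proof
  fix X :: "nat \<Rightarrow> 'a bop"
  assume X: "Cauchy X"
  have C: "convergent (\<lambda>n. Rep_bop (Y n))" if "Cauchy Y" for Y :: "nat \<Rightarrow> 'a bop"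
    using that unfolding Cauchy_convergent_iff[symmetric] Cauchy_iff by (simp add: norm_bop.rep_eq Rep_bop_diff)
  have "Cauchy (\<lambda>n. star (X n))"
    by (rule bounded_linear.Cauchy[OF bounded_linear_star X])
  then obtain S where S: "(\<lambda>n. Rep_bop (star (X n))) \<longlonglongrightarrow> S" using C by (auto simp: convergent_def)
  obtain T where T: "(\<lambda>n. Rep_bop (X n)) \<longlonglongrightarrow> T" using C[OF X] by (auto simp: convergent_def)
  have "cinner (blinfun_apply T x) y = cinner x (blinfun_apply S y)" for x y
  proof (rule LIMSEQ_unique)
    show "(\<lambda>n. cinner (blinfun_apply (Rep_bop (X n)) x) y) \<longlonglongrightarrow> cinner (blinfun_apply T x) y"
      by (intro cinner.tendsto tendsto_const blinfun.tendsto T)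
    have "(\<lambda>n. cinner x (blinfun_apply (Rep_bop (star (X n))) y)) \<longlonglongrightarrow> cinner x (blinfun_apply S y)"
      by (intro cinner.tendsto tendsto_const blinfun.tendsto S)
    then show "(\<lambda>n. cinner (blinfun_apply (Rep_bop (X n)) x) y) \<longlonglongrightarrow> cinner x (blinfun_apply S y)"
      by (simp add: bop_apply.rep_eq[symmetric] cinner_star)
  qed
  then have R: "Rep_bop (Abs_bop T) = T" by (intro Abs_bop_inverse) auto
  have "X \<longlonglongrightarrow> Abs_bop T"
    using T unfolding LIMSEQ_iff by (simp add: norm_bop.rep_eq Rep_bop_diff R)
  then show "convergent X" by (auto simp: convergent_def)
qed

lemma star_scaleC_bop: "star (scaleC_bop c T) = scaleC_bop (cnj c) (star T)"
  by (rule star_bop_eqI) (simp add: bop_apply_scaleC cinner_scaleC_left cinner_scaleC_right cinner_star)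

text \<open>The underlying maps are only real-linear by type; an adjoint for the complex inner
  product forces complex linearity.\<close>

lemma bop_apply_scaleC_right: "bop_apply T (scaleC_ell2 c x) = scaleC_ell2 c (bop_apply T x)"
  by (rule cinner_extensionality) (metis cinner_scaleC_right cinner_star star_star)

lemma scaleC_bop_mult: "scaleC_bop c S * scaleC_bop d T = scaleC_bop (c * d) (S * T)"
  by (rule bop_eqI, rule ell2_eqI)
    (simp add: bop_apply_times bop_apply_scaleC bop_apply_scaleC_right scaleC_ell2.rep_eq)

section \<open>The left regular representation\<close>

context group
begin

lemma left_reg_mult:
  "g \<in> carrier G \<Longrightarrow> h \<in> carrier G \<Longrightarrow> left_reg G g * left_reg G h = left_reg G (g \<otimes> h)"
  by (rule bop_eqI, rule ell2_eqI) (simp add: bop_apply_times coord_left_reg inv_mult_group m_assoc)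

lemma left_reg_star:
  assumes g: "g \<in> carrier G"
  shows "star (left_reg G g) = left_reg G (inv g)"
proof -
  define L where "L = (\<lambda>g f. Abs_ell2 (\<lambda>x. if x \<in> carrier G then coord f (inv g \<otimes> x) else 0))"
  have "bop_apply (left_reg G g) = L g" if "g \<in> carrier G" for g
    unfolding left_reg_def L_def
    by (rule bop_apply_bop_of[OF left_reg_aux(2)[OF that] left_reg_aux(2)[OF inv_closed[OF that]]
        left_reg_aux(3)[OF that]])
  then show ?thesis
    using g left_reg_aux(3)[OF g] by (intro star_bop_eqI) (simp add: L_def)
qed

lemma left_reg_apply_mult:
  "g \<in> carrier G \<Longrightarrow> h \<in> carrier G \<Longrightarrow>
    bop_apply (left_reg G g) (bop_apply (left_reg G h) \<xi>) = bop_apply (left_reg G (g \<otimes> h)) \<xi>"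
  by (simp add: left_reg_mult[symmetric] bop_apply_times)

text \<open>On families over the whole type \<open>left_reg G g\<close> is a partial isometry with
  initial projection \<open>left_reg G \<one>\<close>, so the vector on the right has to be cut down
  to the carrier.\<close>

lemma norm_left_reg:
  assumes g: "g \<in> carrier G"
  shows "norm (bop_apply (left_reg G g) \<xi>) = norm (bop_apply (left_reg G \<one>) \<xi>)"
proof -
  have *: "cinner (bop_apply (left_reg G h) \<xi>) (bop_apply (left_reg G h) \<xi>) = cinner \<xi> (bop_apply (left_reg G \<one>) \<xi>)"
    if "h \<in> carrier G" for h
    using that by (simp add: cinner_star left_reg_star left_reg_apply_mult)
  have "(norm (bop_apply (left_reg G g) \<xi>))\<^sup>2 = (norm (bop_apply (left_reg G \<one>) \<xi>))\<^sup>2"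
    using *[OF g] *[OF one_closed] by (simp add: cinner_self del: of_real_power flip: of_real_eq_iff[where 'a=complex])
  then show ?thesis by (rule power2_eq_imp_eq) simp_all
qed

section \<open>The complex group ring and its norm closure\<close>

definition group_span :: "'a bop set" where
  "group_span = {\<Sum>g\<in>F. scaleC_bop (c g) (left_reg G g) | c F. finite F \<and> F \<subseteq> carrier G}"

lemma scaleC_bop_add_left: "scaleC_bop (a + b) T = scaleC_bop a T + scaleC_bop b T"
  by (rule bop_eqI, rule ell2_eqI)
    (simp add: bop_apply_plus bop_apply_scaleC scaleC_ell2.rep_eq plus_ell2.rep_eq distrib_right)

lemma scaleC_bop_zero: "scaleC_bop 0 T = 0"
  by (rule bop_eqI, rule ell2_eqI) (simp add: bop_apply_scaleC scaleC_ell2.rep_eq zero_ell2.rep_eq)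

lemma group_span_zero: "0 \<in> group_span"
  unfolding group_span_def by (auto intro!: exI[of _ "{}"])

lemma group_span_single: "g \<in> carrier G \<Longrightarrow> scaleC_bop c (left_reg G g) \<in> group_span"
  unfolding group_span_def by (auto intro!: exI[of _ "\<lambda>_. c"] exI[of _ "{g}"])

lemma group_span_add:
  assumes "x \<in> group_span" "y \<in> group_span"
  shows "x + y \<in> group_span"
proof -
  obtain c F where F: "finite F" "F \<subseteq> carrier G" and x: "x = (\<Sum>g\<in>F. scaleC_bop (c g) (left_reg G g))"
    using assms(1) by (auto simp: group_span_def)
  obtain c' F' where F': "finite F'" "F' \<subseteq> carrier G" and y: "y = (\<Sum>g\<in>F'. scaleC_bop (c' g) (left_reg G g))"
    using assms(2) by (auto simp: group_span_def)
  have x': "x = (\<Sum>g\<in>F \<union> F'. scaleC_bop (if g \<in> F then c g else 0) (left_reg G g))"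
    unfolding x by (rule sum.mono_neutral_cong_left) (use F F' in \<open>auto simp: scaleC_bop_zero\<close>)
  have y': "y = (\<Sum>g\<in>F \<union> F'. scaleC_bop (if g \<in> F' then c' g else 0) (left_reg G g))"
    unfolding y by (rule sum.mono_neutral_cong_left) (use F F' in \<open>auto simp: scaleC_bop_zero\<close>)
  have "x + y = (\<Sum>g\<in>F \<union> F'. scaleC_bop ((if g \<in> F then c g else 0) + (if g \<in> F' then c' g else 0)) (left_reg G g))"
    unfolding x' y' by (simp add: sum.distrib[symmetric] scaleC_bop_add_left)
  then show ?thesis unfolding group_span_def mem_Collect_eq using F F'
    by (intro exI[of _ "\<lambda>g. (if g \<in> F then c g else 0) + (if g \<in> F' then c' g else 0)"]
        exI[of _ "F \<union> F'"] conjI) auto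
qed

lemma group_span_sum: "(\<And>i. i \<in> I \<Longrightarrow> f i \<in> group_span) \<Longrightarrow> sum f I \<in> group_span"
  by (induction I rule: infinite_finite_induct) (auto intro: group_span_zero group_span_add)

lemma group_span_mult:
  assumes "x \<in> group_span" "y \<in> group_span"
  shows "x * y \<in> group_span"
proof -
  obtain c F where F: "finite F" "F \<subseteq> carrier G" and x: "x = (\<Sum>g\<in>F. scaleC_bop (c g) (left_reg G g))"
    using assms(1) by (auto simp: group_span_def)
  obtain c' F' where F': "finite F'" "F' \<subseteq> carrier G" and y: "y = (\<Sum>g\<in>F'. scaleC_bop (c' g) (left_reg G g))"
    using assms(2) by (auto simp: group_span_def)
  have "scaleC_bop (c g) (left_reg G g) * scaleC_bop (c' h) (left_reg G h) \<in> group_span"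
    if "g \<in> F" "h \<in> F'" for g h
  proof -
    have "g \<in> carrier G" "h \<in> carrier G" using that F F' by auto
    then show ?thesis by (simp add: scaleC_bop_mult left_reg_mult group_span_single)
  qed
  then show ?thesis unfolding x y sum_product by (intro group_span_sum) auto
qed

lemma group_span_star:
  assumes "x \<in> group_span"
  shows "star x \<in> group_span"
proof -
  obtain c F where F: "finite F" "F \<subseteq> carrier G" and x: "x = (\<Sum>g\<in>F. scaleC_bop (c g) (left_reg G g))"
    using assms by (auto simp: group_span_def)
  show ?thesis unfolding x star_sum using F
    by (intro group_span_sum) (auto simp: star_scaleC_bop left_reg_star subset_iff intro!: group_span_single)
qed

lemma reduced_cstar_eq: "reduced_cstar G = closure group_span"
  by (simp add: reduced_cstar_def group_span_def)

lemma closed_reduced_cstar: "closed (reduced_cstar G)"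
  by (simp add: reduced_cstar_eq)

lemma star_subring_reduced_cstar: "star_subring (reduced_cstar G)"
proof
  show "0 \<in> reduced_cstar G"
    using closure_subset group_span_zero by (auto simp: reduced_cstar_eq)
next
  fix x y assume "x \<in> reduced_cstar G" "y \<in> reduced_cstar G"
  then obtain u v where u: "\<And>n. u n \<in> group_span" "u \<longlonglongrightarrow> x" and v: "\<And>n. v n \<in> group_span" "v \<longlonglongrightarrow> y"
    unfolding reduced_cstar_eq closure_sequential by blast
  show "x + y \<in> reduced_cstar G"
    unfolding reduced_cstar_eq closure_sequential
    using u v by (intro exI[of _ "\<lambda>n. u n + v n"]) (auto intro: group_span_add tendsto_add)
  show "x * y \<in> reduced_cstar G"
    unfolding reduced_cstar_eq closure_sequential
    using u v by (intro exI[of _ "\<lambda>n. u n * v n"]) (auto intro: group_span_mult tendsto_mult)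
next
  fix x assume "x \<in> reduced_cstar G"
  then obtain u where u: "\<And>n. u n \<in> group_span" "u \<longlonglongrightarrow> x"
    unfolding reduced_cstar_eq closure_sequential by blast
  show "star x \<in> reduced_cstar G"
    unfolding reduced_cstar_eq closure_sequential
    using u by (intro exI[of _ "\<lambda>n. star (u n)"])
       (auto intro: group_span_star bounded_linear.tendsto[OF bounded_linear_star])
qed

lemma scaleC_bop_of_real: "scaleC_bop (of_real r) T = r *\<^sub>R T"
  by (rule bop_eqI) (simp add: bop_apply_scaleC bop_apply_scaleR scaleR_scaleC)

lemma left_reg_mem: "g \<in> carrier G \<Longrightarrow> left_reg G g \<in> reduced_cstar G"
  using subsetD[OF closure_subset group_span_single[of g 1]] scaleC_bop_of_real[of 1 "left_reg G g"]
  by (simp add: reduced_cstar_eq)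

lemma reduced_cstar_scaleR:
  assumes "x \<in> reduced_cstar G"
  shows "r *\<^sub>R x \<in> reduced_cstar G"
proof -
  have sc: "r *\<^sub>R y \<in> group_span" if y: "y \<in> group_span" for y
  proof -
    obtain c F where F: "finite F" "F \<subseteq> carrier G" and y: "y = (\<Sum>g\<in>F. scaleC_bop (c g) (left_reg G g))"
      using y by (auto simp: group_span_def)
    have "r *\<^sub>R scaleC_bop a T = scaleC_bop (of_real r * a) T" for a and T :: "'a bop"
      by (rule bop_eqI, rule ell2_eqI)
        (simp add: bop_apply_scaleC bop_apply_scaleR scaleC_ell2.rep_eq scaleR_ell2.rep_eq scaleR_conv_of_real)
    then show ?thesis unfolding y scaleR_sum_right using F
      by (intro group_span_sum) (auto intro!: group_span_single)
  qed
  obtain u where u: "\<And>n. u n \<in> group_span" "u \<longlonglongrightarrow> x"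
    using assms unfolding reduced_cstar_eq closure_sequential by blast
  show ?thesis
    unfolding reduced_cstar_eq closure_sequential
    using u by (intro exI[of _ "\<lambda>n. r *\<^sub>R u n"]) (auto intro: sc tendsto_scaleR)
qed

section \<open>Averaging projections of finite subgroups\<close>

lemma averaging_mem:
  assumes "H \<subseteq> carrier G"
  shows "averaging G H \<in> reduced_cstar G"
proof -
  interpret star_subring "reduced_cstar G" by (rule star_subring_reduced_cstar)
  show ?thesis unfolding averaging_def
    using assms by (intro reduced_cstar_scaleR sum_mem left_reg_mem) auto
qed

lemma averaging_absorb:
  assumes H: "subgroup H G" and h: "h \<in> H"
  shows "left_reg G h * averaging G H = averaging G H"
proof -
  have HG: "x \<in> carrier G" if "x \<in> H" for x using subgroup.mem_carrier[OF H that] .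
  have "(\<Sum>x\<in>H. left_reg G h * left_reg G x) = (\<Sum>x\<in>H. left_reg G (h \<otimes> x))"
    by (intro sum.cong) (use HG h in \<open>auto simp: left_reg_mult\<close>)
  also have "\<dots> = (\<Sum>x\<in>H. left_reg G x)"
    by (rule sum.reindex_bij_witness[where i = "\<lambda>x. inv h \<otimes> x" and j = "\<lambda>x. h \<otimes> x"])
      (use HG h H in \<open>auto simp: m_assoc[symmetric] subgroup.m_closed subgroup.m_inv_closed\<close>)
  finally show ?thesis by (simp add: averaging_def sum_distrib_left[symmetric])
qed

lemma averaging_fixes:
  assumes "finite H" "H \<noteq> {}" "\<And>h. h \<in> H \<Longrightarrow> bop_apply (left_reg G h) \<xi> = \<xi>"
  shows "bop_apply (averaging G H) \<xi> = \<xi>"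
  using assms by (simp add: averaging_def bop_apply_scaleR bop_apply_sum sum_constant_scaleR)

lemma averaging_star:
  assumes H: "subgroup H G"
  shows "star (averaging G H) = averaging G H"
proof -
  have HG: "x \<in> carrier G" if "x \<in> H" for x using subgroup.mem_carrier[OF H that] .
  have "(\<Sum>x\<in>H. star (left_reg G x)) = (\<Sum>x\<in>H. left_reg G (inv x))"
    by (intro sum.cong) (use HG in \<open>auto simp: left_reg_star\<close>)
  also have "\<dots> = (\<Sum>x\<in>H. left_reg G x)"
    by (rule sum.reindex_bij_witness[where i = "m_inv G" and j = "m_inv G"])
      (use HG H in \<open>auto simp: subgroup.m_inv_closed\<close>)
  finally show ?thesis by (simp add: averaging_def star_scaleR_bop star_sum)
qed

lemma averaging_apply_absorb:
  "subgroup H G \<Longrightarrow> h \<in> H \<Longrightarrow>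
    bop_apply (left_reg G h) (bop_apply (averaging G H) \<xi>) = bop_apply (averaging G H) \<xi>"
  by (metis averaging_absorb bop_apply_times)

lemma averaging_idem:
  assumes "subgroup H G" "finite H"
  shows "averaging G H * averaging G H = averaging G H"
proof (rule bop_eqI)
  fix \<xi>
  have "H \<noteq> {}" using subgroup.one_closed[OF assms(1)] by blast
  then show "bop_apply (averaging G H * averaging G H) \<xi> = bop_apply (averaging G H) \<xi>"
    unfolding bop_apply_times using assms by (intro averaging_fixes averaging_apply_absorb) auto
qed

end

section \<open>Operator matrices and their functional calculus\<close>

text \<open>Tuples are functions on all natural numbers. The value 0 beyond the last row makes
  \<open>mapp (M * N)\<close> equal to the composite as a function, with no index bound.\<close>

definition mapp :: "'i bop mat \<Rightarrow> (nat \<Rightarrow> 'i ell2) \<Rightarrow> nat \<Rightarrow> 'i ell2" where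
  "mapp M \<xi> i = (if i < dim_row M then \<Sum>j<dim_col M. bop_apply (M $$ (i, j)) (\<xi> j) else 0)"

definition tinner :: "nat \<Rightarrow> (nat \<Rightarrow> 'i ell2) \<Rightarrow> (nat \<Rightarrow> 'i ell2) \<Rightarrow> complex" where
  "tinner n \<xi> \<eta> = (\<Sum>i<n. cinner (\<xi> i) (\<eta> i))"

definition tnorm2 :: "nat \<Rightarrow> (nat \<Rightarrow> 'i ell2) \<Rightarrow> real" where
  "tnorm2 n \<xi> = (\<Sum>i<n. (norm (\<xi> i))\<^sup>2)"

lemma tnorm2_nonneg [simp]: "0 \<le> tnorm2 n \<xi>"
  by (simp add: tnorm2_def sum_nonneg)

lemma tinner_self: "tinner n \<xi> \<xi> = of_real (tnorm2 n \<xi>)"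
  by (simp add: tinner_def tnorm2_def cinner_self)

lemma tinner_cnj: "cnj (tinner n \<xi> \<eta>) = tinner n \<eta> \<xi>"
  by (simp add: tinner_def cinner_cnj)

lemma tnorm2_eq_0D: "tnorm2 n \<xi> = 0 \<Longrightarrow> i < n \<Longrightarrow> \<xi> i = 0"
  unfolding tnorm2_def by (subst (asm) sum_nonneg_eq_0_iff) auto

lemma tinner_cong: "(\<And>i. i < n \<Longrightarrow> \<xi> i = \<xi>' i) \<Longrightarrow> (\<And>i. i < n \<Longrightarrow> \<eta> i = \<eta>' i) \<Longrightarrow> tinner n \<xi> \<eta> = tinner n \<xi>' \<eta>'"
  by (simp add: tinner_def)

lemma tnorm2_cong: "(\<And>i. i < n \<Longrightarrow> \<xi> i = \<xi>' i) \<Longrightarrow> tnorm2 n \<xi> = tnorm2 n \<xi>'"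
  by (simp add: tnorm2_def)

lemma tinner_diff_right: "tinner n \<xi> (\<lambda>i. \<eta> i - \<theta> i) = tinner n \<xi> \<eta> - tinner n \<xi> \<theta>"
  by (simp add: tinner_def cinner.diff_right sum_subtractf)

lemma tinner_diff_left: "tinner n (\<lambda>i. \<eta> i - \<theta> i) \<xi> = tinner n \<eta> \<xi> - tinner n \<theta> \<xi>"
  by (simp add: tinner_def cinner.diff_left sum_subtractf)

lemma mapp_cong: "(\<And>j. j < dim_col M \<Longrightarrow> \<xi> j = \<xi>' j) \<Longrightarrow> mapp M \<xi> = mapp M \<xi>'"
  by (simp add: mapp_def fun_eq_iff)

lemma mapp_mult:
  assumes "dim_col M = dim_row N"
  shows "mapp (M * N) \<xi> = mapp M (mapp N \<xi>)"
proof
  fix i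
  show "mapp (M * N) \<xi> i = mapp M (mapp N \<xi>) i"
  proof (cases "i < dim_row M")
    case True
    have "mapp (M * N) \<xi> i = (\<Sum>j<dim_col N. \<Sum>k<dim_row N. bop_apply (M $$ (i, k)) (bop_apply (N $$ (k, j)) (\<xi> j)))"
      using True assms
      by (simp add: mapp_def index_mult_mat_sum bop_apply_sum bop_apply_times del: index_mult_mat(1))
    also have "\<dots> = mapp M (mapp N \<xi>) i"
      using True assms by (subst sum.swap) (simp add: mapp_def bop_apply_sum_right)
    finally show ?thesis .
  qed (simp add: mapp_def)
qed

lemma mapp_diff:
  assumes "M \<in> carrier_mat m n" "N \<in> carrier_mat m n"
  shows "mapp (M - N) \<xi> i = mapp M \<xi> i - mapp N \<xi> i"
  using assms by (auto simp: mapp_def bop_apply_diff sum_subtractf)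

lemma mapp_arg_diff: "mapp M (\<lambda>j. \<xi> j - \<eta> j) i = mapp M \<xi> i - mapp M \<eta> i"
  by (simp add: mapp_def bop_apply_linear sum_subtractf)

lemma mapp_arg_scaleR: "mapp M (\<lambda>j. r *\<^sub>R \<xi> j) i = r *\<^sub>R mapp M \<xi> i"
  by (simp add: mapp_def bop_apply_linear scaleR_sum_right)

lemma mapp_zero [simp]: "mapp (0\<^sub>m m n) \<xi> i = 0"
  by (simp add: mapp_def)

lemma tinner_mapp:
  assumes "M \<in> carrier_mat m n"
  shows "tinner m (mapp M \<xi>) \<eta> = tinner n \<xi> (mapp (star_mat M) \<eta>)"
proof -
  have "tinner m (mapp M \<xi>) \<eta> = (\<Sum>i<m. \<Sum>j<n. cinner (bop_apply (M $$ (i, j)) (\<xi> j)) (\<eta> i))"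
    using assms by (auto simp: tinner_def mapp_def cinner.sum_left intro!: sum.cong)
  also have "\<dots> = tinner n \<xi> (mapp (star_mat M) \<eta>)"
    using assms by (subst sum.swap) (auto simp: tinner_def mapp_def cinner.sum_right cinner_star intro!: sum.cong)
  finally show ?thesis .
qed

lemma mapp_single:
  assumes "M \<in> carrier_mat m n" "i < m" "j < n"
  shows "mapp M (\<lambda>k. if k = j then x else 0) i = bop_apply (M $$ (i, j)) x"
proof -
  have "bop_apply (M $$ (i, k)) (if k = j then x else 0) = (if k = j then bop_apply (M $$ (i, j)) x else 0)" for k
    by (simp add: bop_apply_linear)
  then have "mapp M (\<lambda>k. if k = j then x else 0) i = (\<Sum>k<n. if k = j then bop_apply (M $$ (i, j)) x else 0)"
    using assms by (simp only: mapp_def carrier_matD if_True)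
  then show ?thesis using assms by simp
qed

lemma mapp_eqI:
  assumes "M \<in> carrier_mat m n" "N \<in> carrier_mat m n"
    and "\<And>\<xi> i. i < m \<Longrightarrow> mapp M \<xi> i = mapp N \<xi> i"
  shows "M = N"
proof (rule eq_matI)
  fix i j assume "i < dim_row N" "j < dim_col N"
  then have ij: "i < m" "j < n" using assms by auto
  show "M $$ (i, j) = N $$ (i, j)"
  proof (rule bop_eqI)
    fix x
    show "bop_apply (M $$ (i, j)) x = bop_apply (N $$ (i, j)) x"
      using assms(3)[OF ij(1), of "\<lambda>k. if k = j then x else 0"]
      unfolding mapp_single[OF assms(1) ij] mapp_single[OF assms(2) ij] .
  qed
qed (use assms in auto)

lemma tnorm2_single: "j < n \<Longrightarrow> tnorm2 n (\<lambda>k. if k = j then x else 0) = (norm x)\<^sup>2"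
proof -
  assume "j < n"
  have "tnorm2 n (\<lambda>k. if k = j then x else 0) = (\<Sum>k<n. if k = j then (norm x)\<^sup>2 else 0)"
    unfolding tnorm2_def by (intro sum.cong) auto
  then show ?thesis using \<open>j < n\<close> by simp
qed

lemma norm_le_tnorm2: "i < n \<Longrightarrow> (norm (\<xi> i))\<^sup>2 \<le> tnorm2 n \<xi>"
  unfolding tnorm2_def by (rule member_le_sum) auto

text \<open>Tuples with a single nonzero entry turn a bound for the operator into bounds for the
  entries, the form in which convergence of matrices is expressed.\<close>

lemma norm_index_mat_le:
  fixes M :: "'i bop mat"
  assumes M: "M \<in> carrier_mat m n" "i < m" "j < n" and b: "0 \<le> b"
    and le: "\<And>\<xi>. tnorm2 m (mapp M \<xi>) \<le> b\<^sup>2 * tnorm2 n \<xi>"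
  shows "norm (M $$ (i, j)) \<le> b"
proof (rule norm_bop_le[OF b])
  fix x :: "'i ell2"
  let ?\<xi> = "\<lambda>k. if k = j then x else 0"
  have "(norm (bop_apply (M $$ (i, j)) x))\<^sup>2 \<le> tnorm2 m (mapp M ?\<xi>)"
    using norm_le_tnorm2[of i m "mapp M ?\<xi>"] mapp_single[OF M, of x] M by simp
  also have "\<dots> \<le> b\<^sup>2 * (norm x)\<^sup>2" using le[of ?\<xi>] tnorm2_single[OF M(3), of x] by simp
  finally have "(norm (bop_apply (M $$ (i, j)) x))\<^sup>2 \<le> (b * norm x)\<^sup>2" by (simp add: power_mult_distrib)
  then show "norm (bop_apply (M $$ (i, j)) x) \<le> b * norm x"
    by (rule power2_le_imp_le) (use b in simp)
qed

lemma mapp_bounded: "\<exists>c\<ge>0. \<forall>\<xi>. tnorm2 (dim_row M) (mapp M \<xi>) \<le> c * tnorm2 (dim_col M) \<xi>"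
proof -
  define b where "b = (\<lambda>i. \<Sum>j<dim_col M. norm (M $$ (i, j)))"
  have "(norm (mapp M \<xi> i))\<^sup>2 \<le> (b i)\<^sup>2 * tnorm2 (dim_col M) \<xi>" if i: "i < dim_row M" for \<xi> i
  proof -
    let ?t = "sqrt (tnorm2 (dim_col M) \<xi>)"
    have "norm (mapp M \<xi> i) \<le> (\<Sum>j<dim_col M. norm (M $$ (i, j)) * ?t)"
    proof -
      have "norm (\<xi> j) \<le> ?t" if "j < dim_col M" for j
        using norm_le_tnorm2[OF that, of \<xi>] by (simp add: real_le_rsqrt)
      then have "norm (bop_apply (M $$ (i, j)) (\<xi> j)) \<le> norm (M $$ (i, j)) * ?t" if "j < dim_col M" for j
        using that by (intro order_trans[OF norm_bop_apply_le] mult_left_mono) auto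
      then show ?thesis using i by (auto simp: mapp_def intro!: sum_norm_le)
    qed
    also have "\<dots> = b i * ?t" by (simp add: b_def sum_distrib_right)
    finally have "(norm (mapp M \<xi> i))\<^sup>2 \<le> (b i * ?t)\<^sup>2" by (intro power_mono) auto
    then show ?thesis by (simp add: power_mult_distrib)
  qed
  then have "tnorm2 (dim_row M) (mapp M \<xi>) \<le> (\<Sum>i<dim_row M. (b i)\<^sup>2) * tnorm2 (dim_col M) \<xi>" for \<xi>
    unfolding tnorm2_def[of "dim_row M"] sum_distrib_right by (intro sum_mono) auto
  then show ?thesis by (intro exI[of _ "\<Sum>i<dim_row M. (b i)\<^sup>2"]) (auto intro: sum_nonneg)
qed

text \<open>Evaluate the positive form \<open>\<langle>\<eta>, x \<eta>\<rangle>\<close> at \<open>\<eta> = \<xi> - (1 / q) x \<xi>\<close>.\<close>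

lemma tnorm2_positive_le:
  assumes x: "x \<in> carrier_mat m m" "star_mat x = x" and q: "0 < q"
    and pos: "\<And>\<xi>. 0 \<le> Re (tinner m \<xi> (mapp x \<xi>))"
    and le: "\<And>\<xi>. Re (tinner m \<xi> (mapp x \<xi>)) \<le> q * tnorm2 m \<xi>"
  shows "tnorm2 m (mapp x \<xi>) \<le> q\<^sup>2 * tnorm2 m \<xi>"
proof -
  let ?b = "mapp x \<xi>"
  let ?t = "1 / q"
  let ?z = "\<lambda>i. \<xi> i - ?t *\<^sub>R ?b i"
  have sc: "tinner m (\<lambda>i. r *\<^sub>R \<eta> i) \<theta> = r * tinner m \<eta> \<theta>" "tinner m \<eta> (\<lambda>i. r *\<^sub>R \<theta> i) = r * tinner m \<eta> \<theta>"
    for r :: real and \<eta> \<theta> :: "nat \<Rightarrow> 'a ell2"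
    by (simp_all add: tinner_def cinner.scaleR_left cinner.scaleR_right scaleR_conv_of_real sum_distrib_left)
  have mz: "mapp x ?z = (\<lambda>i. ?b i - ?t *\<^sub>R mapp x ?b i)"
    by (rule ext) (simp only: mapp_arg_diff mapp_arg_scaleR)
  have sa: "tinner m \<xi> (mapp x ?b) = tinner m ?b ?b" using tinner_mapp[OF x(1), of \<xi> ?b] x(2) by simp
  have "tinner m ?z (mapp x ?z) = tinner m \<xi> ?b - 2 * ?t * tinner m ?b ?b + ?t * ?t * tinner m ?b (mapp x ?b)"
    unfolding mz tinner_diff_left tinner_diff_right sc sa by (simp add: algebra_simps)
  then have "0 \<le> Re (tinner m \<xi> ?b - of_real (2 * ?t * tnorm2 m ?b) + of_real (?t * ?t) * tinner m ?b (mapp x ?b))"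
    using pos[of ?z] by (simp add: tinner_self)
  then have "0 \<le> Re (tinner m \<xi> ?b) - 2 * ?t * tnorm2 m ?b + ?t * ?t * Re (tinner m ?b (mapp x ?b))"
    by simp
  also have "\<dots> \<le> q * tnorm2 m \<xi> - 2 * ?t * tnorm2 m ?b + ?t * ?t * (q * tnorm2 m ?b)"
    using q by (intro add_mono diff_mono mult_left_mono le order_refl) auto
  also have "\<dots> = q * tnorm2 m \<xi> - tnorm2 m ?b / q" using q by (simp add: field_simps)
  finally have "tnorm2 m ?b / q \<le> q * tnorm2 m \<xi>" by simp
  then show ?thesis using q by (simp add: field_simps power2_eq_square)
qed

lemma tnorm2_projection_le:
  assumes P: "P \<in> carrier_mat m m" "star_mat P = P" "P * P = P"
  shows "tinner m \<xi> (mapp P \<xi>) = of_real (tnorm2 m (mapp P \<xi>))" "tnorm2 m (mapp P \<xi>) \<le> tnorm2 m \<xi>"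
proof -
  have *: "tinner m \<xi> (mapp P \<xi>) = tinner m (mapp P \<xi>) (mapp P \<xi>)"
    using tinner_mapp[OF P(1), of \<xi> "mapp P \<xi>"] P mapp_mult[of P P \<xi>] by simp
  then show 1: "tinner m \<xi> (mapp P \<xi>) = of_real (tnorm2 m (mapp P \<xi>))" by (simp add: tinner_self)
  let ?z = "\<lambda>i. \<xi> i - mapp P \<xi> i"
  have "of_real (tnorm2 m ?z) = tinner m ?z ?z" by (simp add: tinner_self)
  also have "\<dots> = of_real (tnorm2 m \<xi> - tnorm2 m (mapp P \<xi>))"
    using 1 tinner_cnj[of m \<xi> "mapp P \<xi>"]
    by (simp add: tinner_diff_left tinner_diff_right tinner_self)
  finally have "tnorm2 m ?z = tnorm2 m \<xi> - tnorm2 m (mapp P \<xi>)" by (simp only: of_real_eq_iff)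
  then show "tnorm2 m (mapp P \<xi>) \<le> tnorm2 m \<xi>" using tnorm2_nonneg[of m ?z] by linarith
qed

subsection \<open>The binomial series of \<open>(1 - x)\<^bsup>-1/2\<^esup>\<close>\<close>

definition invsqrt_coeff :: "nat \<Rightarrow> real" where
  "invsqrt_coeff k = pochhammer (1 / 2) k / fact k"

text \<open>Consecutive coefficients have ratio \<open>(1/2 + k) / (k + 1)\<close>, which is below
  1. Boundedness is enough for the geometric series of any q < 1 to dominate the binomial
  series.\<close>

lemma invsqrt_coeff_bounds: "0 \<le> invsqrt_coeff k" "invsqrt_coeff k \<le> 1"
proof -
  have "0 \<le> invsqrt_coeff k \<and> invsqrt_coeff k \<le> 1"
  proof (induction k)
    case (Suc k)
    have "invsqrt_coeff (Suc k) = invsqrt_coeff k * ((1 / 2 + real k) / (real k + 1))"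
      by (simp add: invsqrt_coeff_def pochhammer_Suc add.commute)
    moreover have "invsqrt_coeff k * ((1 / 2 + real k) / (real k + 1)) \<le> 1 * 1"
      using Suc by (intro mult_mono) auto
    ultimately show ?case using Suc by simp
  qed (simp add: invsqrt_coeff_def)
  then show "0 \<le> invsqrt_coeff k" "invsqrt_coeff k \<le> 1" by auto
qed

text \<open>The coefficient form of squaring (1 - x)^(-1/2) to 1 / (1 - x): Vandermonde's identity
  for -1/2 + -1/2 = -1, up to signs.\<close>

lemma invsqrt_coeff_convolution: "(\<Sum>i\<le>k. invsqrt_coeff i * invsqrt_coeff (k - i)) = 1"
proof -
  have c: "invsqrt_coeff i = (- 1) ^ i * ((- 1 / 2) gchoose i)" for i
    by (simp add: invsqrt_coeff_def gbinomial_pochhammer power_mult_distrib[symmetric])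
  have "(\<Sum>i\<le>k. invsqrt_coeff i * invsqrt_coeff (k - i))
      = (\<Sum>i\<le>k. (- 1) ^ k * (((- 1 / 2 :: real) gchoose i) * ((- 1 / 2) gchoose (k - i))))"
    unfolding c by (intro sum.cong) (auto simp: power_add[symmetric])
  also have "\<dots> = (- 1) ^ k * ((- 1 / 2 + - 1 / 2 :: real) gchoose k)"
    unfolding sum_distrib_left[symmetric] atMost_atLeast0 gbinomial_Vandermonde ..
  also have "\<dots> = 1"
    by (simp add: gbinomial_pochhammer pochhammer_fact[symmetric] power_mult_distrib[symmetric])
  finally show ?thesis .
qed

section \<open>Norm convergent series of operator matrices, entry by entry\<close>

definition msums :: "(nat \<Rightarrow> 'i bop mat) \<Rightarrow> 'i bop mat \<Rightarrow> bool" where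
  "msums M S \<longleftrightarrow> (\<forall>i<dim_row S. \<forall>j<dim_col S. (\<lambda>k. M k $$ (i, j)) sums (S $$ (i, j)))"

lemma msums_mult_right:
  assumes "msums M S" "\<And>k. M k \<in> carrier_mat l m" "S \<in> carrier_mat l m" "N \<in> carrier_mat m n"
  shows "msums (\<lambda>k. M k * N) (S * N)"
  unfolding msums_def
proof (intro allI impI)
  fix i j assume ij: "i < dim_row (S * N)" "j < dim_col (S * N)"
  have "(\<lambda>k. \<Sum>r<m. M k $$ (i, r) * N $$ (r, j)) sums (\<Sum>r<m. S $$ (i, r) * N $$ (r, j))"
    by (intro sums_sum bounded_linear.sums[OF bounded_linear_mult_left]) (use assms ij in \<open>auto simp: msums_def\<close>)
  moreover have "(M k * N) $$ (i, j) = (\<Sum>r<m. M k $$ (i, r) * N $$ (r, j))" for k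
    using assms(2)[of k] assms(3,4) ij by (subst index_mult_mat_sum) auto
  moreover have "(S * N) $$ (i, j) = (\<Sum>r<m. S $$ (i, r) * N $$ (r, j))"
    using assms(3,4) ij by (subst index_mult_mat_sum) auto
  ultimately show "(\<lambda>k. (M k * N) $$ (i, j)) sums ((S * N) $$ (i, j))" by simp
qed

lemma msums_mult_left:
  assumes "msums M S" "\<And>k. M k \<in> carrier_mat m n" "S \<in> carrier_mat m n" "N \<in> carrier_mat l m"
  shows "msums (\<lambda>k. N * M k) (N * S)"
  unfolding msums_def
proof (intro allI impI)
  fix i j assume ij: "i < dim_row (N * S)" "j < dim_col (N * S)"
  have "(\<lambda>k. \<Sum>r<m. N $$ (i, r) * M k $$ (r, j)) sums (\<Sum>r<m. N $$ (i, r) * S $$ (r, j))"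
    by (intro sums_sum bounded_linear.sums[OF bounded_linear_mult_right]) (use assms ij in \<open>auto simp: msums_def\<close>)
  moreover have "(N * M k) $$ (i, j) = (\<Sum>r<m. N $$ (i, r) * M k $$ (r, j))" for k
    using assms(2)[of k] assms(3,4) ij by (subst index_mult_mat_sum) auto
  moreover have "(N * S) $$ (i, j) = (\<Sum>r<m. N $$ (i, r) * S $$ (r, j))"
    using assms(3,4) ij by (subst index_mult_mat_sum) auto
  ultimately show "(\<lambda>k. (N * M k) $$ (i, j)) sums ((N * S) $$ (i, j))" by simp
qed

lemma msums_unique:
  assumes "msums M S" "msums M S'" "S \<in> carrier_mat m n" "S' \<in> carrier_mat m n"
  shows "S = S'"
proof (rule eq_matI)
  fix i j assume "i < dim_row S'" "j < dim_col S'"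
  then have "(\<lambda>k. M k $$ (i, j)) sums (S $$ (i, j))" "(\<lambda>k. M k $$ (i, j)) sums (S' $$ (i, j))"
    using assms by (auto simp: msums_def)
  then show "S $$ (i, j) = S' $$ (i, j)" by (rule sums_unique2)
qed (use assms in auto)

lemma map_mat_scaleR_mult:
  fixes M N :: "'i bop mat"
  assumes "M \<in> carrier_mat l m" "N \<in> carrier_mat m n"
  shows "map_mat ((*\<^sub>R) r) M * N = map_mat ((*\<^sub>R) r) (M * N)" "M * map_mat ((*\<^sub>R) r) N = map_mat ((*\<^sub>R) r) (M * N)"
  by (rule eq_matI; use assms in \<open>auto simp: index_mult_mat_sum scaleR_sum_right simp del: index_mult_mat(1)\<close>)+

text \<open>The analytic input of the polar decomposition: norm limits and real multiples stay in
  \<open>A\<close>. Projections take the place of a unit.\<close>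

locale real_cstar = star_subring A for A :: "'i bop set" +
  assumes closed: "closed A" and scaleR_mem: "x \<in> A \<Longrightarrow> r *\<^sub>R x \<in> A"
begin

text \<open>\<open>s\<close> is the binomial series of \<open>(P - x)\<close> to the power -1/2 in
  the corner of \<open>P\<close>. Its Cauchy square is the Neumann series of the powers of
  \<open>x\<close>, which telescopes against \<open>P - x\<close>.\<close>

lemma inverse_sqrt_exists:
  assumes P: "P \<in> mats_over A m m" "star_mat P = P" "P * P = P"
    and x: "x \<in> mats_over A m m" "star_mat x = x" "P * x = x" "x * P = x"
    and q: "0 < q" "q < 1"
    and pos: "\<And>\<xi>. 0 \<le> Re (tinner m \<xi> (mapp x \<xi>))"
    and le: "\<And>\<xi>. Re (tinner m \<xi> (mapp x \<xi>)) \<le> q * tnorm2 m \<xi>"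
  obtains s where "s \<in> mats_over A m m" "star_mat s = s" "s * P = s" "s * x = x * s" "s * s * (P - x) = P"
proof -
  \<comment> \<open>The powers of \<open>x\<close>, with the corner unit \<open>P\<close> as zeroth
    power.\<close>
  define X where "X = rec_nat P (\<lambda>_ y. x * y)"
  have X0: "X 0 = P" and XS: "X (Suc k) = x * X k" for k by (simp_all add: X_def)
  have Pc: "P \<in> carrier_mat m m" and xc: "x \<in> carrier_mat m m" using P x by (auto simp: mats_over_iff)
  have XA: "X k \<in> mats_over A m m" for k
    by (induction k) (auto simp: X0 XS P(1) intro: mats_mult x)
  then have Xc: "X k \<in> carrier_mat m m" for k by (auto simp: mats_over_iff)
  have XP: "X k * P = X k" for k
    by (induction k) (auto simp: X0 XS P assoc_mult_mat[OF xc Xc Pc])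
  have Xx: "X k * x = x * X k" for k
    by (induction k) (auto simp: X0 XS x assoc_mult_mat[OF xc Xc xc])
  have Xadd: "X a * X b = X (a + b)" for a b
  proof (induction a)
    case 0
    have "P * X b = X b" by (cases b) (auto simp: X0 XS P x assoc_mult_mat[OF Pc xc Xc, symmetric])
    then show ?case by (simp add: X0)
  qed (simp add: XS assoc_mult_mat[OF xc Xc Xc])
  have Xstar: "star_mat (X k) = X k" for k
  proof (induction k)
    case (Suc k)
    have "star_mat (x * X k) = star_mat (X k) * star_mat x"
      using xc Xc[of k] by (intro star_mat_mult) auto
    then show ?case by (simp add: XS Suc x Xx)
  qed (simp add: X0 P)
  \<comment> \<open>The form bounds 0 \<le> x \<le> q give operator norm at most \<open>q\<close>
    for \<open>x\<close> by \<open>tnorm2_positive_le\<close>; the start of the induction is that a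
    projection is a contraction.\<close>
  have tn: "tnorm2 m (mapp (X k) \<xi>) \<le> (q ^ k)\<^sup>2 * tnorm2 m \<xi>" for k \<xi>
  proof (induction k)
    case 0
    then show ?case using tnorm2_projection_le(2)[OF Pc P(2,3)] by (simp add: X0)
  next
    case (Suc k)
    have "mapp (X (Suc k)) \<xi> = mapp x (mapp (X k) \<xi>)"
      unfolding XS using xc Xc[of k] by (intro mapp_mult) auto
    then have "tnorm2 m (mapp (X (Suc k)) \<xi>) \<le> q\<^sup>2 * tnorm2 m (mapp (X k) \<xi>)"
      using tnorm2_positive_le[OF xc x(2) q(1) pos le] by simp
    also have "\<dots> \<le> q\<^sup>2 * ((q ^ k)\<^sup>2 * tnorm2 m \<xi>)" using Suc by (intro mult_left_mono) auto
    finally show ?case by (simp add: power_mult_distrib mult.assoc)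
  qed
  have Xn: "norm (X k $$ (i, j)) \<le> q ^ k" if "i < m" "j < m" for i j k
    using q by (intro norm_index_mat_le[OF Xc that _ tn]) auto
  let ?c = invsqrt_coeff
  define Y where "Y = (\<lambda>k. map_mat ((*\<^sub>R) (?c k)) (X k))"
  have Yc: "Y k \<in> carrier_mat m m" for k using Xc[of k] by (simp add: Y_def)
  have Yi: "Y k $$ (i, j) = ?c k *\<^sub>R X k $$ (i, j)" if "i < m" "j < m" for i j k
    using Xc[of k] that by (simp add: Y_def)
  have geo: "summable (\<lambda>k. q ^ k)" using q by (intro summable_geometric) auto
  have Ysum: "summable (\<lambda>k. norm (Y k $$ (i, j)))" if ij: "i < m" "j < m" for i j
  proof (rule summable_comparison_test'[OF geo, of 0])
    fix k
    have "norm (Y k $$ (i, j)) \<le> 1 * q ^ k"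
      unfolding Yi[OF ij] norm_scaleR using invsqrt_coeff_bounds[of k] Xn[OF ij, of k]
      by (intro mult_mono) auto
    then show "norm (norm (Y k $$ (i, j))) \<le> q ^ k" by simp
  qed
  define s where "s = mat m m (\<lambda>(i, j). \<Sum>k. Y k $$ (i, j))"
  have sc: "s \<in> carrier_mat m m" by (simp add: s_def)
  have sms: "msums Y s"
    unfolding msums_def
  proof (intro allI impI)
    fix i j assume "i < dim_row s" "j < dim_col s"
    then have ij: "i < m" "j < m" by (auto simp: s_def)
    show "(\<lambda>k. Y k $$ (i, j)) sums (s $$ (i, j))"
      using summable_sums[OF summable_norm_cancel[OF Ysum[OF ij]]] ij by (simp add: s_def)
  qed
  have sms': "(\<lambda>k. Y k $$ (i, j)) sums (s $$ (i, j))" if "i < m" "j < m" for i j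
    using sms that sc by (simp add: msums_def)
  have sA: "s \<in> mats_over A m m"
  proof (rule mats_overI[OF sc])
    fix i j assume ij: "i < m" "j < m"
    have "(\<Sum>k<n. Y k $$ (i, j)) \<in> A" for n
      using XA ij by (intro sum_mem) (auto simp: Yi mats_over_iff intro!: scaleR_mem)
    moreover have "(\<lambda>n. \<Sum>k<n. Y k $$ (i, j)) \<longlonglongrightarrow> s $$ (i, j)"
      using sms' ij by (simp add: sums_def)
    ultimately show "s $$ (i, j) \<in> A"
      by (rule closed_sequentially[OF closed])
  qed
  have ss: "star_mat s = s"
  proof (rule eq_matI)
    fix i j assume "i < dim_row s" "j < dim_col s"
    then have ij: "i < m" "j < m" using sc by auto
    have "(\<lambda>k. star (Y k $$ (j, i))) sums star (s $$ (j, i))"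
      by (intro bounded_linear.sums[OF bounded_linear_star] sms' ij)
    moreover have "star (Y k $$ (j, i)) = Y k $$ (i, j)" for k
    proof -
      have "star (X k $$ (j, i)) = star_mat (X k) $$ (i, j)" using Xc[of k] ij by (subst index_star_mat) auto
      then show ?thesis using ij by (simp add: Yi star_scaleR_bop Xstar)
    qed
    ultimately have "(\<lambda>k. Y k $$ (i, j)) sums star (s $$ (j, i))" by simp
    from sums_unique2[OF this sms'[OF ij]] show "star_mat s $$ (i, j) = s $$ (i, j)"
      using ij sc by simp
  qed (use sc in auto)
  have "msums (\<lambda>k. Y k * P) (s * P)" by (rule msums_mult_right[OF sms Yc sc Pc])
  then have sP: "s * P = s"
    using sms sc Pc by (intro msums_unique[of Y]) (auto simp: Y_def map_mat_scaleR_mult[OF Xc Pc] XP)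
  have "msums (\<lambda>k. Y k * x) (s * x)" "msums (\<lambda>k. x * Y k) (x * s)"
    by (rule msums_mult_right[OF sms Yc sc xc] msums_mult_left[OF sms Yc sc xc])+
  then have sx: "s * x = x * s"
    using sc xc by (intro msums_unique[of "\<lambda>k. Y k * x"])
      (auto simp: Y_def map_mat_scaleR_mult[OF Xc xc] map_mat_scaleR_mult[OF xc Xc] Xx)
  have ssms: "msums X (s * s)"
    unfolding msums_def
  proof (intro allI impI)
    fix i j assume "i < dim_row (s * s)" "j < dim_col (s * s)"
    then have ij: "i < m" "j < m" using sc by auto
    \<comment> \<open>Each entry of \<open>s * s\<close> is a finite sum of products of absolutely
      convergent series in a Banach algebra, so the Cauchy product applies entrywise, order of
      factors included.\<close>
    have "(\<lambda>k. \<Sum>l<m. \<Sum>a\<le>k. Y a $$ (i, l) * Y (k - a) $$ (l, j)) sums (\<Sum>l<m. (\<Sum>k. Y k $$ (i, l)) * (\<Sum>k. Y k $$ (l, j)))"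
      using ij by (intro sums_sum Cauchy_product_sums Ysum) simp_all
    moreover have "(\<Sum>l<m. (\<Sum>k. Y k $$ (i, l)) * (\<Sum>k. Y k $$ (l, j))) = (s * s) $$ (i, j)"
      using sc ij by (subst index_mult_mat_sum) (auto simp: s_def)
    moreover have "(\<Sum>l<m. \<Sum>a\<le>k. Y a $$ (i, l) * Y (k - a) $$ (l, j)) = X k $$ (i, j)" for k
    proof -
      have "(\<Sum>l<m. \<Sum>a\<le>k. Y a $$ (i, l) * Y (k - a) $$ (l, j))
          = (\<Sum>a\<le>k. (?c a * ?c (k - a)) *\<^sub>R (\<Sum>l<m. X a $$ (i, l) * X (k - a) $$ (l, j)))"
        using ij by (subst sum.swap) (auto simp: Yi scaleR_sum_right intro!: sum.cong)
      also have "\<dots> = (\<Sum>a\<le>k. (?c a * ?c (k - a)) *\<^sub>R X k $$ (i, j))"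
      proof (rule sum.cong[OF HOL.refl]) (* plain refl is gog_cong.refl *)
        fix a assume "a \<in> {..k}"
        have "(\<Sum>l<m. X a $$ (i, l) * X (k - a) $$ (l, j)) = (X a * X (k - a)) $$ (i, j)"
          using Xc[of a] Xc[of "k - a"] ij by (subst index_mult_mat_sum) auto
        then show "(?c a * ?c (k - a)) *\<^sub>R (\<Sum>l<m. X a $$ (i, l) * X (k - a) $$ (l, j)) = (?c a * ?c (k - a)) *\<^sub>R X k $$ (i, j)"
          using \<open>a \<in> {..k}\<close> by (simp add: Xadd)
      qed
      also have "\<dots> = X k $$ (i, j)"
        by (simp add: scaleR_left.sum[symmetric] invsqrt_coeff_convolution)
      finally show ?thesis .
    qed
    ultimately show "(\<lambda>k. X k $$ (i, j)) sums ((s * s) $$ (i, j))" by simp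
  qed
  have ssc: "s * s \<in> carrier_mat m m" using sc by auto
  have ssx: "msums (\<lambda>k. X k * x) (s * s * x)" by (rule msums_mult_right[OF ssms Xc ssc xc])
  \<comment> \<open>Multiplication by \<open>x\<close> shifts the Neumann series by one index and so
    loses just the term \<open>X 0 = P\<close>.\<close>
  have "s * s * x = s * s - P"
  proof (rule eq_matI)
    fix i j assume "i < dim_row (s * s - P)" "j < dim_col (s * s - P)"
    then have ij: "i < m" "j < m" using Pc by auto
    have "(\<lambda>k. X (Suc k) $$ (i, j)) sums ((s * s * x) $$ (i, j))"
      using ssx ij sc xc by (simp add: msums_def XS Xx del: index_mult_mat(1))
    moreover have "(\<lambda>k. X (Suc k) $$ (i, j)) sums ((s * s) $$ (i, j) - X 0 $$ (i, j))"
      using ssms ij sc by (subst sums_Suc_iff) (simp add: msums_def del: index_mult_mat(1))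
    ultimately have "(s * s * x) $$ (i, j) = (s * s) $$ (i, j) - X 0 $$ (i, j)"
      by (rule sums_unique2)
    then show "(s * s * x) $$ (i, j) = (s * s - P) $$ (i, j)"
      using ij Pc sc by (simp add: X0 del: index_mult_mat(1))
  qed (use sc xc Pc in auto)
  moreover have "s * s * P = s * s" using sc Pc by (simp add: assoc_mult_mat[OF sc sc Pc] sP)
  ultimately have "s * s * (P - x) = P"
    unfolding mult_minus_distrib_mat[OF ssc Pc xc] using ssc Pc by (auto intro!: eq_matI)
  with sA ss sP sx show ?thesis by (rule that)
qed

section \<open>Polar decomposition of an operator that is bounded below\<close>

lemma mats_diff: "M \<in> mats_over A m n \<Longrightarrow> N \<in> mats_over A m n \<Longrightarrow> M - N \<in> mats_over A m n"
proof -
  have "x - y \<in> A" if "x \<in> A" "y \<in> A" for x y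
    using add_mem[OF that(1) scaleR_mem[OF that(2), of "- 1"]] by simp
  then show "M \<in> mats_over A m n \<Longrightarrow> N \<in> mats_over A m n \<Longrightarrow> M - N \<in> mats_over A m n"
    unfolding mats_over_iff by auto
qed

text \<open>For \<open>D\<close> bounded below on the range of \<open>P\<close>, the polar decomposition \<open>v = D (D\<^sup>* D)\<^bsup>-1/2\<^esup>\<close> identifies
  \<open>P\<close> with the projection onto the range of \<open>D\<close>, whose complement in \<open>E\<close> is the kernel of \<open>D\<^sup>*\<close>.\<close>

lemma cokernel_projection:
  assumes P: "P \<in> mats_over A m m" "star_mat P = P" "P * P = P"
    and E: "E \<in> mats_over A n n" "star_mat E = E" "E * E = E"
    and D: "D \<in> mats_over A n m" "D * P = D" "E * D = D"
    and eps: "0 < \<epsilon>" "\<And>\<xi>. \<epsilon> * tnorm2 m (mapp P \<xi>) \<le> tnorm2 n (mapp D \<xi>)"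
    and contr: "\<And>\<xi>. tnorm2 n (mapp D \<xi>) \<le> tnorm2 m (mapp P \<xi>)"
  obtains p R where "p \<in> projections A" "p \<in> carrier_mat n n" "E * p = p" "star_mat D * p = 0\<^sub>m m n"
    "R \<in> carrier_mat m n" "p = E - D * R"
    "K0_class A E = K0_class A P \<otimes>\<^bsub>K0 A\<^esub> K0_class A p"
proof -
  let ?D = "star_mat D"
  have Pc: "P \<in> carrier_mat m m" and Ec: "E \<in> carrier_mat n n" and Dc: "D \<in> carrier_mat n m"
    and D'c: "?D \<in> carrier_mat m n" and DDc: "?D * D \<in> carrier_mat m m"
    using P E D by (auto simp: mats_over_iff)
  have PD: "P * ?D = ?D" using arg_cong[OF D(2), of star_mat] Pc Dc P(2) by (simp add: star_mat_mult)
  have DE: "?D * E = ?D" using arg_cong[OF D(3), of star_mat] Ec Dc E(2) by (simp add: star_mat_mult)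
  \<comment> \<open>Chosen so that \<open>P - x\<close> is \<open>D\<^sup>* D\<close>: the
    contraction bound makes \<open>x\<close> nonnegative, and the lower bound \<epsilon> keeps it
    away from \<open>P\<close>.\<close>
  define x where "x = P - ?D * D"
  have xA: "x \<in> mats_over A m m" unfolding x_def by (intro mats_diff P mats_mult[OF mats_star D(1)] D(1))
  have xc: "x \<in> carrier_mat m m" using xA by (simp add: mats_over_iff)
  have "star_mat (?D * D) = ?D * D" using Dc by (subst star_mat_mult) auto
  moreover have "star_mat (P - ?D * D) = star_mat P - star_mat (?D * D)"
    using Pc DDc by (auto intro!: eq_matI simp: star_diff simp del: index_mult_mat(1))
  ultimately have xs: "star_mat x = x" using P(2) by (simp add: x_def)
  have Px: "P * x = x" unfolding x_def mult_minus_distrib_mat[OF Pc Pc DDc]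
    using assoc_mult_mat[OF Pc D'c Dc] by (simp add: P(3) PD)
  have xP: "x * P = x" unfolding x_def minus_mult_distrib_mat[OF Pc DDc Pc]
    using assoc_mult_mat[OF D'c Dc Pc] by (simp add: P(3) D(2))
  have form: "Re (tinner m \<xi> (mapp x \<xi>)) = tnorm2 m (mapp P \<xi>) - tnorm2 n (mapp D \<xi>)" for \<xi>
  proof -
    have "tinner m \<xi> (mapp (?D * D) \<xi>) = tinner n (mapp D \<xi>) (mapp D \<xi>)"
      using Dc by (subst mapp_mult) (auto simp: tinner_mapp)
    moreover have "tinner m \<xi> (mapp x \<xi>) = tinner m \<xi> (mapp P \<xi>) - tinner m \<xi> (mapp (?D * D) \<xi>)"
      unfolding x_def tinner_diff_right[symmetric] by (rule tinner_cong[OF HOL.refl mapp_diff[OF Pc DDc]])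
    ultimately show ?thesis by (simp add: tinner_self tnorm2_projection_le(1)[OF Pc P(2,3)])
  qed
  \<comment> \<open>The maximum with 1/2 keeps \<open>q\<close> positive when \<epsilon> \<ge> 1, as
    the norm estimate for \<open>x\<close> divides by \<open>q\<close>.\<close>
  define q where "q = max (1 - \<epsilon>) (1 / 2)"
  have "0 < q" "q < 1" using eps(1) by (auto simp: q_def)
  have "Re (tinner m \<xi> (mapp x \<xi>)) \<le> q * tnorm2 m \<xi>" for \<xi>
  proof -
    have "Re (tinner m \<xi> (mapp x \<xi>)) \<le> (1 - \<epsilon>) * tnorm2 m (mapp P \<xi>)"
      using eps(2)[of \<xi>] by (simp add: form algebra_simps)
    also have "\<dots> \<le> q * tnorm2 m (mapp P \<xi>)" by (intro mult_right_mono) (auto simp: q_def)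
    also have "\<dots> \<le> q * tnorm2 m \<xi>"
      using \<open>0 < q\<close> tnorm2_projection_le(2)[OF Pc P(2,3)] by (intro mult_left_mono) auto
    finally show ?thesis .
  qed
  moreover have "0 \<le> Re (tinner m \<xi> (mapp x \<xi>))" for \<xi> using contr[of \<xi>] by (simp add: form)
  ultimately obtain s where sA: "s \<in> mats_over A m m" and s: "star_mat s = s" "s * P = s" "s * x = x * s"
    and inv: "s * s * (P - x) = P"
    using inverse_sqrt_exists[OF P xA xs Px xP \<open>0 < q\<close> \<open>q < 1\<close>] by metis
  have sc: "s \<in> carrier_mat m m" using sA by (simp add: mats_over_iff)
  have ssc: "s * s \<in> carrier_mat m m" using sc by auto
  have PxD: "P - x = ?D * D"
    using Pc DDc by (auto simp: x_def intro!: eq_matI simp del: index_mult_mat(1))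
  have Ps: "P * s = s" using arg_cong[OF s(2), of star_mat] sc Pc s(1) P(2) by (simp add: star_mat_mult)
  have comm: "s * (P - x) = (P - x) * s"
    unfolding mult_minus_distrib_mat[OF sc Pc xc] minus_mult_distrib_mat[OF Pc xc sc] by (simp add: s Ps)
  have inv': "?D * D * (s * s) = P"
  proof -
    have "?D * D * (s * s) = ((P - x) * s) * s" unfolding PxD using assoc_mult_mat[OF DDc sc sc] by simp
    also have "\<dots> = (s * (P - x)) * s" by (simp only: comm)
    also have "\<dots> = s * ((P - x) * s)"
      using sc xc Pc by (intro assoc_mult_mat) auto
    also have "\<dots> = s * s * (P - x)" unfolding comm[symmetric]
      using sc xc Pc by (subst assoc_mult_mat[of s m m s m]) auto
    finally show ?thesis by (simp add: inv)
  qed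
  define v where "v = D * s"
  have vA: "v \<in> mats_over A n m" unfolding v_def by (rule mats_mult[OF D(1) sA])
  have vc: "v \<in> carrier_mat n m" using vA by (simp add: mats_over_iff)
  have vs: "star_mat v = s * ?D" unfolding v_def using Dc sc by (subst star_mat_mult) (auto simp: s)
  have vv: "star_mat v * v = P"
  proof -
    have "star_mat v * v = s * ((?D * D) * s)"
      unfolding vs unfolding v_def by (rule assoc_mult_mat4[OF sc D'c Dc sc])
    also have "\<dots> = s * s * (P - x)" unfolding PxD[symmetric] comm[symmetric]
      using sc xc Pc by (subst assoc_mult_mat[of s m m s m]) auto
    finally show ?thesis by (simp add: inv)
  qed
  define Q where "Q = v * star_mat v"
  \<comment> \<open>\<open>s * s\<close> inverts \<open>D\<^sup>* D\<close> in the corner of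
    \<open>P\<close>, so \<open>D * R\<close> is the usual formula for the projection onto the range
    of \<open>D\<close>. The form \<open>p = E - D * R\<close> later yields orthogonality to the
    kernel of the adjoint.\<close>
  define R where "R = (s * s) * ?D"
  have Rc: "R \<in> carrier_mat m n" using sc Dc by (auto simp: R_def)
  have QR: "Q = D * R"
    unfolding Q_def vs unfolding v_def R_def by (rule assoc_mult_mat4[OF Dc sc sc D'c])
  have QA: "Q \<in> mats_over A n n" unfolding Q_def by (rule mats_mult[OF vA mats_star[OF vA]])
  have Qc: "Q \<in> carrier_mat n n" using QA by (simp add: mats_over_iff)
  have Qs: "star_mat Q = Q" unfolding Q_def using vc by (subst star_mat_mult) auto
  have EQ: "E * Q = Q" unfolding QR using assoc_mult_mat[OF Ec Dc Rc] by (simp add: D(3))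
  have QE: "Q * E = Q" using arg_cong[OF EQ, of star_mat] Ec Qc E(2) Qs by (simp add: star_mat_mult)
  \<comment> \<open>This says that the adjoint of \<open>D\<close> annihilates \<open>E - Q\<close>;
    its own adjoint \<open>Q * D = D\<close> makes \<open>Q\<close> idempotent.\<close>
  have DQ: "?D * Q = ?D"
  proof -
    have "?D * Q = (?D * D) * R" unfolding QR by (rule assoc_mult_mat[OF D'c Dc Rc, symmetric])
    also have "\<dots> = (?D * D * (s * s)) * ?D" unfolding R_def by (rule assoc_mult_mat[OF DDc ssc D'c, symmetric])
    finally show ?thesis by (simp add: inv' PD)
  qed
  have QQ: "Q * Q = Q"
  proof -
    have "Q * D = D" using arg_cong[OF DQ, of star_mat] Dc Qc Qs by (simp add: star_mat_mult)
    then show ?thesis using assoc_mult_mat[OF Qc Dc Rc] by (simp add: QR)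
  qed
  define p where "p = E - Q"
  have pA: "p \<in> mats_over A n n" unfolding p_def by (rule mats_diff[OF E(1) QA])
  have pc: "p \<in> carrier_mat n n" using pA by (simp add: mats_over_iff)
  have ps: "star_mat p = p"
  proof -
    have "star_mat (E - Q) = star_mat E - star_mat Q"
      using Ec Qc by (auto intro!: eq_matI simp: star_diff)
    then show ?thesis by (simp add: p_def E(2) Qs)
  qed
  have Qp: "Q * p = 0\<^sub>m n n" unfolding p_def mult_minus_distrib_mat[OF Qc Ec Qc] QE QQ using Qc by auto
  have Ep: "E * p = p" unfolding p_def mult_minus_distrib_mat[OF Ec Ec Qc] EQ E(3) ..
  have Dp: "?D * p = 0\<^sub>m m n" unfolding p_def mult_minus_distrib_mat[OF D'c Ec Qc] DE DQ using D'c by auto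
  have pp: "p * p = p"
  proof -
    have "p * p = E * p - Q * p" using minus_mult_distrib_mat[OF Ec Qc pc] by (simp add: p_def)
    also have "\<dots> = p" unfolding Ep Qp using pc by (auto intro!: eq_matI)
    finally show ?thesis .
  qed
  have prj: "P \<in> projections A" "Q \<in> projections A" "p \<in> projections A" "E \<in> projections A"
    using projectionsI P QA Qs QQ pA ps pp E by blast+
  have EQp: "E = Q + p" unfolding p_def using Ec Qc by (auto intro!: eq_matI)
  \<comment> \<open>The class of \<open>E\<close> splits along the orthogonal sum
    \<open>Q + p\<close>, and the partial isometry \<open>v\<close> replaces \<open>Q\<close> by
    \<open>P\<close>.\<close>
  have "mvn_equiv A (Q + p) (Q \<oplus>\<^sub>m p)"
    using Qp Qc pc by (intro mvn_orthogonal_sum prj) auto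
  then have "K0_class A E = K0_class A (Q \<oplus>\<^sub>m p)"
    unfolding EQp[symmetric] by (intro K0_class_mvn prj block_sum_projections)
  moreover have "mvn_equiv A P Q"
    unfolding mvn_equiv_def by (rule bexI[of _ v]) (use vv vA Qc Pc in \<open>auto simp: Q_def\<close>)
  then have "K0_class A P = K0_class A Q" by (intro K0_class_mvn prj)
  ultimately have "K0_class A E = K0_class A P \<otimes>\<^bsub>K0 A\<^esub> K0_class A p"
    by (simp add: K0_class_block_sum prj)
  with prj(3) pc Ep Dp Rc show ?thesis by (intro that[of p R]) (simp_all add: p_def QR)
qed

end

context group
begin

lemma real_cstar_reduced_cstar: "real_cstar (reduced_cstar G)"
proof -
  interpret star_subring "reduced_cstar G" by (rule star_subring_reduced_cstar)
  show ?thesis by unfold_locales (auto intro: closed_reduced_cstar reduced_cstar_scaleR)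
qed

end

section \<open>Non-amenability and almost invariant vectors\<close>

definition restr :: "'i set \<Rightarrow> 'i ell2 \<Rightarrow> 'i ell2" where
  "restr A \<xi> = Abs_ell2 (\<lambda>i. if i \<in> A then coord \<xi> i else 0)"

lemma coord_restr: "coord (restr A \<xi>) i = (if i \<in> A then coord \<xi> i else 0)"
proof -
  have "(\<lambda>i. (cmod (if i \<in> A then coord \<xi> i else 0))\<^sup>2) summable_on UNIV"
    by (rule summable_on_comparison_test[OF ell2_summable[of \<xi>]]) auto
  then show ?thesis by (simp add: restr_def Abs_ell2_inverse)
qed

lemma norm_restr_power2: "(norm (restr A \<xi>))\<^sup>2 = (\<Sum>\<^sub>\<infinity>i\<in>A. (cmod (coord \<xi> i))\<^sup>2)"
  unfolding norm_ell2_power2 by (rule infsum_cong_neutral) (auto simp: coord_restr)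

lemma norm_restr_le: "norm (restr A \<xi>) \<le> norm \<xi>"
proof (rule norm_ell2_le)
  fix F :: "'a set" assume F: "finite F"
  have "(\<Sum>i\<in>F. (cmod (coord (restr A \<xi>) i))\<^sup>2) \<le> (\<Sum>i\<in>F. (cmod (coord \<xi> i))\<^sup>2)"
    by (rule sum_mono) (simp add: coord_restr)
  also have "\<dots> \<le> (norm \<xi>)\<^sup>2" by (rule sum_coord_le_norm[OF F])
  finally show "(\<Sum>i\<in>F. (cmod (coord (restr A \<xi>) i))\<^sup>2) \<le> (norm \<xi>)\<^sup>2" .
qed simp

lemma restr_diff: "restr A (\<xi> - \<eta>) = restr A \<xi> - restr A \<eta>"
  by (rule ell2_eqI) (simp add: coord_restr minus_ell2.rep_eq)

lemma norm_restr_Un: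
  assumes "A \<inter> B = {}"
  shows "(norm (restr (A \<union> B) \<xi>))\<^sup>2 = (norm (restr A \<xi>))\<^sup>2 + (norm (restr B \<xi>))\<^sup>2"
  unfolding norm_restr_power2
  by (rule infsum_Un_disjoint[OF _ _ assms]; rule summable_on_subset_banach[OF ell2_summable]) auto

text \<open>By Tychonoff, set functions with values in [0,1] form a compact space, so the sequence
  has a cluster point. \<open>F\<close> is its neighbourhood filter traced on the sequence; all
  coordinates converge along it at once, which a subsequence need not achieve.\<close>

lemma mean_limit_exists:
  fixes m :: "nat \<Rightarrow> 's set \<Rightarrow> real"
  assumes m: "\<And>n A. 0 \<le> m n A" "\<And>n A. m n A \<le> 1"
  obtains \<mu> F where "F \<noteq> bot" "\<And>A. ((\<lambda>f. f A) \<longlongrightarrow> \<mu> A) F"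
    "\<And>P. eventually (\<lambda>n. P (m n)) sequentially \<Longrightarrow> eventually P F"
proof -
  let ?K = "PiE UNIV (\<lambda>_ :: 's set. {0..1 :: real})"
  have "compactin (product_topology (\<lambda>_. euclidean) UNIV) ?K"
    unfolding compactin_PiE by simp
  then have "compact ?K" by (simp add: euclidean_product_topology)
  moreover have "filtermap m sequentially \<noteq> bot" by (simp add: filtermap_bot_iff)
  moreover have "eventually (\<lambda>f. f \<in> ?K) (filtermap m sequentially)"
    using m by (simp add: eventually_filtermap PiE_def)
  ultimately obtain \<mu> where \<mu>: "inf (nhds \<mu>) (filtermap m sequentially) \<noteq> bot"
    unfolding compact_filter by blast
  show thesis
  proof (rule that[OF \<mu>])
    fix A
    have "continuous_on UNIV (\<lambda>f :: 's set \<Rightarrow> real. f A)"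
      by (rule continuous_on_product_coordinates)
    then have "((\<lambda>f. f A) \<longlongrightarrow> \<mu> A) (at \<mu>)"
      by (simp add: continuous_on_def)
    then have "((\<lambda>f. f A) \<longlongrightarrow> \<mu> A) (nhds \<mu>)"
      by (rule tendsto_at_iff_tendsto_nhds[THEN iffD1])
    then show "((\<lambda>f. f A) \<longlongrightarrow> \<mu> A) (inf (nhds \<mu>) (filtermap m sequentially))"
      by (rule tendsto_mono[rotated]) simp
  next
    fix P assume "eventually (\<lambda>n. P (m n)) sequentially"
    then have "eventually P (filtermap m sequentially)" by (simp add: eventually_filtermap)
    then show "eventually P (inf (nhds \<mu>) (filtermap m sequentially))"
      by (rule filter_leD[rotated]) simp
  qed
qed

context group
begin

abbreviation supported :: "'a ell2 \<Rightarrow> bool" where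
  "supported \<xi> \<equiv> bop_apply (left_reg G \<one>) \<xi> = \<xi>"

lemma mean_left_translate:
  assumes g: "g \<in> carrier G" and A: "A \<subseteq> carrier G"
  shows "(norm (restr (g <#\<^bsub>G\<^esub> A) \<xi>))\<^sup>2 = (norm (restr A (bop_apply (left_reg G (inv g)) \<xi>)))\<^sup>2"
proof -
  have eq: "g <#\<^bsub>G\<^esub> A = (\<lambda>x. g \<otimes> x) ` A" by (auto simp: l_coset_def)
  have inj: "inj_on (\<lambda>x. g \<otimes> x) A" using g A by (auto simp: inj_on_def subset_iff)
  have "(\<Sum>\<^sub>\<infinity>i\<in>g <#\<^bsub>G\<^esub> A. (cmod (coord \<xi> i))\<^sup>2) = (\<Sum>\<^sub>\<infinity>x\<in>A. (cmod (coord \<xi> (g \<otimes> x)))\<^sup>2)"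
    unfolding eq infsum_reindex[OF inj] by (simp add: o_def)
  also have "\<dots> = (\<Sum>\<^sub>\<infinity>x\<in>A. (cmod (coord (bop_apply (left_reg G (inv g)) \<xi>) x))\<^sup>2)"
    using g A by (intro infsum_cong) (auto simp: coord_left_reg subset_iff)
  finally show ?thesis by (simp add: norm_restr_power2)
qed

text \<open>Translating the set amounts to moving the vector by the inverse element. The norms of
  the two restrictions differ by at most the displacement, and the factor 2 bounds their sum for a
  unit vector.\<close>

lemma mean_almost_invariant:
  assumes g: "g \<in> carrier G" and A: "A \<subseteq> carrier G" and \<xi>: "supported \<xi>" "norm \<xi> = 1"
  shows "\<bar>(norm (restr (g <#\<^bsub>G\<^esub> A) \<xi>))\<^sup>2 - (norm (restr A \<xi>))\<^sup>2\<bar> \<le> 2 * norm (bop_apply (left_reg G g) \<xi> - \<xi>)"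
proof -
  let ?\<eta> = "bop_apply (left_reg G (inv g)) \<xi>"
  let ?a = "norm (restr A ?\<eta>)" and ?b = "norm (restr A \<xi>)"
  have e1: "norm ?\<eta> = 1" using norm_left_reg[of "inv g" \<xi>] g \<xi> by simp
  have "norm (bop_apply (left_reg G g) (?\<eta> - \<xi>)) = norm (bop_apply (left_reg G \<one>) (?\<eta> - \<xi>))"
    by (rule norm_left_reg[OF g])
  then have d: "norm (?\<eta> - \<xi>) = norm (bop_apply (left_reg G g) \<xi> - \<xi>)"
    using g \<xi> by (simp add: bop_apply_linear left_reg_apply_mult norm_minus_commute)
  have "\<bar>?a - ?b\<bar> \<le> norm (restr A ?\<eta> - restr A \<xi>)" by (rule norm_triangle_ineq3)
  also have "\<dots> \<le> norm (?\<eta> - \<xi>)" unfolding restr_diff[symmetric] by (rule norm_restr_le)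
  finally have 1: "\<bar>?a - ?b\<bar> \<le> norm (bop_apply (left_reg G g) \<xi> - \<xi>)" by (simp add: d)
  have "?a \<le> 1" "?b \<le> 1" using norm_restr_le[of A ?\<eta>] norm_restr_le[of A \<xi>] e1 \<xi> by auto
  then have 2: "\<bar>?a + ?b\<bar> \<le> 2" by simp
  have "\<bar>?a\<^sup>2 - ?b\<^sup>2\<bar> = \<bar>?a + ?b\<bar> * \<bar>?a - ?b\<bar>"
    unfolding abs_mult[symmetric] by (simp add: power2_eq_square algebra_simps)
  also have "\<dots> \<le> 2 * norm (bop_apply (left_reg G g) \<xi> - \<xi>)" using 1 2 by (intro mult_mono) auto
  finally show ?thesis by (simp add: mean_left_translate[OF g A])
qed

text \<open>Without such a constant there are unit vectors moved arbitrarily little by all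
  generators. The masses of their squared moduli on subsets cluster at a finitely additive invariant
  mean.\<close>

lemma nonamenable_gap:
  assumes S: "S \<subseteq> carrier G" "generate G S = carrier G" "finite S" and "\<not> amenable G"
  shows "\<exists>K\<ge>0. \<forall>\<xi>. supported \<xi> \<longrightarrow> norm \<xi> \<le> K * (\<Sum>g\<in>S. norm (bop_apply (left_reg G g) \<xi> - \<xi>))"
proof (rule ccontr)
  let ?d = "\<lambda>\<xi>. \<Sum>g\<in>S. norm (bop_apply (left_reg G g) \<xi> - \<xi>)"
  assume neg: "\<not> ?thesis"
  \<comment> \<open>The negation is used with the constant n + 1 and the vector normalised; the
    strict inequality rules out the zero vector.\<close>
  have "\<exists>\<xi>. supported \<xi> \<and> norm \<xi> = 1 \<and> real (Suc n) * ?d \<xi> \<le> 1" for n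
  proof -
    obtain \<xi> where \<xi>: "supported \<xi>" "norm \<xi> > real (Suc n) * ?d \<xi>"
      using neg by (meson not_le of_nat_0_le_iff)
    have "0 \<le> real (Suc n) * ?d \<xi>" by (intro mult_nonneg_nonneg sum_nonneg) auto
    then have pos: "norm \<xi> > 0" using \<xi>(2) by linarith
    let ?r = "inverse (norm \<xi>)"
    have "bop_apply (left_reg G g) (?r *\<^sub>R \<xi>) - ?r *\<^sub>R \<xi> = ?r *\<^sub>R (bop_apply (left_reg G g) \<xi> - \<xi>)" for g
      by (simp add: bop_apply_linear scaleR_diff_right)
    then have "?d (?r *\<^sub>R \<xi>) = ?r * ?d \<xi>" using pos by (simp add: sum_distrib_left)
    moreover have "?r * (real (Suc n) * ?d \<xi>) \<le> ?r * norm \<xi>"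
      using \<xi>(2) pos by (intro mult_left_mono) auto
    ultimately show ?thesis using \<xi>(1) pos
      by (intro exI[of _ "?r *\<^sub>R \<xi>"]) (simp add: bop_apply_linear mult.left_commute)
  qed
  then obtain \<eta> where \<eta>: "\<And>n. supported (\<eta> n)" "\<And>n. norm (\<eta> n) = 1"
    and \<eta>d: "\<And>n. real (Suc n) * ?d (\<eta> n) \<le> 1" by metis
  define m where "m = (\<lambda>n A. (norm (restr A (\<eta> n)))\<^sup>2)"
  have m01: "0 \<le> m n A" "m n A \<le> 1" for n A
    using norm_restr_le[of A "\<eta> n"] \<eta>(2)[of n] by (auto simp: m_def power_le_one)
  obtain \<mu> F where F: "F \<noteq> bot" and lim: "\<And>A. ((\<lambda>f. f A) \<longlongrightarrow> \<mu> A) F"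
    and ev: "\<And>P. eventually (\<lambda>n. P (m n)) sequentially \<Longrightarrow> eventually P F"
    by (rule mean_limit_exists[OF m01]) (rule that; assumption)
  have nonneg: "0 \<le> \<mu> A" for A
    by (rule tendsto_lowerbound[OF lim ev F]) (simp add: m01)
  have m1: "m n (carrier G) = 1" for n
  proof -
    have "restr (carrier G) (\<eta> n) = \<eta> n"
      by (rule ell2_eqI) (metis \<eta>(1) coord_restr coord_left_reg one_closed)
    then show ?thesis by (simp add: m_def \<eta>(2))
  qed
  have total: "\<mu> (carrier G) = 1"
  proof (rule tendsto_unique[OF F lim])
    show "((\<lambda>f. f (carrier G)) \<longlongrightarrow> 1) F"
      by (rule tendsto_eventually[OF ev]) (simp add: m1)
  qed
  have add: "\<mu> (A \<union> B) = \<mu> A + \<mu> B" if "A \<inter> B = {}" for A B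
  proof (rule tendsto_unique[OF F lim])
    have "eventually (\<lambda>f. f A + f B = f (A \<union> B)) F"
      by (rule ev) (simp add: m_def norm_restr_Un[OF that])
    with tendsto_add[OF lim[of A] lim[of B]] show "((\<lambda>f. f (A \<union> B)) \<longlongrightarrow> \<mu> A + \<mu> B) F"
      by (rule Lim_transform_eventually)
  qed
  have inv_gen: "\<mu> (g <#\<^bsub>G\<^esub> A) = \<mu> A" if g: "g \<in> S" and A: "A \<subseteq> carrier G" for g A
  proof -
    have gG: "g \<in> carrier G" using g S by auto
    have bnd: "\<bar>m n (g <#\<^bsub>G\<^esub> A) - m n A\<bar> \<le> 2 / real (Suc n)" for n
    proof -
      have "norm (bop_apply (left_reg G g) (\<eta> n) - \<eta> n) \<le> ?d (\<eta> n)"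
        by (rule member_le_sum) (use g S in auto)
      also have "\<dots> \<le> 1 / real (Suc n)" using \<eta>d[of n] by (simp add: field_simps)
      finally have "2 * norm (bop_apply (left_reg G g) (\<eta> n) - \<eta> n) \<le> 2 / real (Suc n)" by simp
      with mean_almost_invariant[OF gG A \<eta>(1,2)] show ?thesis unfolding m_def by (rule order_trans)
    qed
    \<comment> \<open>The bound holds eventually for the sequence, hence along \<open>F\<close>, and
      being closed in the two coordinates involved it passes to the limit.\<close>
    have "\<bar>\<mu> (g <#\<^bsub>G\<^esub> A) - \<mu> A\<bar> \<le> e" if e: "0 < e" for e
    proof (rule tendsto_upperbound[OF _ ev F])
      show "((\<lambda>f. \<bar>f (g <#\<^bsub>G\<^esub> A) - f A\<bar>) \<longlongrightarrow> \<bar>\<mu> (g <#\<^bsub>G\<^esub> A) - \<mu> A\<bar>) F"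
        by (intro tendsto_intros lim)
      have "(\<lambda>n. 2 / real (Suc n)) \<longlonglongrightarrow> 0" by (intro LIMSEQ_Suc lim_const_over_n)
      then have "eventually (\<lambda>n. 2 / real (Suc n) < e) sequentially" using e by (rule order_tendstoD)
      then show "eventually (\<lambda>n. \<bar>m n (g <#\<^bsub>G\<^esub> A) - m n A\<bar> \<le> e) sequentially"
        by (rule eventually_mono) (use bnd in \<open>meson less_imp_le order_trans\<close>)
    qed
    then have "\<bar>\<mu> (g <#\<^bsub>G\<^esub> A) - \<mu> A\<bar> \<le> 0" by (rule field_le_epsilon) simp
    then show ?thesis by simp
  qed
  have coset_mult: "(g \<otimes> h) <#\<^bsub>G\<^esub> A = g <#\<^bsub>G\<^esub> (h <#\<^bsub>G\<^esub> A)" "h <#\<^bsub>G\<^esub> A \<subseteq> carrier G"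
    if "g \<in> carrier G" "h \<in> carrier G" "A \<subseteq> carrier G" for g h A
    using that lcos_m_assoc[of A g h] l_coset_subset_G[of A h] by auto
  \<comment> \<open>An inverse of a generator is handled by applying the generator to the already
    translated set; products follow by iteration.\<close>
  have inv_all: "g \<in> carrier G \<and> (\<forall>A\<subseteq>carrier G. \<mu> (g <#\<^bsub>G\<^esub> A) = \<mu> A)" if "g \<in> generate G S" for g
    using that
  proof (induction rule: generate.induct)
    case one
    then show ?case by (simp add: lcos_mult_one)
  next
    case (incl h)
    then show ?case using inv_gen S by auto
  next
    case (inv h)
    then have h: "h \<in> carrier G" using S by auto
    have "\<mu> (m_inv G h <#\<^bsub>G\<^esub> A) = \<mu> A" if A: "A \<subseteq> carrier G" for A
    proof -
      have "\<mu> A = \<mu> (h <#\<^bsub>G\<^esub> (m_inv G h <#\<^bsub>G\<^esub> A))"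
        using coset_mult(1)[OF h inv_closed[OF h] A] h A by (simp add: lcos_mult_one)
      also have "\<dots> = \<mu> (m_inv G h <#\<^bsub>G\<^esub> A)"
        using coset_mult(2)[OF h inv_closed[OF h] A] by (rule inv_gen[OF inv])
      finally show ?thesis by simp
    qed
    then show ?case using h by simp
  next
    case (eng h1 h2)
    then show ?case by (simp add: coset_mult(1) l_coset_subset_G)
  qed
  have "amenable G"
    unfolding amenable_def by (rule exI[of _ \<mu>]) (use nonneg total add inv_all S(2) in auto)
  with \<open>\<not> amenable G\<close> show False by simp
qed

end

section \<open>Equivariant cochains\<close>

lemma bsum_diagonal:
  "bsum (map (\<lambda>x. mat 1 1 (\<lambda>_. f x)) xs)
    = mat (length xs) (length xs) (\<lambda>(i, j). if i = j then f (xs ! i) else 0)"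
proof (induction xs)
  case (Cons x xs)
  let ?m = "mat (length xs) (length xs) (\<lambda>(i, j). if i = j then f (xs ! i) else 0)"
  have "bsum (map (\<lambda>x. mat 1 1 (\<lambda>_. f x)) (x # xs)) = mat 1 1 (\<lambda>_. f x) \<oplus>\<^sub>m ?m"
    by (simp only: list.map bsum_simps Cons.IH)
  also have "\<dots> = mat (length (x # xs)) (length (x # xs)) (\<lambda>(i, j). if i = j then f ((x # xs) ! i) else 0)"
    by (rule eq_matI) (auto simp: block_sum_def nth_Cons split: nat.split)
  finally show ?case .
qed (auto intro: eq_matI)

text \<open>Instantiated once for vertices and once for arcs. The list \<open>rs\<close> provides
  matrix indices for the orbits, \<open>l\<close> a base point in each; finite stabilisers make the
  averages meaningful.\<close>

locale lifted_action = group G for G (structure) +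
  fixes S :: "'s set" and \<alpha> :: "'a \<Rightarrow> 's \<Rightarrow> 's" and l :: "'s set \<Rightarrow> 's" and rs :: "'s set list"
  assumes act_closed: "g \<in> carrier G \<Longrightarrow> x \<in> S \<Longrightarrow> \<alpha> g x \<in> S"
    and act_one: "x \<in> S \<Longrightarrow> \<alpha> \<one> x = x"
    and act_mult: "g \<in> carrier G \<Longrightarrow> h \<in> carrier G \<Longrightarrow> x \<in> S \<Longrightarrow> \<alpha> (g \<otimes> h) x = \<alpha> g (\<alpha> h x)"
    and finite_stabilizer: "x \<in> S \<Longrightarrow> finite (stabilizer G \<alpha> x)"
    and lift: "orbit_lift G S \<alpha> l"
    and distinct_rs: "distinct rs" and set_rs: "set rs = orbits G S \<alpha>"
begin

abbreviation rep :: "nat \<Rightarrow> 's" where "rep i \<equiv> l (rs ! i)"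
abbreviation av :: "nat \<Rightarrow> 'a bop" where "av i \<equiv> averaging G (stabilizer G \<alpha> (rep i))"

lemma subgroup_stabilizer:
  assumes x: "x \<in> S"
  shows "subgroup (stabilizer G \<alpha> x) G"
proof (rule subgroupI)
  show "stabilizer G \<alpha> x \<noteq> {}" using act_one[OF x] by (auto simp: stabilizer_def)
  fix a b assume a: "a \<in> stabilizer G \<alpha> x" 
  then have "\<alpha> (inv a) (\<alpha> a x) = x"
    using act_mult[of "inv a" a x] x by (simp add: stabilizer_def act_one)
  then show "inv a \<in> stabilizer G \<alpha> x" using a by (simp add: stabilizer_def)
  assume b: "b \<in> stabilizer G \<alpha> x"
  then show "a \<otimes> b \<in> stabilizer G \<alpha> x" using a x by (simp add: stabilizer_def act_mult)
qed (auto simp: stabilizer_def)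

lemma rep_props:
  assumes i: "i < length rs"
  shows "rep i \<in> S" "rs ! i = orbit G \<alpha> (rep i)"
proof -
  have R: "rs ! i \<in> orbits G S \<alpha>" using i set_rs by (metis nth_mem)
  then obtain x where x: "x \<in> S" "rs ! i = orbit G \<alpha> x" by (auto simp: orbits_def)
  have "rep i \<in> rs ! i" using lift R by (simp add: orbit_lift_def)
  then obtain g where g: "g \<in> carrier G" "rep i = \<alpha> g x" using x by (auto simp: orbit_def)
  show "rep i \<in> S" using g x act_closed by simp
  have x': "x = \<alpha> (inv g) (rep i)" using g x act_mult[of "inv g" g x] by (simp add: act_one)
  show "rs ! i = orbit G \<alpha> (rep i)"
  proof
    show "rs ! i \<subseteq> orbit G \<alpha> (rep i)"
    proof
      fix y assume "y \<in> rs ! i"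
      then obtain h where "h \<in> carrier G" "y = \<alpha> h x" using x by (auto simp: orbit_def)
      then have "y = \<alpha> (h \<otimes> inv g) (rep i)"
        using act_mult[of h "inv g" "rep i"] x'[symmetric] g(1) \<open>rep i \<in> S\<close> by simp
      then show "y \<in> orbit G \<alpha> (rep i)" using \<open>h \<in> carrier G\<close> g by (auto simp: orbit_def)
    qed
    show "orbit G \<alpha> (rep i) \<subseteq> rs ! i"
      unfolding x(2) using g x by (auto simp: orbit_def act_mult[symmetric])
  qed
qed

lemma rep_cover:
  assumes x: "x \<in> S"
  obtains i g where "i < length rs" "g \<in> carrier G" "x = \<alpha> g (rep i)"
proof -
  have "orbit G \<alpha> x \<in> set rs" using x set_rs by (auto simp: orbits_def)
  then obtain i where i: "i < length rs" "rs ! i = orbit G \<alpha> x" by (metis in_set_conv_nth)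
  have "x \<in> orbit G \<alpha> x" unfolding orbit_def using act_one[OF x, symmetric] by blast
  then have "x \<in> orbit G \<alpha> (rep i)" using i rep_props(2)[OF i(1)] by simp
  then show ?thesis using i that by (auto simp: orbit_def)
qed

lemma rep_orbit_unique:
  assumes "i < length rs" "j < length rs" "g \<in> carrier G" "rep j = \<alpha> g (rep i)"
  shows "i = j"
proof -
  have "rep i = \<alpha> (inv g) (rep j)"
    using assms act_mult[of "inv g" g "rep i"] rep_props(1)[OF assms(1)] by (simp add: act_one)
  have "rs ! i = rs ! j"
  proof -
    have "\<alpha> h (rep i) \<in> orbit G \<alpha> (rep j)" if "h \<in> carrier G" for h
    proof -
      have "\<alpha> h (rep i) = \<alpha> (h \<otimes> inv g) (rep j)"
        using act_mult[OF that inv_closed[OF assms(3)] rep_props(1)[OF assms(2)]]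
          \<open>rep i = \<alpha> (inv g) (rep j)\<close> by simp
      then show ?thesis unfolding orbit_def using that assms by blast
    qed
    moreover have "\<alpha> h (rep j) \<in> orbit G \<alpha> (rep i)" if "h \<in> carrier G" for h
    proof -
      have "\<alpha> h (rep j) = \<alpha> (h \<otimes> g) (rep i)"
        using that assms rep_props(1) by (simp add: act_mult)
      then show ?thesis unfolding orbit_def using that assms by blast
    qed
    ultimately have "orbit G \<alpha> (rep i) = orbit G \<alpha> (rep j)"
      unfolding orbit_def[of G \<alpha> "rep i"] orbit_def[of G \<alpha> "rep j"] by (auto simp: orbit_def)
    with rep_props(2)[OF assms(1)] have "rs ! i = orbit G \<alpha> (rep j)" by (rule HOL.trans)
    then show ?thesis by (rule HOL.trans[OF _ rep_props(2)[OF assms(2), symmetric]])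
  qed
  then show ?thesis using nth_eq_iff_index_eq[OF distinct_rs assms(1,2)] by simp
qed

lemma subgroup_rep: "i < length rs \<Longrightarrow> subgroup (stabilizer G \<alpha> (rep i)) G"
  by (rule subgroup_stabilizer[OF rep_props(1)])

lemma av_props:
  assumes "i < length rs"
  shows "av i \<in> reduced_cstar G" "star (av i) = av i" "av i * av i = av i"
  using subgroup_rep[OF assms] finite_stabilizer[OF rep_props(1)[OF assms]]
  by (simp_all add: averaging_mem[OF subgroup.subset] averaging_star averaging_idem)

text \<open>Two elements carrying the lift to the same point differ by an element of its stabiliser,
  which the average absorbs.\<close>

lemma left_reg_av_cong:
  assumes i: "i < length rs" and g: "g \<in> carrier G" "h \<in> carrier G" "\<alpha> g (rep i) = \<alpha> h (rep i)"
  shows "left_reg G g * av i = left_reg G h * av i"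
proof -
  have "\<alpha> (inv h \<otimes> g) (rep i) = \<alpha> (inv h) (\<alpha> h (rep i))"
    using g rep_props(1)[OF i] by (simp add: act_mult)
  also have "\<dots> = rep i" using g rep_props(1)[OF i] act_mult[of "inv h" h "rep i"] by (simp add: act_one)
  finally have "inv h \<otimes> g \<in> stabilizer G \<alpha> (rep i)" using g by (simp add: stabilizer_def)
  then have "left_reg G (inv h \<otimes> g) * av i = av i" by (rule averaging_absorb[OF subgroup_rep[OF i]])
  then have "left_reg G h * av i = left_reg G h * left_reg G (inv h \<otimes> g) * av i" by (simp add: mult.assoc)
  also have "left_reg G h * left_reg G (inv h \<otimes> g) = left_reg G g"
    using g by (simp add: left_reg_mult m_assoc[symmetric])
  finally show ?thesis by simp
qed

definition section_elt :: "'s \<Rightarrow> nat \<Rightarrow> 'a" where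
  "section_elt x i = (SOME g. g \<in> carrier G \<and> x = \<alpha> g (rep i))"

text \<open>The row over the C*-algebra that computes the value at \<open>x\<close> of an
  equivariant map from its values at the lifts. Only the orbit of \<open>x\<close> contributes, and
  the factor \<open>av i\<close> makes the choice in \<open>section_elt\<close> immaterial.\<close>

definition row_op :: "'s \<Rightarrow> nat \<Rightarrow> 'a bop" where
  "row_op x i = (if \<exists>g\<in>carrier G. x = \<alpha> g (rep i) then left_reg G (section_elt x i) * av i else 0)"

lemma row_op_orbit:
  assumes "i < length rs" "g \<in> carrier G"
  shows "row_op (\<alpha> g (rep i)) i = left_reg G g * av i"
proof -
  have "section_elt (\<alpha> g (rep i)) i \<in> carrier G \<and> \<alpha> g (rep i) = \<alpha> (section_elt (\<alpha> g (rep i)) i) (rep i)"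
    unfolding section_elt_def by (rule someI[of _ g]) (use assms in auto)
  then have "left_reg G (section_elt (\<alpha> g (rep i)) i) * av i = left_reg G g * av i"
    using assms by (intro left_reg_av_cong) auto
  moreover have "\<exists>h\<in>carrier G. \<alpha> g (rep i) = \<alpha> h (rep i)" using assms by blast
  ultimately show ?thesis by (simp add: row_op_def)
qed

lemma row_op_other:
  assumes "i < length rs" "j < length rs" "g \<in> carrier G" "j \<noteq> i"
  shows "row_op (\<alpha> g (rep i)) j = 0"
proof -
  have "\<not> (\<exists>h\<in>carrier G. \<alpha> g (rep i) = \<alpha> h (rep j))"
  proof
    assume "\<exists>h\<in>carrier G. \<alpha> g (rep i) = \<alpha> h (rep j)"
    then obtain h where h: "h \<in> carrier G" "\<alpha> g (rep i) = \<alpha> h (rep j)" by blast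
    have "rep j = \<alpha> (inv h) (\<alpha> h (rep j))"
      using h act_mult[of "inv h" h "rep j"] rep_props(1)[OF assms(2)] by (simp add: act_one)
    also have "\<dots> = \<alpha> (inv h \<otimes> g) (rep i)"
      using h assms rep_props(1)[OF assms(1)] by (simp add: act_mult)
    finally show False using rep_orbit_unique[OF assms(1,2), of "inv h \<otimes> g"] h assms by simp
  qed
  then show ?thesis by (simp add: row_op_def)
qed

lemma row_op_mem:
  assumes "x \<in> S" "j < length rs"
  shows "row_op x j \<in> reduced_cstar G"
proof -
  interpret C: star_subring "reduced_cstar G" by (rule star_subring_reduced_cstar)
  obtain i g where i: "i < length rs" "g \<in> carrier G" "x = \<alpha> g (rep i)" using rep_cover[OF assms(1)] .
  show ?thesis
    using i assms row_op_orbit[OF i(1,2)] row_op_other[OF i(1) assms(2) i(2)]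
    by (cases "j = i") (auto intro!: C.mult_mem C.zero_mem left_reg_mem av_props)
qed

text \<open>Since \<open>row_op\<close> contains the averages, an arbitrary tuple is projected
  before it is extended; the result is always a cochain, and on evaluations of cochains this inverts
  evaluation at the lifts.\<close>

definition extend :: "(nat \<Rightarrow> 'a ell2) \<Rightarrow> 's \<Rightarrow> 'a ell2" where
  "extend \<xi> x = (if x \<in> S then \<Sum>j<length rs. bop_apply (row_op x j) (\<xi> j) else 0)"

lemma extend_orbit:
  assumes "i < length rs" "g \<in> carrier G"
  shows "extend \<xi> (\<alpha> g (rep i)) = bop_apply (left_reg G g) (bop_apply (av i) (\<xi> i))"
proof -
  have "extend \<xi> (\<alpha> g (rep i)) = (\<Sum>j<length rs. bop_apply (row_op (\<alpha> g (rep i)) j) (\<xi> j))"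
    using assms act_closed rep_props(1) by (simp add: extend_def)
  also have "\<dots> = (\<Sum>j<length rs. if j = i then bop_apply (left_reg G g * av i) (\<xi> i) else 0)"
    by (rule sum.cong[OF HOL.refl]) (use assms in \<open>simp add: row_op_orbit row_op_other\<close>)
  finally show ?thesis using assms by (simp add: bop_apply_times)
qed

lemma extend_rep:
  assumes i: "i < length rs"
  shows "extend \<xi> (rep i) = bop_apply (av i) (\<xi> i)"
  using extend_orbit[OF i one_closed, of \<xi>]
    averaging_apply_absorb[OF subgroup_rep[OF i] subgroup.one_closed[OF subgroup_rep[OF i]]]
  by (simp add: act_one[OF rep_props(1)[OF i]])

lemma extend_cochain: "extend \<xi> \<in> cochains G S \<alpha>"
  unfolding cochains_def
proof (intro CollectI conjI ballI allI impI)
  fix g x assume g: "g \<in> carrier G" and x: "x \<in> S"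
  obtain i h where i: "i < length rs" "h \<in> carrier G" "x = \<alpha> h (rep i)" using rep_cover[OF x] .
  then have "\<alpha> g x = \<alpha> (g \<otimes> h) (rep i)" using g rep_props(1) by (simp add: act_mult)
  then show "extend \<xi> (\<alpha> g x) = bop_apply (left_reg G g) (extend \<xi> x)"
    using i g by (simp add: extend_orbit left_reg_apply_mult)
qed (simp add: extend_def)

lemma cochainD:
  assumes "\<phi> \<in> cochains G S \<alpha>"
  shows "g \<in> carrier G \<Longrightarrow> x \<in> S \<Longrightarrow> \<phi> (\<alpha> g x) = bop_apply (left_reg G g) (\<phi> x)"
    "x \<notin> S \<Longrightarrow> \<phi> x = 0"
  using assms by (auto simp: cochains_def)

lemma cochain_supported: "\<phi> \<in> cochains G S \<alpha> \<Longrightarrow> supported (\<phi> x)"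
  by (cases "x \<in> S") (auto simp: cochainD(1)[symmetric] cochainD(2) act_one bop_apply_linear)

lemma cochain_norm:
  "\<phi> \<in> cochains G S \<alpha> \<Longrightarrow> g \<in> carrier G \<Longrightarrow> x \<in> S \<Longrightarrow> norm (\<phi> (\<alpha> g x)) = norm (\<phi> x)"
  by (simp add: cochainD(1) norm_left_reg cochain_supported)

lemma cochain_eqI:
  assumes "\<phi> \<in> cochains G S \<alpha>" "\<phi>' \<in> cochains G S \<alpha>" "\<And>i. i < length rs \<Longrightarrow> \<phi> (rep i) = \<phi>' (rep i)"
  shows "\<phi> = \<phi>'"
proof
  fix x show "\<phi> x = \<phi>' x"
  proof (cases "x \<in> S")
    case True
    then obtain i h where "i < length rs" "h \<in> carrier G" "x = \<alpha> h (rep i)" using rep_cover by metis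
    then show ?thesis using assms rep_props(1) by (simp add: cochainD(1))
  qed (use assms in \<open>simp add: cochainD(2)\<close>)
qed

abbreviation eval_lifts :: "('s \<Rightarrow> 'a ell2) \<Rightarrow> nat \<Rightarrow> 'a ell2" where
  "eval_lifts \<phi> \<equiv> (\<lambda>i. \<phi> (rep i))"

text \<open>Equivariance under the stabiliser of a lift makes the value there invariant; this is how
  the corner of \<open>av i\<close> arises from cochains.\<close>

lemma av_cochain:
  assumes "\<phi> \<in> cochains G S \<alpha>" "i < length rs"
  shows "bop_apply (av i) (\<phi> (rep i)) = \<phi> (rep i)"
proof (rule averaging_fixes)
  show "finite (stabilizer G \<alpha> (rep i))" by (rule finite_stabilizer[OF rep_props(1)[OF assms(2)]])
  show "stabilizer G \<alpha> (rep i) \<noteq> {}" using subgroup.one_closed[OF subgroup_rep[OF assms(2)]] by blast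
  fix h assume "h \<in> stabilizer G \<alpha> (rep i)"
  then show "bop_apply (left_reg G h) (\<phi> (rep i)) = \<phi> (rep i)"
    using cochainD(1)[OF assms(1), of h "rep i"] rep_props(1)[OF assms(2)] by (simp add: stabilizer_def)
qed

lemma extend_eval: "\<phi> \<in> cochains G S \<alpha> \<Longrightarrow> extend (eval_lifts \<phi>) = \<phi>"
  by (rule cochain_eqI[OF extend_cochain]) (auto simp: extend_rep av_cochain)

section \<open>The diagonal projection of stabiliser averages and its class\<close>

definition proj_mat :: "'a bop mat" where
  "proj_mat = mat (length rs) (length rs) (\<lambda>(i, j). if i = j then av i else 0)"

lemma proj_mat_carrier: "proj_mat \<in> carrier_mat (length rs) (length rs)"
  by (simp add: proj_mat_def)

lemma proj_mat_mem: "proj_mat \<in> mats_over (reduced_cstar G) (length rs) (length rs)"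
proof -
  interpret C: star_subring "reduced_cstar G" by (rule star_subring_reduced_cstar)
  show ?thesis by (rule mats_overI[OF proj_mat_carrier]) (auto simp: proj_mat_def av_props C.zero_mem)
qed

lemma proj_mat_star: "star_mat proj_mat = proj_mat"
  by (rule eq_matI) (auto simp: proj_mat_def av_props)

lemma mapp_proj_mat: "i < length rs \<Longrightarrow> mapp proj_mat \<xi> i = bop_apply (av i) (\<xi> i)"
proof -
  assume i: "i < length rs"
  have "mapp proj_mat \<xi> i = (\<Sum>j<length rs. if j = i then bop_apply (av i) (\<xi> i) else 0)"
    unfolding mapp_def using i by (auto simp: proj_mat_def intro!: sum.cong simp del: sum.delta sum.delta')
  then show ?thesis using i by simp
qed

lemma proj_mat_idem: "proj_mat * proj_mat = proj_mat"
proof (rule mapp_eqI[of _ "length rs" "length rs"])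
  fix \<xi> i assume i: "i < length rs"
  have "mapp (proj_mat * proj_mat) \<xi> i = mapp proj_mat (mapp proj_mat \<xi>) i"
    using proj_mat_carrier by (subst mapp_mult) auto
  then show "mapp (proj_mat * proj_mat) \<xi> i = mapp proj_mat \<xi> i"
    using i av_props(3)[OF i] by (simp add: mapp_proj_mat bop_apply_times[symmetric])
qed (use proj_mat_carrier in auto)

lemma proj_mat_bsum: "proj_mat = bsum (map (\<lambda>R. mat 1 1 (\<lambda>_. averaging G (stabilizer G \<alpha> (l R)))) rs)"
  unfolding bsum_diagonal proj_mat_def ..

lemma K0_class_proj_mat:
  "K0_class (reduced_cstar G) proj_mat = (\<Otimes>\<^bsub>K0 (reduced_cstar G)\<^esub>R \<in> orbits G S \<alpha>.
     K0_class (reduced_cstar G) (mat 1 1 (\<lambda>_. averaging G (stabilizer G \<alpha> (l R)))))"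
proof -
  interpret C: star_subring "reduced_cstar G" by (rule star_subring_reduced_cstar)
  have "mat 1 1 (\<lambda>_. averaging G (stabilizer G \<alpha> (l R))) \<in> projections (reduced_cstar G)" if "R \<in> set rs" for R
  proof -
    have "\<exists>i<length rs. rs ! i = R" by (rule in_set_conv_nth[THEN iffD1, OF that])
    then obtain i where i: "i < length rs" "rs ! i = R" by auto
    show ?thesis unfolding i(2)[symmetric]
    proof (rule C.projectionsI[of _ 1])
      show "mat 1 1 (\<lambda>_. av i) \<in> mats_over (reduced_cstar G) 1 1"
        by (rule mats_overI) (simp_all add: av_props[OF i(1)])
      show "star_mat (mat 1 1 (\<lambda>_. av i)) = mat 1 1 (\<lambda>_. av i)"
        by (rule eq_matI) (simp_all add: av_props[OF i(1)])
      show "mat 1 1 (\<lambda>_. av i) * mat 1 1 (\<lambda>_. av i) = mat 1 1 (\<lambda>_. av i)"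
        by (rule eq_matI) (simp_all add: scalar_prod_def av_props[OF i(1)])
    qed
  qed
  then show ?thesis
    unfolding proj_mat_bsum set_rs[symmetric] by (intro C.K0_class_bsum[symmetric] distinct_rs)
qed

lemma cochain_inner_eq: "cochain_inner G S \<alpha> l \<phi> \<phi>' = tinner (length rs) (eval_lifts \<phi>) (eval_lifts \<phi>')"
  unfolding cochain_inner_def tinner_def set_rs[symmetric]
  by (rule sum.reindex_bij_betw[OF bij_betw_nth[OF distinct_rs HOL.refl HOL.refl], symmetric])

lemma eval_extend: "i < length rs \<Longrightarrow> extend \<xi> (rep i) = mapp proj_mat \<xi> i"
  by (simp add: extend_rep mapp_proj_mat)

lemma mapp_proj_eval: "\<phi> \<in> cochains G S \<alpha> \<Longrightarrow> i < length rs \<Longrightarrow> mapp proj_mat (eval_lifts \<phi>) i = \<phi> (rep i)"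
  by (simp add: mapp_proj_mat av_cochain)

end

section \<open>The first Kazhdan projection of an equivariant graph\<close>

lemma mapp_map_mat_scaleR: "mapp (map_mat ((*\<^sub>R) r) M) \<xi> i = r *\<^sub>R mapp M \<xi> i"
  by (simp add: mapp_def bop_apply_scaleR scaleR_sum_right)

lemma star_mat_map_scaleR: "star_mat (map_mat ((*\<^sub>R) r) M) = map_mat ((*\<^sub>R) r) (star_mat (M :: 'i bop mat))"
  by (rule eq_matI) (auto simp: star_scaleR_bop)

lemma tnorm2_scaleR: "tnorm2 n (\<lambda>i. r *\<^sub>R \<xi> i) = r\<^sup>2 * tnorm2 n \<xi>"
  by (simp add: tnorm2_def power_mult_distrib sum_distrib_left)

locale equivariant_graph = group G +
  V: lifted_action G "verts X" \<alpha> l\<^sub>v vs + E: lifted_action G "arcs X" \<beta> l\<^sub>e es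
  for G :: "('a, 'm) monoid_scheme" (structure) and X :: "('x, 'y) pre_digraph" and \<alpha> l\<^sub>v vs \<beta> l\<^sub>e es +
  assumes ends: "e \<in> arcs X \<Longrightarrow> head X e \<in> verts X" "e \<in> arcs X \<Longrightarrow> tail X e \<in> verts X"
    and equivariant: "g \<in> carrier G \<Longrightarrow> e \<in> arcs X \<Longrightarrow> head X (\<beta> g e) = \<alpha> g (head X e)"
      "g \<in> carrier G \<Longrightarrow> e \<in> arcs X \<Longrightarrow> tail X (\<beta> g e) = \<alpha> g (tail X e)"
begin

abbreviation "C0 \<equiv> cochains G (verts X) \<alpha>"
abbreviation "C1 \<equiv> cochains G (arcs X) \<beta>"
abbreviation "m \<equiv> length vs"
abbreviation "n \<equiv> length es"

lemma coboundary_cochain: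
  assumes "\<phi> \<in> C0"
  shows "coboundary X \<phi> \<in> C1"
  unfolding cochains_def
proof (intro CollectI conjI ballI allI impI)
  fix g e assume "g \<in> carrier G" "e \<in> arcs X"
  then show "coboundary X \<phi> (\<beta> g e) = bop_apply (left_reg G g) (coboundary X \<phi> e)"
    by (simp add: coboundary_def E.act_closed equivariant V.cochainD(1)[OF assms] ends bop_apply_linear)
qed (simp add: coboundary_def)

text \<open>The differential in the coordinates given by the lifts. The ends of a lifted arc need
  not be lifted vertices; \<open>row_op\<close> supplies the translation.\<close>

definition dmat :: "'a bop mat" where
  "dmat = mat n m (\<lambda>(i, j). V.row_op (head X (E.rep i)) j - V.row_op (tail X (E.rep i)) j)"

lemma dmat_carrier: "dmat \<in> carrier_mat n m"
  by (simp add: dmat_def)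

lemma mapp_dmat:
  assumes i: "i < n"
  shows "mapp dmat \<xi> i = coboundary X (V.extend \<xi>) (E.rep i)"
proof -
  have e: "E.rep i \<in> arcs X" by (rule E.rep_props(1)[OF i])
  show ?thesis
    using i e by (simp add: mapp_def dmat_def coboundary_def V.extend_def ends bop_apply_diff sum_subtractf)
qed

lemma dmat_mem: "dmat \<in> mats_over (reduced_cstar G) n m"
proof -
  interpret C: real_cstar "reduced_cstar G" by (rule real_cstar_reduced_cstar)
  have d: "x - y \<in> reduced_cstar G" if "x \<in> reduced_cstar G" "y \<in> reduced_cstar G" for x y
    using C.add_mem[OF that(1) C.scaleR_mem[OF that(2), of "- 1"]] by simp
  show ?thesis
    by (rule mats_overI[OF dmat_carrier])
      (simp add: dmat_def d V.row_op_mem ends E.rep_props(1))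
qed

lemma extend_cong_proj: "V.extend (mapp V.proj_mat \<xi>) = V.extend \<xi>"
  by (rule V.cochain_eqI[OF V.extend_cochain V.extend_cochain])
    (simp add: V.extend_rep V.mapp_proj_mat bop_apply_times[symmetric] V.av_props)

lemma dmat_proj: "dmat * V.proj_mat = dmat"
proof (rule mapp_eqI[OF mult_carrier_mat[OF dmat_carrier V.proj_mat_carrier] dmat_carrier])
  fix \<xi> i assume i: "i < n"
  have "mapp (dmat * V.proj_mat) \<xi> = mapp dmat (mapp V.proj_mat \<xi>)"
    using dmat_carrier V.proj_mat_carrier by (intro mapp_mult) simp
  then show "mapp (dmat * V.proj_mat) \<xi> i = mapp dmat \<xi> i"
    by (simp add: mapp_dmat[OF i] extend_cong_proj)
qed

lemma proj_dmat: "E.proj_mat * dmat = dmat"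
proof (rule mapp_eqI[OF mult_carrier_mat[OF E.proj_mat_carrier dmat_carrier] dmat_carrier])
  fix \<xi> i assume i: "i < n"
  have "mapp (E.proj_mat * dmat) \<xi> = mapp E.proj_mat (mapp dmat \<xi>)"
    using dmat_carrier E.proj_mat_carrier by (intro mapp_mult) simp
  then show "mapp (E.proj_mat * dmat) \<xi> i = mapp dmat \<xi> i"
    by (simp add: mapp_dmat[OF i] E.mapp_proj_mat[OF i]
        E.av_cochain[OF coboundary_cochain[OF V.extend_cochain] i])
qed

lemma mapp_dmat_eval: "\<phi> \<in> C0 \<Longrightarrow> i < n \<Longrightarrow> mapp dmat (V.eval_lifts \<phi>) i = coboundary X \<phi> (E.rep i)"
  by (simp add: mapp_dmat V.extend_eval)

subsection \<open>The spectral gap\<close>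

definition dnorm :: "('x \<Rightarrow> 'a ell2) \<Rightarrow> real" where
  "dnorm \<phi> = sqrt (tnorm2 n (\<lambda>i. coboundary X \<phi> (E.rep i)))"

text \<open>Every arc is a translate of a lifted one and translation preserves the norms of cochain
  values, so finitely many orbits control all arcs uniformly.\<close>

lemma norm_coboundary_le:
  assumes \<phi>: "\<phi> \<in> C0" and e: "e \<in> arcs X"
  shows "norm (\<phi> (head X e) - \<phi> (tail X e)) \<le> dnorm \<phi>"
proof -
  obtain i g where i: "i < n" "g \<in> carrier G" "e = \<beta> g (E.rep i)" using E.rep_cover[OF e] .
  have "norm (coboundary X \<phi> e) = norm (coboundary X \<phi> (E.rep i))"
    using E.cochain_norm[OF coboundary_cochain[OF \<phi>] i(2) E.rep_props(1)[OF i(1)]] i(3) by simp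
  also have "\<dots> \<le> dnorm \<phi>"
    unfolding dnorm_def by (rule real_le_rsqrt[OF norm_le_tnorm2[OF i(1)]])
  finally show ?thesis using e by (simp add: coboundary_def)
qed

lemma norm_gwalk_le:
  assumes \<phi>: "\<phi> \<in> C0"
  shows "gwalk X u w v \<Longrightarrow> norm (\<phi> v - \<phi> u) \<le> real (length w) * dnorm \<phi>"
proof (induction w arbitrary: u)
  case (Cons a w)
  obtain e s where a: "a = (e, s)" by (cases a)
  let ?u' = "if s then head X e else tail X e"
  have w: "e \<in> arcs X" "u = (if s then tail X e else head X e)" "gwalk X ?u' w v"
    using Cons.prems by (auto simp: a)
  have 1: "norm (\<phi> ?u' - \<phi> u) \<le> dnorm \<phi>"
    using norm_coboundary_le[OF \<phi> w(1)] w(2) by (simp add: norm_minus_commute)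
  have "norm (\<phi> v - \<phi> u) \<le> norm (\<phi> v - \<phi> ?u') + norm (\<phi> ?u' - \<phi> u)"
    using norm_triangle_ineq[of "\<phi> v - \<phi> ?u'" "\<phi> ?u' - \<phi> u"] by simp
  also have "\<dots> \<le> real (length w) * dnorm \<phi> + dnorm \<phi>" by (intro add_mono Cons.IH w(3) 1)
  finally show ?case by (simp add: algebra_simps)
qed (simp add: dnorm_def)

text \<open>A cochain with small coboundary varies little along a walk from \<open>x0\<close>.
  Comparing \<open>x0\<close> with its translates makes its value at \<open>x0\<close> almost
  invariant, hence small by non-amenability, and walks carry the smallness to all lifts.\<close>

lemma coboundary_gap:
  assumes con: "connected_graph X" and fg: "finitely_generated G" and na: "\<not> amenable G"
  shows "\<exists>\<epsilon>>0. \<forall>\<xi>. \<epsilon> * tnorm2 m (mapp V.proj_mat \<xi>) \<le> tnorm2 n (mapp dmat \<xi>)"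
proof -
  obtain x0 where x0: "x0 \<in> verts X" using con by (auto simp: connected_graph_def)
  have "\<exists>c. 0 \<le> c \<and> (\<forall>\<phi>\<in>C0. norm (\<phi> x - \<phi> x0) \<le> c * dnorm \<phi>)" if x: "x \<in> verts X" for x
  proof -
    obtain w where "gwalk X x0 w x" using con x x0 by (auto simp: connected_graph_def)
    then show ?thesis by (intro exI[of _ "real (length w)"]) (simp add: norm_gwalk_le)
  qed
  then obtain c where c: "\<And>x. x \<in> verts X \<Longrightarrow> 0 \<le> c x"
    "\<And>x \<phi>. x \<in> verts X \<Longrightarrow> \<phi> \<in> C0 \<Longrightarrow> norm (\<phi> x - \<phi> x0) \<le> c x * dnorm \<phi>" by metis
  obtain S where S: "finite S" "S \<subseteq> carrier G" "generate G S = carrier G"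
    using fg by (auto simp: finitely_generated_def)
  obtain K where K: "0 \<le> K"
    "\<And>\<xi>. supported \<xi> \<Longrightarrow> norm \<xi> \<le> K * (\<Sum>g\<in>S. norm (bop_apply (left_reg G g) \<xi> - \<xi>))"
    using nonamenable_gap[OF S(2,3,1) na] by blast
  \<comment> \<open>By equivariance the displacement of \<open>\<phi> x0\<close> by \<open>g\<close>
    is the difference of the values at \<open>\<alpha> g x0\<close> and \<open>x0\<close>, which a
    walk of length \<open>c (\<alpha> g x0)\<close> bounds.\<close>
  define K' where "K' = K * (\<Sum>g\<in>S. c (\<alpha> g x0))"
  have K'0: "0 \<le> K'" unfolding K'_def using K(1) c(1) V.act_closed x0 S(2)
    by (intro mult_nonneg_nonneg sum_nonneg) auto
  have base: "norm (\<phi> x0) \<le> K' * dnorm \<phi>" if \<phi>: "\<phi> \<in> C0" for \<phi>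
  proof -
    have "norm (bop_apply (left_reg G g) (\<phi> x0) - \<phi> x0) \<le> c (\<alpha> g x0) * dnorm \<phi>" if "g \<in> S" for g
      using c(2)[OF V.act_closed[OF _ x0] \<phi>] V.cochainD(1)[OF \<phi> _ x0] that S(2) by (auto simp: subset_iff)
    then have "K * (\<Sum>g\<in>S. norm (bop_apply (left_reg G g) (\<phi> x0) - \<phi> x0)) \<le> K * (\<Sum>g\<in>S. c (\<alpha> g x0) * dnorm \<phi>)"
      using K(1) by (intro mult_left_mono sum_mono) auto
    from order_trans[OF K(2)[OF V.cochain_supported[OF \<phi>, of x0]] this] show ?thesis
      unfolding K'_def by (simp add: sum_distrib_right mult.assoc)
  qed
  define B where "B = (\<Sum>i<m. (K' + c (V.rep i))\<^sup>2)"
  have B0: "0 \<le> B" by (simp add: B_def sum_nonneg)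
  have B: "tnorm2 m (V.eval_lifts \<phi>) \<le> B * (dnorm \<phi>)\<^sup>2" if \<phi>: "\<phi> \<in> C0" for \<phi>
    unfolding tnorm2_def B_def sum_distrib_right
  proof (rule sum_mono)
    fix i assume "i \<in> {..<m}"
    then have r: "V.rep i \<in> verts X" by (simp add: V.rep_props(1))
    have "norm (\<phi> (V.rep i)) \<le> norm (\<phi> (V.rep i) - \<phi> x0) + norm (\<phi> x0)"
      using norm_triangle_ineq[of "\<phi> (V.rep i) - \<phi> x0" "\<phi> x0"] by simp
    also have "\<dots> \<le> c (V.rep i) * dnorm \<phi> + K' * dnorm \<phi>" by (intro add_mono c(2) r \<phi> base)
    finally have "norm (\<phi> (V.rep i)) \<le> (K' + c (V.rep i)) * dnorm \<phi>" by (simp add: algebra_simps)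
    then have "(norm (\<phi> (V.rep i)))\<^sup>2 \<le> ((K' + c (V.rep i)) * dnorm \<phi>)\<^sup>2" by (intro power_mono) auto
    then show "(norm (\<phi> (V.rep i)))\<^sup>2 \<le> (K' + c (V.rep i))\<^sup>2 * (dnorm \<phi>)\<^sup>2" by (simp add: power_mult_distrib)
  qed
  have gap: "tnorm2 m (mapp V.proj_mat \<xi>) \<le> B * tnorm2 n (mapp dmat \<xi>)" for \<xi>
  proof -
    have "tnorm2 m (mapp V.proj_mat \<xi>) = tnorm2 m (V.eval_lifts (V.extend \<xi>))"
      by (rule tnorm2_cong) (simp add: V.eval_extend)
    also have "\<dots> \<le> B * (dnorm (V.extend \<xi>))\<^sup>2" by (rule B[OF V.extend_cochain])
    also have "(dnorm (V.extend \<xi>))\<^sup>2 = tnorm2 n (mapp dmat \<xi>)"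
      unfolding dnorm_def real_sqrt_pow2[OF tnorm2_nonneg] by (rule tnorm2_cong) (simp add: mapp_dmat)
    finally show ?thesis .
  qed
  \<comment> \<open>\<open>B\<close> is only known to be nonnegative, so 1 is added before
    inverting.\<close>
  have "inverse (B + 1) * tnorm2 m (mapp V.proj_mat \<xi>) \<le> tnorm2 n (mapp dmat \<xi>)" for \<xi>
  proof -
    have "tnorm2 m (mapp V.proj_mat \<xi>) \<le> (B + 1) * tnorm2 n (mapp dmat \<xi>)"
      unfolding distrib_right mult_1 using gap[of \<xi>] tnorm2_nonneg[of n "mapp dmat \<xi>"] by linarith
    then have "inverse (B + 1) * tnorm2 m (mapp V.proj_mat \<xi>) \<le> inverse (B + 1) * ((B + 1) * tnorm2 n (mapp dmat \<xi>))"
      using B0 by (intro mult_left_mono) auto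
    then show ?thesis using B0 by (simp add: mult.assoc[symmetric])
  qed
  then show ?thesis using B0 by (intro exI[of _ "inverse (B + 1)"]) auto
qed

subsection \<open>The Laplacian and its kernel\<close>

lemma proj_star_dmat: "V.proj_mat * star_mat dmat = star_mat dmat"
  using arg_cong[OF dmat_proj, of star_mat] dmat_carrier V.proj_mat_carrier
  by (simp add: star_mat_mult V.proj_mat_star)

lemma mapp_proj_star_dmat: "mapp V.proj_mat (mapp (star_mat dmat) \<eta>) = mapp (star_mat dmat) \<eta>"
  using mapp_mult[of V.proj_mat "star_mat dmat" \<eta>] dmat_carrier V.proj_mat_carrier
  by (simp add: proj_star_dmat)

lemma coboundary_adj_eq:
  assumes \<omega>: "\<omega> \<in> C1"
  shows "coboundary_adj G X \<alpha> \<beta> l\<^sub>v l\<^sub>e \<omega> = V.extend (mapp (star_mat dmat) (E.eval_lifts \<omega>))"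
  unfolding coboundary_adj_def
proof (rule the_equality)
  let ?\<psi> = "V.extend (mapp (star_mat dmat) (E.eval_lifts \<omega>))"
  \<comment> \<open>Extending projects by the averages, but the adjoint of \<open>dmat\<close>
    already takes values in their range, so nothing changes at the lifts.\<close>
  have ev: "?\<psi> (V.rep i) = mapp (star_mat dmat) (E.eval_lifts \<omega>) i" if "i < m" for i
    using that by (simp add: V.eval_extend mapp_proj_star_dmat)
  have adj: "cochain_inner G (arcs X) \<beta> l\<^sub>e (coboundary X \<theta>) \<omega> = cochain_inner G (verts X) \<alpha> l\<^sub>v \<theta> ?\<psi>"
    if \<theta>: "\<theta> \<in> C0" for \<theta>
  proof -
    have "tinner n (E.eval_lifts (coboundary X \<theta>)) (E.eval_lifts \<omega>)
        = tinner n (mapp dmat (V.eval_lifts \<theta>)) (E.eval_lifts \<omega>)"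
      by (rule tinner_cong) (simp_all add: mapp_dmat_eval[OF \<theta>])
    also have "\<dots> = tinner m (V.eval_lifts \<theta>) (mapp (star_mat dmat) (E.eval_lifts \<omega>))"
      by (rule tinner_mapp[OF dmat_carrier])
    also have "\<dots> = tinner m (V.eval_lifts \<theta>) (V.eval_lifts ?\<psi>)"
      by (rule tinner_cong) (simp_all add: ev)
    finally show ?thesis by (simp only: E.cochain_inner_eq V.cochain_inner_eq)
  qed
  then show "?\<psi> \<in> C0 \<and> (\<forall>\<theta>\<in>C0. cochain_inner G (arcs X) \<beta> l\<^sub>e (coboundary X \<theta>) \<omega>
      = cochain_inner G (verts X) \<alpha> l\<^sub>v \<theta> ?\<psi>)"
    by (simp add: V.extend_cochain)
  fix \<phi> assume \<phi>: "\<phi> \<in> C0 \<and> (\<forall>\<theta>\<in>C0. cochain_inner G (arcs X) \<beta> l\<^sub>e (coboundary X \<theta>) \<omega>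
      = cochain_inner G (verts X) \<alpha> l\<^sub>v \<theta> \<phi>)"
  \<comment> \<open>The difference of two candidates is itself a test cochain, so its inner product
    with itself vanishes.\<close>
  define \<theta> where "\<theta> = (\<lambda>x. \<phi> x - ?\<psi> x)"
  have \<theta>: "\<theta> \<in> C0"
    using \<phi> V.extend_cochain unfolding \<theta>_def cochains_def by (simp add: bop_apply_linear)
  have "tinner m (V.eval_lifts \<theta>) (V.eval_lifts \<phi>) = tinner m (V.eval_lifts \<theta>) (V.eval_lifts ?\<psi>)"
    using \<phi> \<theta> adj[OF \<theta>] by (simp add: V.cochain_inner_eq)
  then have "tinner m (V.eval_lifts \<theta>) (V.eval_lifts \<theta>) = 0"
    unfolding \<theta>_def by (simp add: tinner_diff_right)
  then have "tnorm2 m (V.eval_lifts \<theta>) = 0" by (simp add: tinner_self)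
  then have "\<phi> (V.rep i) = ?\<psi> (V.rep i)" if "i < m" for i
    using tnorm2_eq_0D[OF _ that, of "V.eval_lifts \<theta>"] by (simp add: \<theta>_def)
  then show "\<phi> = ?\<psi>" using \<phi> V.extend_cochain by (intro V.cochain_eqI) auto
qed

text \<open>The gap makes the differential injective on the range of the vertex projection, and the
  adjoint lands in that range; so the outer factor of the Laplacian can be cancelled.\<close>

lemma ker_laplacian1_iff:
  assumes gap: "0 < \<epsilon>" "\<And>\<xi>. \<epsilon> * tnorm2 m (mapp V.proj_mat \<xi>) \<le> tnorm2 n (mapp dmat \<xi>)"
  shows "\<omega> \<in> ker_laplacian1 G X \<alpha> \<beta> l\<^sub>v l\<^sub>e
    \<longleftrightarrow> \<omega> \<in> C1 \<and> (\<forall>j<m. mapp (star_mat dmat) (E.eval_lifts \<omega>) j = 0)"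
proof (cases "\<omega> \<in> C1")
  case \<omega>: True
  let ?\<zeta> = "mapp (star_mat dmat) (E.eval_lifts \<omega>)"
  have L: "laplacian1 G X \<alpha> \<beta> l\<^sub>v l\<^sub>e \<omega> = coboundary X (V.extend ?\<zeta>)"
    by (simp add: laplacian1_def coboundary_adj_eq[OF \<omega>])
  have "(coboundary X (V.extend ?\<zeta>) = (\<lambda>_. 0)) \<longleftrightarrow> (\<forall>j<m. ?\<zeta> j = 0)"
  proof
    assume zero: "coboundary X (V.extend ?\<zeta>) = (\<lambda>_. 0)"
    have "tnorm2 n (mapp dmat ?\<zeta>) = tnorm2 n (\<lambda>_. 0 :: 'a ell2)" by (rule tnorm2_cong) (simp add: mapp_dmat zero)
    then have "\<epsilon> * tnorm2 m ?\<zeta> \<le> 0"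
      using gap(2)[of ?\<zeta>] by (simp add: mapp_proj_star_dmat tnorm2_def)
    then have "tnorm2 m ?\<zeta> = 0" using gap(1) tnorm2_nonneg[of m ?\<zeta>]
      by (metis mult_le_0_iff not_less order_antisym)
    then show "\<forall>j<m. ?\<zeta> j = 0" using tnorm2_eq_0D by blast
  next
    assume "\<forall>j<m. ?\<zeta> j = 0"
    then have "V.extend ?\<zeta> x = 0" for x by (simp add: V.extend_def bop_apply_linear)
    then show "coboundary X (V.extend ?\<zeta>) = (\<lambda>_. 0)" by (simp add: coboundary_def fun_eq_iff)
  qed
  then show ?thesis using \<omega> by (simp add: ker_laplacian1_def L)
qed (simp add: ker_laplacian1_def)

text \<open>The definite description is unique: the values of two candidates at a tuple differ by a
  kernel element that is orthogonal to the kernel.\<close>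

lemma kazhdan_projection1_eqI:
  assumes p: "p \<in> carrier_mat n n"
    and ker: "\<And>\<xi>. \<exists>\<omega> \<in> ker_laplacian1 G X \<alpha> \<beta> l\<^sub>v l\<^sub>e.
       (\<forall>i < n. mapp p \<xi> i = \<omega> (E.rep i)) \<and>
       (\<forall>\<eta> \<in> ker_laplacian1 G X \<alpha> \<beta> l\<^sub>v l\<^sub>e. tinner n (E.eval_lifts \<eta>) (\<lambda>i. \<xi> i - \<omega> (E.rep i)) = 0)"
  shows "kazhdan_projection1 G X \<alpha> \<beta> l\<^sub>v l\<^sub>e es = p"
proof -
  let ?ker = "ker_laplacian1 G X \<alpha> \<beta> l\<^sub>v l\<^sub>e"
  define Q where "Q = (\<lambda>p \<xi> \<omega>. (\<forall>i < n. (\<Sum>j < n. bop_apply (p $$ (i, j)) (\<xi> j)) = \<omega> (E.rep i)) \<and>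
     (\<forall>\<eta> \<in> ?ker. (\<Sum>i < n. cinner (\<eta> (E.rep i)) (\<xi> i - \<omega> (E.rep i))) = 0))"
  have Q: "Q p' \<xi> \<omega> \<longleftrightarrow> (\<forall>i < n. mapp p' \<xi> i = \<omega> (E.rep i)) \<and>
       (\<forall>\<eta> \<in> ?ker. tinner n (E.eval_lifts \<eta>) (\<lambda>i. \<xi> i - \<omega> (E.rep i)) = 0)"
    if "p' \<in> carrier_mat n n" for p' \<xi> \<omega>
    using that by (simp add: Q_def tinner_def mapp_def)
  have "(THE p. p \<in> carrier_mat n n \<and> (\<forall>\<xi>. \<exists>\<omega>\<in>?ker. Q p \<xi> \<omega>)) = p"
  proof (rule the_equality)
    show "p \<in> carrier_mat n n \<and> (\<forall>\<xi>. \<exists>\<omega>\<in>?ker. Q p \<xi> \<omega>)" using p ker Q[OF p] by blast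
    fix p' assume p': "p' \<in> carrier_mat n n \<and> (\<forall>\<xi>. \<exists>\<omega>\<in>?ker. Q p' \<xi> \<omega>)"
    then have p'c: "p' \<in> carrier_mat n n" ..
    show "p' = p"
    proof (rule mapp_eqI[OF p'c p])
      fix \<xi> i assume i: "i < n"
      obtain \<omega> where \<omega>: "\<omega> \<in> ?ker" "\<forall>i < n. mapp p \<xi> i = \<omega> (E.rep i)"
        "\<forall>\<eta> \<in> ?ker. tinner n (E.eval_lifts \<eta>) (\<lambda>i. \<xi> i - \<omega> (E.rep i)) = 0"
        using ker[of \<xi>] by blast
      obtain \<omega>' where \<omega>': "\<omega>' \<in> ?ker" "\<forall>i < n. mapp p' \<xi> i = \<omega>' (E.rep i)"
        "\<forall>\<eta> \<in> ?ker. tinner n (E.eval_lifts \<eta>) (\<lambda>i. \<xi> i - \<omega>' (E.rep i)) = 0"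
        using p' Q[OF p'c] by blast
      let ?\<delta> = "\<lambda>i. \<omega> (E.rep i) - \<omega>' (E.rep i)"
      have "tinner n (E.eval_lifts \<eta>) ?\<delta> = 0" if "\<eta> \<in> ?ker" for \<eta>
        using \<omega>(3) \<omega>'(3) that by (simp add: tinner_diff_right)
      then have "tinner n ?\<delta> ?\<delta> = 0" using \<omega>(1) \<omega>'(1) by (simp add: tinner_diff_left)
      then have "tnorm2 n ?\<delta> = 0" by (simp add: tinner_self)
      from tnorm2_eq_0D[OF this i] show "mapp p' \<xi> i = mapp p \<xi> i" using \<omega>(2) \<omega>'(2) i by simp
    qed
  qed
  then show ?thesis unfolding kazhdan_projection1_def Q_def .
qed

theorem kazhdan_projection_class:
  assumes con: "connected_graph X" and fg: "finitely_generated G" and na: "\<not> amenable G"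
  defines "A \<equiv> reduced_cstar G"
  shows "kazhdan_projection1 G X \<alpha> \<beta> l\<^sub>v l\<^sub>e es \<in> projections A"
    and "K0_class A E.proj_mat
      = K0_class A V.proj_mat \<otimes>\<^bsub>K0 A\<^esub> K0_class A (kazhdan_projection1 G X \<alpha> \<beta> l\<^sub>v l\<^sub>e es)"
proof -
  interpret C: real_cstar A unfolding A_def by (rule real_cstar_reduced_cstar)
  obtain \<epsilon> where eps: "0 < \<epsilon>" "\<And>\<xi>. \<epsilon> * tnorm2 m (mapp V.proj_mat \<xi>) \<le> tnorm2 n (mapp dmat \<xi>)"
    using coboundary_gap[OF con fg na] by blast
  obtain c where c: "0 \<le> c" "\<And>\<xi>. tnorm2 n (mapp dmat \<xi>) \<le> c * tnorm2 m \<xi>"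
    using mapp_bounded[of dmat] dmat_carrier by auto
  have dP: "mapp dmat (mapp V.proj_mat \<xi>) = mapp dmat \<xi>" for \<xi>
    using mapp_mult[of dmat V.proj_mat \<xi>] dmat_carrier V.proj_mat_carrier by (simp add: dmat_proj)
  \<comment> \<open>The factor that turns the differential into a contraction; \<open>c + 1\<close>
    is used because \<open>c\<close> may be 0. As \<open>r\<close> is positive, the kernel of the
    adjoint is unchanged.\<close>
  define r where "r = 1 / sqrt (c + 1)"
  have r: "0 < r" "r\<^sup>2 = 1 / (c + 1)" using c(1) by (auto simp: r_def power_divide)
  define D where "D = map_mat ((*\<^sub>R) r) dmat"
  have D\<xi>: "mapp D \<xi> i = r *\<^sub>R mapp dmat \<xi> i" for \<xi> i by (simp add: D_def mapp_map_mat_scaleR)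
  have D'\<xi>: "mapp (star_mat D) \<xi> i = r *\<^sub>R mapp (star_mat dmat) \<xi> i" for \<xi> i
    by (simp add: D_def star_mat_map_scaleR mapp_map_mat_scaleR)
  have DA: "D \<in> mats_over A n m"
    using dmat_mem[folded A_def] unfolding D_def mats_over_iff by (auto intro!: C.scaleR_mem)
  have Dc: "D \<in> carrier_mat n m" using DA by (simp add: mats_over_iff)
  have DP: "D * V.proj_mat = D"
    unfolding D_def by (simp add: map_mat_scaleR_mult[OF dmat_carrier V.proj_mat_carrier] dmat_proj)
  have ED: "E.proj_mat * D = D"
    unfolding D_def by (simp add: map_mat_scaleR_mult[OF E.proj_mat_carrier dmat_carrier] proj_dmat)
  have tD: "tnorm2 n (mapp D \<xi>) = r\<^sup>2 * tnorm2 n (mapp dmat \<xi>)" for \<xi>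
    unfolding tnorm2_scaleR[symmetric] by (rule tnorm2_cong) (simp add: D\<xi>)
  have low: "\<epsilon> * r\<^sup>2 * tnorm2 m (mapp V.proj_mat \<xi>) \<le> tnorm2 n (mapp D \<xi>)" for \<xi>
    using mult_left_mono[OF eps(2)[of \<xi>], of "r\<^sup>2"] by (simp add: tD mult_ac)
  \<comment> \<open>The bound has to be relative to the vertex projection; this follows from the
    plain norm bound because the differential factors through it.\<close>
  have up: "tnorm2 n (mapp D \<xi>) \<le> tnorm2 m (mapp V.proj_mat \<xi>)" for \<xi>
  proof -
    have "tnorm2 n (mapp D \<xi>) \<le> r\<^sup>2 * (c * tnorm2 m (mapp V.proj_mat \<xi>))"
      unfolding tD using c(2)[of "mapp V.proj_mat \<xi>"] by (intro mult_left_mono) (auto simp: dP)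
    also have "\<dots> = (r\<^sup>2 * c) * tnorm2 m (mapp V.proj_mat \<xi>)" by simp
    also have "\<dots> \<le> 1 * tnorm2 m (mapp V.proj_mat \<xi>)"
      using c(1) by (intro mult_right_mono) (auto simp: r(2))
    finally show ?thesis by simp
  qed
  have "0 < \<epsilon> * r\<^sup>2" using eps(1) r(1) by simp
  then obtain p R where p: "p \<in> projections A" "p \<in> carrier_mat n n" "E.proj_mat * p = p" "star_mat D * p = 0\<^sub>m m n"
    and R: "R \<in> carrier_mat m n" "p = E.proj_mat - D * R"
    and cls: "K0_class A E.proj_mat = K0_class A V.proj_mat \<otimes>\<^bsub>K0 A\<^esub> K0_class A p"
    using C.cokernel_projection[OF V.proj_mat_mem[folded A_def] V.proj_mat_star V.proj_mat_idem
        E.proj_mat_mem[folded A_def] E.proj_mat_star E.proj_mat_idem DA DP ED _ low up] by metis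
  note ker_iff = ker_laplacian1_iff[OF eps]
  have "kazhdan_projection1 G X \<alpha> \<beta> l\<^sub>v l\<^sub>e es = p"
  proof (rule kazhdan_projection1_eqI[OF p(2)])
    fix \<xi>
    \<comment> \<open>As \<open>E.proj_mat * p = p\<close>, the extended cochain takes exactly the
      values \<open>mapp p \<xi>\<close> at the lifts.\<close>
    let ?\<omega> = "E.extend (mapp p \<xi>)"
    have ev: "?\<omega> (E.rep i) = mapp p \<xi> i" if "i < n" for i
    proof -
      have "mapp E.proj_mat (mapp p \<xi>) = mapp p \<xi>"
        using mapp_mult[of E.proj_mat p \<xi>] p E.proj_mat_carrier by simp
      then show ?thesis using that by (simp add: E.eval_extend)
    qed
    have "mapp (star_mat dmat) (E.eval_lifts ?\<omega>) j = 0" for j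
    proof -
      have "mapp (star_mat dmat) (E.eval_lifts ?\<omega>) = mapp (star_mat dmat) (mapp p \<xi>)"
        by (rule mapp_cong) (use dmat_carrier in \<open>simp add: ev\<close>)
      moreover have "r *\<^sub>R mapp (star_mat dmat) (mapp p \<xi>) j = 0"
      proof -
        have "mapp (star_mat D * p) \<xi> = mapp (star_mat D) (mapp p \<xi>)"
          by (rule mapp_mult) (use p(2) Dc in simp)
        then show ?thesis unfolding D'\<xi>[symmetric] p(4) by (metis mapp_zero)
      qed
      ultimately show ?thesis using r(1) by simp
    qed
    then have "?\<omega> \<in> ker_laplacian1 G X \<alpha> \<beta> l\<^sub>v l\<^sub>e" by (simp add: ker_iff E.extend_cochain)
    moreover have "tinner n (E.eval_lifts \<eta>) (\<lambda>i. \<xi> i - ?\<omega> (E.rep i)) = 0"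
      if \<eta>: "\<eta> \<in> ker_laplacian1 G X \<alpha> \<beta> l\<^sub>v l\<^sub>e" for \<eta>
    proof -
      have \<eta>': "\<eta> \<in> C1" "\<And>j. j < m \<Longrightarrow> mapp (star_mat dmat) (E.eval_lifts \<eta>) j = 0"
        using \<eta> by (auto simp: ker_iff)
      \<comment> \<open>The error \<open>\<xi> - p \<xi>\<close> splits into
        \<open>\<xi> - E \<xi>\<close> and \<open>D R \<xi>\<close>. A kernel element is fixed by
        \<open>E\<close>, hence orthogonal to the first, and annihilated by the adjoint of
        \<open>D\<close>, hence orthogonal to the second.\<close>
      have 1: "tinner n (E.eval_lifts \<eta>) (mapp E.proj_mat \<xi>) = tinner n (E.eval_lifts \<eta>) \<xi>"
        using tinner_mapp[OF E.proj_mat_carrier, of "E.eval_lifts \<eta>" \<xi>]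
          tinner_cong[of n "mapp E.proj_mat (E.eval_lifts \<eta>)" "E.eval_lifts \<eta>" \<xi> \<xi>]
        by (simp add: E.proj_mat_star E.mapp_proj_eval[OF \<eta>'(1)])
      have "tinner n (E.eval_lifts \<eta>) (mapp (D * R) \<xi>) = tinner n (E.eval_lifts \<eta>) (mapp D (mapp R \<xi>))"
        using R(1) Dc by (subst mapp_mult) auto
      also have "\<dots> = tinner m (mapp (star_mat D) (E.eval_lifts \<eta>)) (mapp R \<xi>)"
        using tinner_mapp[OF star_mat_carrier[OF Dc], of "E.eval_lifts \<eta>" "mapp R \<xi>"] by simp
      also have "\<dots> = 0" by (simp add: tinner_def D'\<xi> \<eta>'(2))
      finally have 2: "tinner n (E.eval_lifts \<eta>) (mapp (D * R) \<xi>) = 0" .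
      have p\<xi>: "mapp p \<xi> i = mapp E.proj_mat \<xi> i - mapp (D * R) \<xi> i" for i
        unfolding R(2) by (rule mapp_diff[OF E.proj_mat_carrier mult_carrier_mat[OF Dc R(1)]])
      have "tinner n (E.eval_lifts \<eta>) (\<lambda>i. \<xi> i - ?\<omega> (E.rep i))
          = tinner n (E.eval_lifts \<eta>) (\<lambda>i. \<xi> i - (mapp E.proj_mat \<xi> i - mapp (D * R) \<xi> i))"
        by (rule tinner_cong) (simp_all add: ev p\<xi>)
      then show ?thesis by (simp add: tinner_diff_right 1 2)
    qed
    ultimately show "\<exists>\<omega> \<in> ker_laplacian1 G X \<alpha> \<beta> l\<^sub>v l\<^sub>e. (\<forall>i < n. mapp p \<xi> i = \<omega> (E.rep i)) \<and>
       (\<forall>\<eta> \<in> ker_laplacian1 G X \<alpha> \<beta> l\<^sub>v l\<^sub>e. tinner n (E.eval_lifts \<eta>) (\<lambda>i. \<xi> i - \<omega> (E.rep i)) = 0)"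
      using ev by (intro bexI[of _ ?\<omega>]) simp_all
  qed
  then show "kazhdan_projection1 G X \<alpha> \<beta> l\<^sub>v l\<^sub>e es \<in> projections A"
    "K0_class A E.proj_mat = K0_class A V.proj_mat \<otimes>\<^bsub>K0 A\<^esub> K0_class A (kazhdan_projection1 G X \<alpha> \<beta> l\<^sub>v l\<^sub>e es)"
    using p(1) cls by simp_all
qed

end

section \<open>Connectedness of equivariant graphs\<close>

definition linked :: "('v, 'e) pre_digraph \<Rightarrow> 'v \<Rightarrow> 'v \<Rightarrow> bool" where
  "linked X u v \<longleftrightarrow> (\<exists>w. gwalk X u w v)"

lemma gwalk_append: "gwalk X u w v \<Longrightarrow> gwalk X v w' x \<Longrightarrow> gwalk X u (w @ w') x"
  by (induction w arbitrary: u) auto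

lemma linked_trans: "linked X u v \<Longrightarrow> linked X v x \<Longrightarrow> linked X u x"
  unfolding linked_def using gwalk_append by metis

lemma linked_self: "u \<in> verts X \<Longrightarrow> linked X u u"
  unfolding linked_def by (rule exI[of _ "[]"]) simp

context equivariant_graph
begin

lemma gwalk_sym: "gwalk X u w v \<Longrightarrow> u \<in> verts X \<Longrightarrow> \<exists>w'. gwalk X v w' u"
proof (induction w arbitrary: u)
  case Nil
  then show ?case by (intro exI[of _ "[]"]) simp
next
  case (Cons a w)
  obtain e s where a: "a = (e, s)" by (cases a)
  let ?u' = "if s then head X e else tail X e"
  have w: "e \<in> arcs X" "u = (if s then tail X e else head X e)" "gwalk X ?u' w v"
    using Cons.prems by (auto simp: a)
  have "?u' \<in> verts X" using w(1) ends by auto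
  then obtain w' where w': "gwalk X v w' ?u'" using Cons.IH[OF w(3)] by blast
  have "gwalk X ?u' [(e, \<not> s)] u" using w Cons.prems(2) by auto
  from gwalk_append[OF w' this] show ?case by blast
qed

lemma linked_sym: "linked X u v \<Longrightarrow> u \<in> verts X \<Longrightarrow> linked X v u"
  unfolding linked_def using gwalk_sym by blast

lemma gwalk_act:
  assumes g: "g \<in> carrier G"
  shows "gwalk X u w v \<Longrightarrow> u \<in> verts X \<Longrightarrow> gwalk X (\<alpha> g u) (map (\<lambda>(e, s). (\<beta> g e, s)) w) (\<alpha> g v)"
proof (induction w arbitrary: u)
  case Nil
  then show ?case using g V.act_closed by simp
next
  case (Cons a w)
  obtain e s where a: "a = (e, s)" by (cases a)
  show ?case using Cons.prems Cons.IH g by (cases s) (auto simp: a equivariant E.act_closed ends)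
qed

lemma linked_act: "g \<in> carrier G \<Longrightarrow> linked X u v \<Longrightarrow> u \<in> verts X \<Longrightarrow> linked X (\<alpha> g u) (\<alpha> g v)"
  unfolding linked_def using gwalk_act by blast

lemma linked_arc: "e \<in> arcs X \<Longrightarrow> linked X (tail X e) (head X e)"
  unfolding linked_def by (rule exI[of _ "[(e, True)]"]) (simp add: ends)

end

section \<open>Actions on coset spaces\<close>

context group
begin

text \<open>The disjoint union of the sets G / H c: the index keeps cosets apart that coincide as
  sets.\<close>

definition coset_space :: "'c set \<Rightarrow> ('c \<Rightarrow> 'a set) \<Rightarrow> ('c \<times> 'a set) set" where
  "coset_space I H = {(c, g <#\<^bsub>G\<^esub> H c) | c g. c \<in> I \<and> g \<in> carrier G}"

lemma coset_spaceI: "c \<in> I \<Longrightarrow> g \<in> carrier G \<Longrightarrow> (c, g <#\<^bsub>G\<^esub> H c) \<in> coset_space I H"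
  by (auto simp: coset_space_def)

lemma coset_action_coset:
  assumes "c \<in> I" "g \<in> carrier G" "h \<in> carrier G" "H c \<subseteq> carrier G"
  shows "coset_action G (coset_space I H) g (c, h <#\<^bsub>G\<^esub> H c) = (c, (g \<otimes> h) <#\<^bsub>G\<^esub> H c)"
  using assms coset_spaceI[OF assms(1,3), of H] by (simp add: coset_action_def lcos_m_assoc)

text \<open>The stabiliser of the coset of \<open>h\<close> is contained in the conjugate of
  \<open>H c\<close> by \<open>h\<close>, hence finite.\<close>

lemma lifted_action_coset_space:
  assumes H: "\<And>c. c \<in> I \<Longrightarrow> subgroup (H c) G" "\<And>c. c \<in> I \<Longrightarrow> finite (H c)"
    and l: "orbit_lift G (coset_space I H) (coset_action G (coset_space I H)) l"
    and rs: "distinct rs" "set rs = orbits G (coset_space I H) (coset_action G (coset_space I H))"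
  shows "lifted_action G (coset_space I H) (coset_action G (coset_space I H)) l rs"
proof
  let ?S = "coset_space I H" let ?\<alpha> = "coset_action G ?S"
  have HG: "H c \<subseteq> carrier G" if "c \<in> I" for c using subgroup.subset[OF H(1)[OF that]] .
  fix x assume "x \<in> ?S"
  then obtain c h where c: "c \<in> I" and h: "h \<in> carrier G" and x: "x = (c, h <#\<^bsub>G\<^esub> H c)"
    by (auto simp: coset_space_def)
  note act = coset_action_coset[where H = H, OF c _ _ HG[OF c]]
  show "?\<alpha> \<one> x = x" using h by (simp add: x act)
  show "finite (stabilizer G ?\<alpha> x)"
  proof (rule finite_subset)
    show "stabilizer G ?\<alpha> x \<subseteq> (\<lambda>k. h \<otimes> k \<otimes> inv h) ` H c"
    proof
      fix g assume "g \<in> stabilizer G ?\<alpha> x"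
      then have g: "g \<in> carrier G" "(g \<otimes> h) <#\<^bsub>G\<^esub> H c = h <#\<^bsub>G\<^esub> H c"
        using h by (auto simp: stabilizer_def x act)
      have "g \<otimes> h \<otimes> \<one> \<in> (g \<otimes> h) <#\<^bsub>G\<^esub> H c"
        unfolding l_coset_def using subgroup.one_closed[OF H(1)[OF c]] by blast
      then obtain k where k: "k \<in> H c" "g \<otimes> h = h \<otimes> k"
        using g h unfolding g(2) by (auto simp: l_coset_def)
      have "g = (g \<otimes> h) \<otimes> inv h" using g h by (simp add: m_assoc)
      then show "g \<in> (\<lambda>k. h \<otimes> k \<otimes> inv h) ` H c" unfolding k(2) using k(1) by blast
    qed
    show "finite ((\<lambda>k. h \<otimes> k \<otimes> inv h) ` H c)" using H(2)[OF c] by simp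
  qed
  fix g assume g: "g \<in> carrier G"
  show "?\<alpha> g x \<in> ?S" using g h c by (simp add: x act coset_spaceI)
  fix g' assume g': "g' \<in> carrier G"
  show "?\<alpha> (g \<otimes> g') x = ?\<alpha> g (?\<alpha> g' x)" using g g' h by (simp add: x act m_assoc)
qed (use l rs in auto)

text \<open>The group acts transitively on each G / H c, so every orbit is determined by its
  index.\<close>

lemma finite_orbits_coset_space:
  assumes "finite I" and H: "\<And>c. c \<in> I \<Longrightarrow> H c \<subseteq> carrier G"
  shows "finite (orbits G (coset_space I H) (coset_action G (coset_space I H)))"
proof (rule finite_subset)
  let ?S = "coset_space I H" let ?\<alpha> = "coset_action G ?S"
  show "orbits G ?S ?\<alpha> \<subseteq> (\<lambda>c. {(c, g <#\<^bsub>G\<^esub> H c) | g. g \<in> carrier G}) ` I"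
  proof
    fix R assume "R \<in> orbits G ?S ?\<alpha>"
    then obtain c h where c: "c \<in> I" and h: "h \<in> carrier G" and R: "R = orbit G ?\<alpha> (c, h <#\<^bsub>G\<^esub> H c)"
      by (auto simp: coset_space_def orbits_def)
    note act = coset_action_coset[where H = H, OF c _ h H[OF c]]
    have "R = {(c, (g \<otimes> h) <#\<^bsub>G\<^esub> H c) | g. g \<in> carrier G}"
      unfolding R orbit_def using act by (metis (no_types, lifting))
    also have "\<dots> = {(c, g <#\<^bsub>G\<^esub> H c) | g. g \<in> carrier G}"
    proof -
      have "\<exists>g'. g = g' \<otimes> h \<and> g' \<in> carrier G" if "g \<in> carrier G" for g
        using that h by (intro exI[of _ "g \<otimes> inv h"]) (simp add: m_assoc)
      then show ?thesis using h by blast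
    qed
    finally show "R \<in> (\<lambda>c. {(c, g <#\<^bsub>G\<^esub> H c) | g. g \<in> carrier G}) ` I" using c by blast
  qed
qed (use assms in simp)

end

section \<open>The Bass--Serre tree as an equivariant graph\<close>

locale bass_serre = group G for G :: "('g, 'b) monoid_scheme" (structure) +
  fixes Y :: "('v, 'e, 'h, 'k) graph_of_groups" and T :: "'e set"
    and \<psi> :: "('v, 'e, 'h) letter list set \<Rightarrow> 'g"
  assumes gog: "finite_graph_of_finite_groups Y" and tree: "maximal_tree (base Y) T"
    and iso: "\<psi> \<in> iso (fundamental_group Y T) G"
begin

section \<open>Words and the group elements they represent\<close>

abbreviation "words \<equiv> lists (letters Y)"

definition elt :: "('v, 'e, 'h) letter list \<Rightarrow> 'g" where
  "elt w = \<psi> (word_class Y T w)"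

lemma gog_facts:
  shows "fin_digraph (base Y)" "connected_graph (base Y)"
    and "v \<in> verts (base Y) \<Longrightarrow> group (vgroup Y v)" "v \<in> verts (base Y) \<Longrightarrow> finite (carrier (vgroup Y v))"
    and "e \<in> arcs (base Y) \<Longrightarrow> group (egroup Y e)" "e \<in> arcs (base Y) \<Longrightarrow> finite (carrier (egroup Y e))"
    and "e \<in> arcs (base Y) \<Longrightarrow> tail_emb Y e \<in> hom (egroup Y e) (vgroup Y (tail (base Y) e))"
    and "e \<in> arcs (base Y) \<Longrightarrow> head_emb Y e \<in> hom (egroup Y e) (vgroup Y (head (base Y) e))"
  using gog by (auto simp: finite_graph_of_finite_groups_def mon_def)

lemma base_ends: "e \<in> arcs (base Y) \<Longrightarrow> tail (base Y) e \<in> verts (base Y)"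
  "e \<in> arcs (base Y) \<Longrightarrow> head (base Y) e \<in> verts (base Y)"
  using gog_facts(1) by (auto simp: fin_digraph_def wf_digraph_def)

lemma emb_closed:
  "e \<in> arcs (base Y) \<Longrightarrow> a \<in> carrier (egroup Y e) \<Longrightarrow> tail_emb Y e a \<in> carrier (vgroup Y (tail (base Y) e))"
  "e \<in> arcs (base Y) \<Longrightarrow> a \<in> carrier (egroup Y e) \<Longrightarrow> head_emb Y e a \<in> carrier (vgroup Y (head (base Y) e))"
  by (erule gog_facts(7,8)[THEN hom_in_carrier]; assumption)+

lemma Vert_letter: "v \<in> verts (base Y) \<Longrightarrow> a \<in> carrier (vgroup Y v) \<Longrightarrow> Vert v a \<in> letters Y"
  by (auto simp: letters_def)

lemma Edge_letter: "e \<in> arcs (base Y) \<Longrightarrow> Edge e \<in> letters Y" "e \<in> arcs (base Y) \<Longrightarrow> Edge_inv e \<in> letters Y"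
  by (auto simp: letters_def)

lemma gog_cong_words: "gog_cong Y T w w' \<Longrightarrow> w \<in> words \<and> w' \<in> words"
proof (induction rule: gog_cong.induct)
  case (vert_one v)
  then show ?case using gog_facts(3)[of v] by (auto intro: Vert_letter group.is_monoid monoid.one_closed)
next
  case (vert_mult v a b)
  then show ?case using gog_facts(3)[of v] by (auto intro!: Vert_letter monoid.m_closed group.is_monoid)
next
  case (edge_conj e a)
  then show ?case by (auto intro!: Vert_letter Edge_letter base_ends emb_closed)
qed (auto intro: Edge_letter)

lemma word_class_eqI: "gog_cong Y T w w' \<Longrightarrow> word_class Y T w = word_class Y T w'"
  unfolding word_class_def using gog_cong.sym gog_cong.trans by blast

lemma elt_cong: "gog_cong Y T w w' \<Longrightarrow> elt w = elt w'"
  by (simp add: elt_def word_class_eqI)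

text \<open>The product is a union over representatives; replacing first the left factor and then
  the right one inside the concatenation shows that all its terms agree.\<close>

lemma word_class_mult:
  assumes w: "w \<in> words" and w': "w' \<in> words"
  shows "word_class Y T w \<otimes>\<^bsub>fundamental_group Y T\<^esub> word_class Y T w' = word_class Y T (w @ w')"
proof -
  have "word_class Y T (a @ b) = word_class Y T (w @ w')"
    if a: "a \<in> word_class Y T w" and b: "b \<in> word_class Y T w'" for a b
  proof -
    have ca: "gog_cong Y T w a" and cb: "gog_cong Y T w' b" using a b by (auto simp: word_class_def)
    have aw: "a \<in> words" using gog_cong_words[OF ca] by simp
    have "gog_cong Y T (w @ w') (a @ w')" using gog_cong.context_closed[OF ca, of "[]" w'] w' by simp
    moreover have "gog_cong Y T (a @ w') (a @ b)" using gog_cong.context_closed[OF cb aw, of "[]"] by simp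
    ultimately show ?thesis by (metis word_class_eqI)
  qed
  then have "(\<Union>a\<in>word_class Y T w. \<Union>b\<in>word_class Y T w'. word_class Y T (a @ b))
      = (\<Union>a\<in>word_class Y T w. \<Union>b\<in>word_class Y T w'. word_class Y T (w @ w'))"
    by (intro SUP_cong HOL.refl)
  moreover have "w \<in> word_class Y T w" "w' \<in> word_class Y T w'"
    using w w' by (auto simp: word_class_def intro: gog_cong.refl)
  then have "word_class Y T w \<noteq> {}" "word_class Y T w' \<noteq> {}" by blast+
  ultimately show ?thesis by (simp add: fundamental_group_def)
qed

lemma psi: "\<psi> \<in> hom (fundamental_group Y T) G"
  "bij_betw \<psi> (carrier (fundamental_group Y T)) (carrier G)"
  using iso by (auto simp: iso_def)

lemma word_class_carrier: "w \<in> words \<Longrightarrow> word_class Y T w \<in> carrier (fundamental_group Y T)"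
  by (auto simp: fundamental_group_def)

lemma elt_closed: "w \<in> words \<Longrightarrow> elt w \<in> carrier G"
  using psi(1) word_class_carrier by (auto simp: elt_def hom_def)

lemma elt_append: "w \<in> words \<Longrightarrow> w' \<in> words \<Longrightarrow> elt (w @ w') = elt w \<otimes> elt w'"
  unfolding elt_def word_class_mult[symmetric]
  by (rule hom_mult[OF psi(1)]) (auto intro: word_class_carrier)

lemma elt_Nil: "elt [] = \<one>"
  using elt_append[of "[]" "[]"] elt_closed[of "[]"] by (simp add: l_cancel_one')

lemma elt_surj:
  assumes "g \<in> carrier G"
  obtains w where "w \<in> words" "g = elt w"
proof -
  have "g \<in> \<psi> ` carrier (fundamental_group Y T)" using psi(2) assms by (simp add: bij_betw_def)
  then show ?thesis using that by (auto simp: fundamental_group_def elt_def)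
qed

abbreviation "vsub \<equiv> vsubgroup Y T \<psi>"
abbreviation "esub \<equiv> esubgroup Y T \<psi>"
abbreviation "stab_letter \<equiv> stable_letter Y T \<psi>"

section \<open>Vertex groups, edge groups and stable letters inside \<open>G\<close>\<close>

lemma vsub_eq: "vsub v = (\<lambda>a. elt [Vert v a]) ` carrier (vgroup Y v)"
  by (simp add: vsubgroup_def elt_def)

lemma esub_eq: "esub e = (\<lambda>a. elt [Vert (tail (base Y) e) (tail_emb Y e a)]) ` carrier (egroup Y e)"
  by (simp add: esubgroup_def elt_def)

lemma stab_letter_eq: "stab_letter e = elt [Edge e]"
  by (simp add: stable_letter_def elt_def)

lemma elt_Vert_hom:
  assumes "v \<in> verts (base Y)"
  shows "(\<lambda>a. elt [Vert v a]) \<in> hom (vgroup Y v) G"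
proof (rule homI)
  fix a b assume ab: "a \<in> carrier (vgroup Y v)" "b \<in> carrier (vgroup Y v)"
  show "elt [Vert v a] \<in> carrier G" using assms ab by (intro elt_closed) (simp add: Vert_letter)
  have "elt [Vert v (a \<otimes>\<^bsub>vgroup Y v\<^esub> b)] = elt ([Vert v a] @ [Vert v b])"
    using elt_cong[OF gog_cong.vert_mult[OF assms ab]] by simp
  also have "\<dots> = elt [Vert v a] \<otimes> elt [Vert v b]"
    using assms ab by (intro elt_append) (simp_all add: Vert_letter)
  finally show "elt [Vert v (a \<otimes>\<^bsub>vgroup Y v\<^esub> b)] = elt [Vert v a] \<otimes> elt [Vert v b]" .
qed

lemma vsub_subgroup:
  assumes v: "v \<in> verts (base Y)"
  shows "subgroup (vsub v) G"
proof -
  interpret group_hom "vgroup Y v" G "\<lambda>a. elt [Vert v a]"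
    using elt_Vert_hom[OF v] gog_facts(3)[OF v] group_axioms
    by (simp add: group_hom_def group_hom_axioms_def)
  show ?thesis unfolding vsub_eq by (rule img_is_subgroup)
qed

lemma esub_subgroup:
  assumes e: "e \<in> arcs (base Y)"
  shows "subgroup (esub e) G"
proof -
  have "(\<lambda>a. elt [Vert (tail (base Y) e) a]) \<circ> tail_emb Y e \<in> hom (egroup Y e) G"
    by (rule Group.hom_compose[OF gog_facts(7)[OF e] elt_Vert_hom[OF base_ends(1)[OF e]]])
  then interpret group_hom "egroup Y e" G "(\<lambda>a. elt [Vert (tail (base Y) e) a]) \<circ> tail_emb Y e"
    using gog_facts(5)[OF e] group_axioms by (simp add: group_hom_def group_hom_axioms_def)
  show ?thesis using img_is_subgroup unfolding esub_eq by (simp add: o_def)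
qed

lemma esub_vsub: "e \<in> arcs (base Y) \<Longrightarrow> esub e \<subseteq> vsub (tail (base Y) e)"
  by (auto simp: esub_eq vsub_eq emb_closed)

lemma vsub_finite: "v \<in> verts (base Y) \<Longrightarrow> finite (vsub v)"
  by (simp add: vsub_eq gog_facts(4))

lemma esub_finite: "e \<in> arcs (base Y) \<Longrightarrow> finite (esub e)"
  by (simp add: esub_eq gog_facts(6))

lemma stab_letter_closed: "e \<in> arcs (base Y) \<Longrightarrow> stab_letter e \<in> carrier G"
  unfolding stab_letter_eq by (intro elt_closed) (simp add: Edge_letter)

lemma stab_letter_inv: 
  assumes e: "e \<in> arcs (base Y)"
  shows "elt [Edge_inv e] = inv (stab_letter e)"
proof -
  have w: "[Edge e] \<in> words" "[Edge_inv e] \<in> words" using e by (simp_all add: Edge_letter)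
  have "stab_letter e \<otimes> elt [Edge_inv e] = \<one>"
    using elt_append[OF w] elt_cong[OF gog_cong.edge_right_inv[OF e]] by (simp add: stab_letter_eq elt_Nil)
  then show ?thesis using inv_solve_left'[of "stab_letter e" \<one> "elt [Edge_inv e]"]
    inv_equality[of "elt [Edge_inv e]" "stab_letter e"] elt_closed w stab_letter_closed[OF e]
    by (metis inv_comm inv_inv)
qed

text \<open>The conjugation relation of the fundamental group, read as moving an edge group element
  from left to right past the stable letter. It makes the head of an arc independent of the coset
  representative.\<close>

lemma esub_conj:
  assumes e: "e \<in> arcs (base Y)" and k: "k \<in> esub e"
  obtains h where "h \<in> vsub (head (base Y) e)" "k \<otimes> stab_letter e = stab_letter e \<otimes> h"
proof -
  obtain a where a: "a \<in> carrier (egroup Y e)" "k = elt [Vert (tail (base Y) e) (tail_emb Y e a)]"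
    using k by (auto simp: esub_eq)
  let ?h = "elt [Vert (head (base Y) e) (head_emb Y e a)]"
  have hl: "Vert (head (base Y) e) (head_emb Y e a) \<in> letters Y"
    using e a by (intro Vert_letter base_ends emb_closed)
  have h: "?h \<in> carrier G" using hl by (intro elt_closed) simp
  have "k = elt ([Edge e] @ [Vert (head (base Y) e) (head_emb Y e a)] @ [Edge_inv e])"
    using elt_cong[OF gog_cong.edge_conj[OF e a(1)]] a(2) by simp
  also have "\<dots> = stab_letter e \<otimes> (?h \<otimes> inv (stab_letter e))"
    using hl e by (subst elt_append, simp_all add: Edge_letter)
      (subst elt_append[of "[_]" "[_]", simplified], simp_all add: Edge_letter stab_letter_eq[symmetric] stab_letter_inv)
  finally have "k \<otimes> stab_letter e = stab_letter e \<otimes> ?h"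
    using stab_letter_closed[OF e] h by (simp add: m_assoc)
  moreover have "?h \<in> vsub (head (base Y) e)" using emb_closed(2)[OF e a(1)] by (auto simp: vsub_eq)
  ultimately show ?thesis by (rule that[rotated])
qed

text \<open>The edge group is embedded into the vertex group at the tail, which absorbs it.\<close>

lemma coset_tail:
  assumes e: "e \<in> arcs (base Y)" and g: "g \<in> carrier G"
  shows "(g <#\<^bsub>G\<^esub> esub e) <#>\<^bsub>G\<^esub> vsub (tail (base Y) e) = g <#\<^bsub>G\<^esub> vsub (tail (base Y) e)"
proof -
  let ?V = "vsub (tail (base Y) e)"
  have V: "subgroup ?V G" by (rule vsub_subgroup[OF base_ends(1)[OF e]])
  have VG: "x \<in> carrier G" if "x \<in> ?V" for x using subgroup.mem_carrier[OF V that] .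
  show ?thesis
  proof
    show "(g <#\<^bsub>G\<^esub> esub e) <#>\<^bsub>G\<^esub> ?V \<subseteq> g <#\<^bsub>G\<^esub> ?V"
    proof
      fix x assume "x \<in> (g <#\<^bsub>G\<^esub> esub e) <#>\<^bsub>G\<^esub> ?V"
      then obtain k y where k: "k \<in> esub e" "y \<in> ?V" "x = g \<otimes> k \<otimes> y"
        by (auto simp: set_mult_def l_coset_def)
      have kV: "k \<in> ?V" using k(1) esub_vsub[OF e] by blast
      have "x = g \<otimes> (k \<otimes> y)" using k kV VG g by (simp add: m_assoc)
      then show "x \<in> g <#\<^bsub>G\<^esub> ?V" using subgroup.m_closed[OF V kV k(2)] by (auto simp: l_coset_def)
    qed
    show "g <#\<^bsub>G\<^esub> ?V \<subseteq> (g <#\<^bsub>G\<^esub> esub e) <#>\<^bsub>G\<^esub> ?V"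
    proof
      fix x assume "x \<in> g <#\<^bsub>G\<^esub> ?V"
      then obtain y where y: "y \<in> ?V" "x = g \<otimes> \<one> \<otimes> y" using g by (auto simp: l_coset_def)
      then show "x \<in> (g <#\<^bsub>G\<^esub> esub e) <#>\<^bsub>G\<^esub> ?V"
        unfolding set_mult_def l_coset_def using subgroup.one_closed[OF esub_subgroup[OF e]] by blast
    qed
  qed
qed

text \<open>The edge group is absorbed only after \<open>esub_conj\<close> has moved it past the
  stable letter into the vertex group at the head.\<close>

lemma coset_head:
  assumes e: "e \<in> arcs (base Y)" and g: "g \<in> carrier G"
  shows "((g <#\<^bsub>G\<^esub> esub e) #>\<^bsub>G\<^esub> stab_letter e) <#>\<^bsub>G\<^esub> vsub (head (base Y) e)
    = (g \<otimes> stab_letter e) <#\<^bsub>G\<^esub> vsub (head (base Y) e)"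
proof -
  let ?V = "vsub (head (base Y) e)" and ?t = "stab_letter e"
  have V: "subgroup ?V G" by (rule vsub_subgroup[OF base_ends(2)[OF e]])
  have VG: "x \<in> carrier G" if "x \<in> ?V" for x using subgroup.mem_carrier[OF V that] .
  have EG: "x \<in> carrier G" if "x \<in> esub e" for x using subgroup.mem_carrier[OF esub_subgroup[OF e] that] .
  have t: "?t \<in> carrier G" by (rule stab_letter_closed[OF e])
  show ?thesis
  proof
    show "((g <#\<^bsub>G\<^esub> esub e) #>\<^bsub>G\<^esub> ?t) <#>\<^bsub>G\<^esub> ?V \<subseteq> (g \<otimes> ?t) <#\<^bsub>G\<^esub> ?V"
    proof
      fix x assume "x \<in> ((g <#\<^bsub>G\<^esub> esub e) #>\<^bsub>G\<^esub> ?t) <#>\<^bsub>G\<^esub> ?V"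
      then obtain k y where k: "k \<in> esub e" "y \<in> ?V" "x = g \<otimes> k \<otimes> ?t \<otimes> y"
        by (auto simp: set_mult_def l_coset_def r_coset_def)
      obtain h where h: "h \<in> ?V" "k \<otimes> ?t = ?t \<otimes> h" using esub_conj[OF e k(1)] .
      have "x = g \<otimes> (k \<otimes> ?t) \<otimes> y" using k EG VG g t by (simp add: m_assoc)
      also have "\<dots> = g \<otimes> ?t \<otimes> (h \<otimes> y)" unfolding h(2) using k h VG g t by (simp add: m_assoc)
      finally show "x \<in> (g \<otimes> ?t) <#\<^bsub>G\<^esub> ?V" using subgroup.m_closed[OF V h(1) k(2)] by (auto simp: l_coset_def)
    qed
    show "(g \<otimes> ?t) <#\<^bsub>G\<^esub> ?V \<subseteq> ((g <#\<^bsub>G\<^esub> esub e) #>\<^bsub>G\<^esub> ?t) <#>\<^bsub>G\<^esub> ?V"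
    proof
      fix x assume "x \<in> (g \<otimes> ?t) <#\<^bsub>G\<^esub> ?V"
      then obtain y where y: "y \<in> ?V" "x = g \<otimes> \<one> \<otimes> ?t \<otimes> y" using g by (auto simp: l_coset_def)
      then show "x \<in> ((g <#\<^bsub>G\<^esub> esub e) #>\<^bsub>G\<^esub> ?t) <#>\<^bsub>G\<^esub> ?V"
        unfolding set_mult_def l_coset_def r_coset_def
        using subgroup.one_closed[OF esub_subgroup[OF e]] by blast
    qed
  qed
qed

section \<open>The ends of the arcs and the action on the tree\<close>

abbreviation "X \<equiv> bass_serre_tree G Y T \<psi>"

lemma tree_sets: "verts X = coset_space (verts (base Y)) vsub" "arcs X = coset_space (arcs (base Y)) esub"
  by (auto simp: bass_serre_tree_def coset_space_def)

lemma tree_ends: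
  assumes "e \<in> arcs (base Y)" "g \<in> carrier G"
  shows "tail X (e, g <#\<^bsub>G\<^esub> esub e) = (tail (base Y) e, g <#\<^bsub>G\<^esub> vsub (tail (base Y) e))"
    "head X (e, g <#\<^bsub>G\<^esub> esub e) = (head (base Y) e, (g \<otimes> stab_letter e) <#\<^bsub>G\<^esub> vsub (head (base Y) e))"
  using assms by (simp_all add: bass_serre_tree_def coset_tail coset_head)

abbreviation "vact \<equiv> coset_action G (verts X)"
abbreviation "eact \<equiv> coset_action G (arcs X)"

lemma vact_coset:
  "v \<in> verts (base Y) \<Longrightarrow> g \<in> carrier G \<Longrightarrow> h \<in> carrier G \<Longrightarrow>
    vact g (v, h <#\<^bsub>G\<^esub> vsub v) = (v, (g \<otimes> h) <#\<^bsub>G\<^esub> vsub v)"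
  unfolding tree_sets by (rule coset_action_coset) (auto dest: subgroup.mem_carrier[OF vsub_subgroup])

lemma eact_coset:
  "e \<in> arcs (base Y) \<Longrightarrow> g \<in> carrier G \<Longrightarrow> h \<in> carrier G \<Longrightarrow>
    eact g (e, h <#\<^bsub>G\<^esub> esub e) = (e, (g \<otimes> h) <#\<^bsub>G\<^esub> esub e)"
  unfolding tree_sets by (rule coset_action_coset) (auto dest: subgroup.mem_carrier[OF esub_subgroup])

text \<open>The ends of an arc arise from right multiplication by vertex groups and stable letters,
  which commutes with left translation.\<close>

lemma equivariant_tree:
  assumes "orbit_lift G (verts X) vact l\<^sub>v" "orbit_lift G (arcs X) eact l\<^sub>e"
    and "distinct vs" "set vs = orbits G (verts X) vact" "distinct es" "set es = orbits G (arcs X) eact"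
  shows "equivariant_graph G X vact l\<^sub>v vs eact l\<^sub>e es"
proof -
  interpret V: lifted_action G "verts X" vact l\<^sub>v vs
    using assms unfolding tree_sets by (intro lifted_action_coset_space vsub_subgroup vsub_finite)
  interpret E: lifted_action G "arcs X" eact l\<^sub>e es
    using assms unfolding tree_sets by (intro lifted_action_coset_space esub_subgroup esub_finite)
  show ?thesis
  proof
    fix x assume "x \<in> arcs X"
    then obtain e h where e: "e \<in> arcs (base Y)" and h: "h \<in> carrier G" and x: "x = (e, h <#\<^bsub>G\<^esub> esub e)"
      unfolding tree_sets by (auto simp: coset_space_def)
    note te = tree_ends[OF e] and be = base_ends[OF e] and t = stab_letter_closed[OF e]
    show "head X x \<in> verts X" "tail X x \<in> verts X"
      unfolding tree_sets using h be t by (simp_all add: x te coset_spaceI)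
    fix g assume g: "g \<in> carrier G"
    show "head X (eact g x) = vact g (head X x)" "tail X (eact g x) = vact g (tail X x)"
      using g h t be by (simp_all add: x eact_coset[OF e] te vact_coset m_assoc)
  qed
qed

text \<open>The cosets of the identity are connected through a copy of the maximal tree. The group
  elements that keep a base vertex in its component form a subgroup containing all letters, hence
  everything.\<close>

lemma connected_tree:
  assumes eq: "equivariant_graph G X vact l\<^sub>v vs eact l\<^sub>e es"
  shows "connected_graph X"
proof -
  interpret equivariant_graph G X vact l\<^sub>v vs eact l\<^sub>e es by (rule eq)
  define b where "b = (\<lambda>v. (v, \<one> <#\<^bsub>G\<^esub> vsub v))"
  have bX: "b v \<in> verts X" if "v \<in> verts (base Y)" for v
    unfolding tree_sets b_def using that by (simp add: coset_spaceI)
  have act_b: "vact g (b v) = (v, g <#\<^bsub>G\<^esub> vsub v)" if "v \<in> verts (base Y)" "g \<in> carrier G" for g v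
    unfolding b_def using that by (simp add: vact_coset)
  have edge: "linked X (b (tail (base Y) e)) (vact (stab_letter e) (b (head (base Y) e)))"
    if e: "e \<in> arcs (base Y)" for e
    using linked_arc[of "(e, \<one> <#\<^bsub>G\<^esub> esub e)"] coset_spaceI[OF e one_closed, of esub]
      tree_ends[OF e one_closed] stab_letter_closed[OF e] act_b[OF base_ends(2)[OF e]]
    unfolding tree_sets(2) by (simp add: b_def)
  have T: "T \<subseteq> arcs (base Y)" "connected_graph (base Y\<lparr>arcs := T\<rparr>)"
    using tree by (auto simp: maximal_tree_def tree_graph_def)
  \<comment> \<open>Stable letters of tree edges are trivial, so the arc over such an edge at the
    identity coset joins two of the vertices \<open>b v\<close> directly.\<close>
  have tree_edge: "linked X (b (tail (base Y) e)) (b (head (base Y) e))" if "e \<in> T" for e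
  proof -
    have e: "e \<in> arcs (base Y)" using that T by blast
    have "stab_letter e = \<one>"
      using elt_cong[OF gog_cong.tree_edge[OF that e]] by (simp add: stab_letter_eq elt_Nil)
    then show ?thesis using edge[OF e] act_b[OF base_ends(2)[OF e]] by (simp add: b_def)
  qed
  have walk: "gwalk (base Y\<lparr>arcs := T\<rparr>) u w v \<Longrightarrow> linked X (b u) (b v)" for u w v
  proof (induction w arbitrary: u)
    case Nil
    then show ?case using linked_self[OF bX] by auto
  next
    case (Cons a w)
    obtain e s where a: "a = (e, s)" by (cases a)
    let ?u' = "if s then head (base Y) e else tail (base Y) e"
    have w: "e \<in> T" "u = (if s then tail (base Y) e else head (base Y) e)" "gwalk (base Y\<lparr>arcs := T\<rparr>) ?u' w v"
      using Cons.prems by (auto simp: a split: if_splits)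
    have "e \<in> arcs (base Y)" using w(1) T by blast
    then have "linked X (b u) (b ?u')"
      using tree_edge[OF w(1)] linked_sym[OF tree_edge[OF w(1)]] bX base_ends w(2) by auto
    then show ?case using Cons.IH[OF w(3)] by (rule linked_trans)
  qed
  have base: "linked X (b u) (b v)" if uv: "u \<in> verts (base Y)" "v \<in> verts (base Y)" for u v
  proof -
    obtain w where "gwalk (base Y\<lparr>arcs := T\<rparr>) u w v"
      using T(2) uv by (auto simp: connected_graph_def)
    then show ?thesis by (rule walk)
  qed
  obtain v0 where v0: "v0 \<in> verts (base Y)" using gog_facts(2) by (auto simp: connected_graph_def)
  \<comment> \<open>It suffices that \<open>L\<close> is closed under products and inverses and
    contains the image of each letter, since every group element is represented by a word.\<close>
  define L where "L = {g \<in> carrier G. linked X (b v0) (vact g (b v0))}"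
  have L_mult: "g \<otimes> h \<in> L" if "g \<in> L" "h \<in> L" for g h
  proof -
    have gh: "g \<in> carrier G" "h \<in> carrier G" "linked X (b v0) (vact g (b v0))" "linked X (b v0) (vact h (b v0))"
      using that by (auto simp: L_def)
    have "linked X (vact g (b v0)) (vact g (vact h (b v0)))"
      by (rule linked_act[OF gh(1,4) bX[OF v0]])
    with gh(3) have "linked X (b v0) (vact g (vact h (b v0)))" by (rule linked_trans)
    then show ?thesis using gh bX[OF v0] by (simp add: L_def V.act_mult)
  qed
  have L_inv: "inv g \<in> L" if "g \<in> L" for g
  proof -
    have g: "g \<in> carrier G" "linked X (b v0) (vact g (b v0))" using that by (auto simp: L_def)
    have "linked X (vact (inv g) (b v0)) (vact (inv g) (vact g (b v0)))"
      by (rule linked_act[OF inv_closed[OF g(1)] g(2) bX[OF v0]])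
    then have "linked X (vact (inv g) (b v0)) (b v0)"
      using g(1) bX[OF v0] V.act_mult[of "inv g" g "b v0"] by (simp add: V.act_one)
    then have "linked X (b v0) (vact (inv g) (b v0))"
      by (rule linked_sym[OF _ V.act_closed[OF inv_closed[OF g(1)] bX[OF v0]]])
    then show ?thesis using g by (simp add: L_def)
  qed
  have L_edge: "stab_letter e \<in> L" if e: "e \<in> arcs (base Y)" for e
  proof -
    note be = base_ends[OF e] and t = stab_letter_closed[OF e]
    have "linked X (b v0) (vact (stab_letter e) (b (head (base Y) e)))"
      by (rule linked_trans[OF base[OF v0 be(1)] edge[OF e]])
    from linked_trans[OF this linked_act[OF t base[OF be(2) v0] bX[OF be(2)]]]
    show ?thesis using t by (simp add: L_def)
  qed
  \<comment> \<open>A vertex group element fixes \<open>b v\<close>; a path from \<open>b v0\<close>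
    to \<open>b v\<close> followed by a translate of a path back reaches the translate of
    \<open>b v0\<close>.\<close>
  have L_vert: "k \<in> L" if v: "v \<in> verts (base Y)" and k: "k \<in> vsub v" for v k
  proof -
    note V = vsub_subgroup[OF v]
    have kG: "k \<in> carrier G" by (rule subgroup.mem_carrier[OF V k])
    have "k <#\<^bsub>G\<^esub> vsub v = \<one> <#\<^bsub>G\<^esub> vsub v"
      using coset_join3[OF kG V k] lcos_mult_one[OF subgroup.subset[OF V]] by simp
    then have "vact k (b v) = b v" using act_b[OF v kG] by (simp add: b_def)
    then have "linked X (b v0) (vact k (b v0))"
      using linked_trans[OF base[OF v0 v]] linked_act[OF kG base[OF v v0] bX[OF v]] by simp
    then show ?thesis using kG by (simp add: L_def)
  qed
  have L_letter: "elt [x] \<in> L" if x: "x \<in> letters Y" for x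
  proof (cases x)
    case (Vert v a)
    then show ?thesis using x L_vert[of v] by (auto simp: letters_def vsub_eq)
  next
    case (Edge e)
    then show ?thesis using x L_edge[of e] by (auto simp: letters_def stab_letter_eq)
  next
    case (Edge_inv e)
    then show ?thesis using x L_inv[OF L_edge[of e]] stab_letter_inv[of e] by (auto simp: letters_def)
  qed
  have L_word: "elt w \<in> L" if "w \<in> words" for w
    using that
  proof (induction w)
    case Nil
    then show ?case using linked_self bX[OF v0] by (simp add: elt_Nil L_def V.act_one)
  next
    case (Cons x w)
    then show ?case using elt_append[of "[x]" w] L_mult L_letter by simp
  qed
  have all: "linked X (b v0) x" if xX: "x \<in> verts X" for x
  proof -
    obtain v g where v: "v \<in> verts (base Y)" and g: "g \<in> carrier G" and x: "x = (v, g <#\<^bsub>G\<^esub> vsub v)"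
      using xX unfolding tree_sets by (auto simp: coset_space_def)
    have "g \<in> L" using elt_surj[OF g] L_word by metis
    then have "linked X (b v0) (vact g (b v0))" by (simp add: L_def)
    from linked_trans[OF this linked_act[OF g base[OF v0 v] bX[OF v0]]]
    show ?thesis by (simp add: act_b[OF v g] x)
  qed
  have "linked X u v" if "u \<in> verts X" "v \<in> verts X" for u v
    using linked_trans[OF linked_sym[OF all[OF that(1)] bX[OF v0]] all[OF that(2)]] .
  then show ?thesis using bX[OF v0] by (auto simp: connected_graph_def linked_def)
qed

end

section \<open>The identity in K-theory\<close>

theorem corollaryB:
  fixes G :: "('g, 'b) monoid_scheme"
    and Y :: "('v, 'e, 'h, 'k) graph_of_groups"
    and T :: "'e set"
    and \<psi> :: "('v, 'e, 'h) letter list set \<Rightarrow> 'g"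
    and l\<^sub>v :: "('v \<times> 'g set) set \<Rightarrow> 'v \<times> 'g set"
    and l\<^sub>e :: "('e \<times> 'g set) set \<Rightarrow> 'e \<times> 'g set"
    and es :: "('e \<times> 'g set) set list"
  defines "X \<equiv> bass_serre_tree G Y T \<psi>"
  defines "\<alpha> \<equiv> coset_action G (verts X)"
  defines "\<beta> \<equiv> coset_action G (arcs X)"
  defines "A \<equiv> reduced_cstar G"
  defines "p\<^sub>1 \<equiv> kazhdan_projection1 G X \<alpha> \<beta> l\<^sub>v l\<^sub>e es"
  assumes "group G" and "finitely_generated G" and "virtually_free G" and "\<not> amenable G"
    and "finite_graph_of_finite_groups Y" and "maximal_tree (base Y) T"
    and "\<psi> \<in> iso (fundamental_group Y T) G"
    and "orbit_lift G (verts X) \<alpha> l\<^sub>v" and "orbit_lift G (arcs X) \<beta> l\<^sub>e"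
    and "distinct es" and "set es = orbits G (arcs X) \<beta>"
  shows "K0_class A p\<^sub>1 \<in> carrier (K0 A) \<and>
    inv\<^bsub>K0 A\<^esub> (K0_class A p\<^sub>1) =
      (\<Otimes>\<^bsub>K0 A\<^esub>R \<in> orbits G (verts X) \<alpha>.
          K0_class A (mat 1 1 (\<lambda>_. averaging G (stabilizer G \<alpha> (l\<^sub>v R)))))
      \<otimes>\<^bsub>K0 A\<^esub> inv\<^bsub>K0 A\<^esub>
      (\<Otimes>\<^bsub>K0 A\<^esub>R \<in> orbits G (arcs X) \<beta>.
          K0_class A (mat 1 1 (\<lambda>_. averaging G (stabilizer G \<beta> (l\<^sub>e R)))))"
proof -
  interpret bs: bass_serre G Y T \<psi>
    using assms by (simp add: bass_serre_def bass_serre_axioms_def)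
  have "finite (orbits G (verts X) \<alpha>)"
    unfolding \<alpha>_def X_def bs.tree_sets
    by (rule bs.finite_orbits_coset_space)
      (use bs.gog_facts(1) in \<open>auto simp: fin_digraph_def fin_digraph_axioms_def dest: subgroup.mem_carrier[OF bs.vsub_subgroup]\<close>)
  \<comment> \<open>Any enumeration of the vertex orbits will do: it only indexes the matrices, and
    the class of their diagonal projection is a product over the set of orbits.\<close>
  then obtain vs where vs: "distinct vs" "set vs = orbits G (verts X) \<alpha>"
    using finite_distinct_list by blast
  have eq: "equivariant_graph G X \<alpha> l\<^sub>v vs \<beta> l\<^sub>e es"
    using assms vs unfolding X_def \<alpha>_def \<beta>_def by (intro bs.equivariant_tree)
  then interpret eg: equivariant_graph G X \<alpha> l\<^sub>v vs \<beta> l\<^sub>e es .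
  have con: "connected_graph X"
    using eq unfolding X_def \<alpha>_def \<beta>_def by (rule bs.connected_tree)
  note kp = eg.kazhdan_projection_class[OF con \<open>finitely_generated G\<close> \<open>\<not> amenable G\<close>,
      folded A_def p\<^sub>1_def]
  interpret C: star_subring A unfolding A_def by (rule bs.star_subring_reduced_cstar)
  interpret K: comm_group "K0 A" by (rule C.K0_comm_group)
  let ?p = "K0_class A p\<^sub>1" and ?v = "K0_class A eg.V.proj_mat" and ?e = "K0_class A eg.E.proj_mat"
  have car: "?p \<in> carrier (K0 A)" "?v \<in> carrier (K0 A)"
    using kp(1) C.projectionsI[OF eg.V.proj_mat_mem[folded A_def] eg.V.proj_mat_star eg.V.proj_mat_idem]
    by (auto intro: C.K0_class_carrier)
  \<comment> \<open>The relation between the three classes is inverted and the vertex class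
    cancelled on one side; this moves the Kazhdan class across with the minus sign of the
    formula.\<close>
  have "inv\<^bsub>K0 A\<^esub> ?e = inv\<^bsub>K0 A\<^esub> ?p \<otimes>\<^bsub>K0 A\<^esub> inv\<^bsub>K0 A\<^esub> ?v"
    unfolding kp(2) using car by (rule K.inv_mult_group[rotated])
  then have "inv\<^bsub>K0 A\<^esub> ?p = ?v \<otimes>\<^bsub>K0 A\<^esub> inv\<^bsub>K0 A\<^esub> ?e"
    using car by (simp add: K.m_lcomm)
  then show ?thesis
    using car(1) unfolding eg.V.K0_class_proj_mat[folded A_def] eg.E.K0_class_proj_mat[folded A_def] by blast
qed

end
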